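(* Suppose that $F$ satisfies conditions (P1), (P2), (P3), (G1), (G2$_\infty$) and (G3) of the context. Then the operator $\overline{\mathrm F}_{\Phi,h}:\mathbf S^\infty\to\mathbf S^\infty$ admits a decomposition $\overline{\mathrm F}_{\Phi,h}=\mathrm P+\mathrm N$, where: (a) $\mathrm P$ is a projection of rank one, that is, $\mathrm P^2=\mathrm P$ and $\dim\operatorname{Im}(\mathrm P)=1$; (b) there exist constants $0<\xi_2<1$ and $R_2>0$ such that, for all $\mu\in\mathbf S^\infty$, $\|\mathrm N^n(\mu)\|_{\mathbf S^\infty}\le R_2\,\xi_2^n\|\mu\|_{\mathbf S^\infty}$ for all $n\ge1$; (c) $\mathrm P\mathrm N=\mathrm N\mathrm P=0$.
   Context: Setting. $M$ is a complete separable metric space and $K$ a compact metric space (Borel $\sigma$-algebras), $\Sigma=M\times K$, and $F:\Sigma\to\Sigma$, $F(x,y)=(f(x),G(x,y))$, with $f:M\to M$ and $G:\Sigma\to K$ measurable. $\pi_1(x,y)=x$, $\pi_2(x,y)=y$; a subscript $*$ denotes push-forward of measures. (P1) There is a class $\mathscr P_M$ of potentials $\varphi:M\to\mathbb R$ such that for each $\varphi\in\mathscr P_M$: (P1.1) there is an equilibrium state $m=m(\varphi)$ of $f$ for $\varphi$ (a probability measure) of the form $m=h\,\nu$ with $0<\inf h\le\sup h<\infty$ and $\mathcal L_\varphi h=\lambda h$ for some $\lambda>0$, where $\mathcal L_\varphi g(x)=\sum_{y\in f^{-1}(x)}g(y)e^{\varphi(y)}$, and $\nu$ is a conformal measure with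 Jacobian $\lambda e^{-\varphi}$ (i.e. $\nu(f(A))=\int_A\lambda e^{-\varphi}d\nu$ for measurable $A$ on which $f$ is injective); (P1.2) there are normed spaces (not necessarily Banach) of real functions on $M$, closed under pointwise multiplication, $h,h^{-1}\in(B_s,|\cdot|_s)\subset(B_w,|\cdot|_w)$, $|\cdot|_w\le|\cdot|_s$, such that $\mathcal L_\varphi:B_s\to B_s$ has spectrum $\{\lambda\}\cup\mathcal U$ with $\mathcal U$ contained in a disk of radius strictly smaller than $|\lambda|$; in particular $\overline{\mathcal L}_\varphi:=\lambda^{-1}\mathcal L_\varphi=\mathcal P_f+\mathcal N_f$ with $\mathcal P_f^2=\mathcal P_f$, $\dim\operatorname{Im}\mathcal P_f=1$, $\mathcal N_f\mathcal P_f=\mathcal P_f\mathcal N_f=0$, and there are $C_0>0$, $0\le r<1$ with $|\mathcal N_f^n g|_s\le C_0r^n|g|_s$ for all $g\in B_s$, $n\ge1$. Consequently $\overline{\mathcal L}_\varphi^*\nu=\nu$. (P2) There is a measurable partition of $M$ (up to $\nu$-null sets) into disjoint sets $P_1,\dots,P_{\deg(f)}$ such that each $f|_{P_i}:P_i\to M$ is a bijection and $\nu(\bigcup_iP_i)=\nu(M)$. Fix $\varphi\in\mathscr P_M$ with its $m,h,\nu,\lambda$, and let $\Phi=\varphi\circ\pi_1$. (P3) There is an $F$-invariant probability measure $\mu_0$ with $\pi_{1*}\mu_0=m$. A point $\gamma\in M$ is identified with the fibre $\{\gamma\}\times K$, and $F_\gamma:K\to K$ is $F_\gamma(y)=G(\gamma,y)$.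 (G1) There are a norm $\|\cdot\|_o$ on the space $\mathcal{SM}(K)$ of finite signed Borel measures on $K$ and $0\le\alpha<1$ such that, for every $\mu\in\mathcal{SM}(K)$: $\|F_{\gamma*}\mu\|_o\le\alpha\|\mu\|_o+|\mu(K)|$ for $\nu$-a.e. $\gamma$, and $\|F_{\gamma*}\mu\|_o\le\|\mu\|_o$ for every $\gamma$. (G3) $\|\mu\|_o=1$ for every probability measure $\mu$ on $K$. Measures and spaces. For a finite signed Borel measure $\mu$ on $\Sigma$ with Jordan decomposition $\mu=\mu^+-\mu^-$, write $\mu\in\mathbf{AB}_m$ if $\pi_{1*}\mu^\pm\ll m$. For positive $\mu\in\mathbf{AB}_m$ let $(\{\mu_\gamma\}_\gamma,\phi_1m)$ be its (Rokhlin) disintegration along the fibres, $\mu_\gamma$ probability measures and $\phi_1=d\pi_{1*}\mu/dm$; the restriction $\mu|_\gamma$ is the measure $\phi_1(\gamma)\,\pi_{2*}\mu_\gamma$ on $K$. For signed $\mu$: $\mu|_\gamma=\mu^+|_\gamma-\mu^-|_\gamma$ and $\phi_1=\phi_1^+-\phi_1^-$. Set $\|\mu\|_\infty=\operatorname{ess\,sup}_{\gamma}\|\mu|_\gamma\|_o$ (with respect to $m$), $\mathbf L^\infty=\{\mu\in\mathbf{AB}_m:\|\mu\|_\infty<\infty\}$, $\mathbf S^\infty=\{\mu\in\mathbf L^\infty:\phi_1\in B_s\}$, $\|\mu\|_{\mathbf S^\infty}=|\phi_1|_s+\|\mu\|_\infty$. (G2$_\infty$) $B_w\subset L^\infty_\nu$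 and for every $\mu\in\mathbf L^\infty$ its marginal density satisfies $|\phi_1|_\infty\le|\phi_1|_w\le\|\mu\|_\infty$ (in particular $|\phi_1|_w$ is assumed defined). Operators. $\mathcal L_{\varphi,h}(g)=\mathcal L_\varphi(gh)/h$. For a.e. $\gamma$ let $\gamma_i\in P_i$ be the point with $f(\gamma_i)=\gamma$. $\mathrm F_{\Phi,h}:\mathbf{AB}_m\to\mathbf{AB}_m$ is the linear operator such that, for positive $\mu$, the marginal of $\mathrm F_{\Phi,h}\mu$ is $\mathcal L_{\varphi,h}(\phi_1)m$ and its conditional measure on the fibre over $\gamma$ is $\frac{1}{h(\gamma)\mathcal L_{\varphi,h}(\phi_1)(\gamma)}\sum_i\phi_1(\gamma_i)h(\gamma_i)e^{\varphi(\gamma_i)}F_*\mu_{\gamma_i}$ where $\mathcal L_{\varphi,h}(\phi_1)(\gamma)\ne0$ (a fixed probability elsewhere). Equivalently, for all $\mu$ and a.e. $\gamma$, $(\mathrm F_{\Phi,h}\mu)|_\gamma=\frac1{h(\gamma)}\sum_{i=1}^{\deg(f)}h(\gamma_i)e^{\varphi(\gamma_i)}F_{\gamma_i*}(\mu|_{\gamma_i})$. Put $\overline{\mathrm F}_{\Phi,h}=\lambda^{-1}\mathrm F_{\Phi,h}$.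
   Formalization: Two corrections: in (G1) the ν-null set of exceptional γ is the same for all μ, and in (P1.2) multiplication by h and by 1/h is assumed bounded on (B_s,|·|_s); without either one the claim fails. *)

theory Defs
  imports "HOL-Probability.Probability"
begin

section \<open>Finite signed Borel measures\<close>

typedef (overloaded) 'a signed_measure =
  "{\<mu> :: 'a::topological_space set \<Rightarrow> real.
      (\<forall>A. A \<notin> sets borel \<longrightarrow> \<mu> A = 0) \<and>
      (\<forall>A. range A \<subseteq> sets borel \<longrightarrow> disjoint_family A \<longrightarrow> (\<lambda>i::nat. \<mu> (A i)) sums \<mu> (\<Union>i. A i))}"
  morphisms sm Abs_sm
  by (rule exI[of _ "\<lambda>_. 0"]) auto

setup_lifting type_definition_signed_measure

instantiation signed_measure :: (topological_space) real_vector
begin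

lift_definition zero_signed_measure :: "'a signed_measure" is "\<lambda>_. 0"
  by auto

lift_definition plus_signed_measure :: "'a signed_measure \<Rightarrow> 'a signed_measure \<Rightarrow> 'a signed_measure"
  is "\<lambda>\<mu> \<eta> A. \<mu> A + \<eta> A"
  by (auto intro!: sums_add)

lift_definition minus_signed_measure :: "'a signed_measure \<Rightarrow> 'a signed_measure \<Rightarrow> 'a signed_measure"
  is "\<lambda>\<mu> \<eta> A. \<mu> A - \<eta> A"
  by (auto intro!: sums_diff)

lift_definition uminus_signed_measure :: "'a signed_measure \<Rightarrow> 'a signed_measure"
  is "\<lambda>\<mu> A. - \<mu> A"
  by (auto intro!: sums_minus)

lift_definition scaleR_signed_measure :: "real \<Rightarrow> 'a signed_measure \<Rightarrow> 'a signed_measure"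
  is "\<lambda>c \<mu> A. c * \<mu> A"
  by (auto intro!: sums_mult)

instance
  by standard (transfer; simp add: algebra_simps)+

end

definition sm_of :: "'a::topological_space measure \<Rightarrow> 'a signed_measure" where
  "sm_of Q = Abs_sm (measure Q)"

lemma sm_sm_of:
  assumes "finite_measure Q" "sets Q = sets borel"
  shows "sm (sm_of Q) A = measure Q A"
proof -
  interpret finite_measure Q by fact
  have "measure Q \<in> {\<mu>. (\<forall>A. A \<notin> sets borel \<longrightarrow> \<mu> A = 0) \<and>
      (\<forall>A. range A \<subseteq> sets borel \<longrightarrow> disjoint_family A \<longrightarrow> (\<lambda>i::nat. \<mu> (A i)) sums \<mu> (\<Union>i. A i))}"
    using assms(2) by (auto simp: measure_notin_sets intro!: finite_measure_UNION)
  then show ?thesis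
    unfolding sm_of_def by (simp add: Abs_sm_inverse)
qed

definition sm_push ::
  "('a::topological_space \<Rightarrow> 'b::topological_space) \<Rightarrow> 'a signed_measure \<Rightarrow> 'b signed_measure" where
  "sm_push g \<mu> = Abs_sm (\<lambda>A. if A \<in> sets borel then sm \<mu> (g -` A) else 0)"

lemma sm_sm_push:
  assumes g: "g \<in> borel_measurable borel" and A: "A \<in> sets borel"
  shows "sm (sm_push g \<mu>) A = sm \<mu> (g -` A)"
proof -
  have vim: "g -` B \<in> sets borel" if "B \<in> sets borel" for B
    using measurable_sets[OF g that] by simp
  have "(\<lambda>i::nat. if A i \<in> sets borel then sm \<mu> (g -` A i) else 0) sums
        (if (\<Union>i. A i) \<in> sets borel then sm \<mu> (g -` (\<Union>i. A i)) else 0)"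
    if A: "range A \<subseteq> sets borel" "disjoint_family A" for A
  proof -
    have "(\<lambda>i. sm \<mu> (g -` A i)) sums sm \<mu> (\<Union>i. g -` A i)"
    proof -
      have "range (\<lambda>i. g -` A i) \<subseteq> sets borel" "disjoint_family (\<lambda>i. g -` A i)"
        using A vim by (auto simp: disjoint_family_on_def)
      then show ?thesis
        using sm[of \<mu>] by blast
    qed
    moreover have "A i \<in> sets borel" for i
      using A by auto
    moreover have "(\<Union>i. A i) \<in> sets borel"
      using A by auto
    ultimately show ?thesis
      by (simp add: vimage_UN)
  qed
  then have "(\<lambda>A. if A \<in> sets borel then sm \<mu> (g -` A) else 0) \<in> {\<mu>.
      (\<forall>A. A \<notin> sets borel \<longrightarrow> \<mu> A = 0) \<and>
      (\<forall>A. range A \<subseteq> sets borel \<longrightarrow> disjoint_family A \<longrightarrow> (\<lambda>i::nat. \<mu> (A i)) sums \<mu> (\<Union>i. A i))}"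
    by simp
  then show ?thesis
    unfolding sm_push_def using A by (simp add: Abs_sm_inverse)
qed

definition jordan_decomposition ::
  "'a::topological_space signed_measure \<Rightarrow> 'a measure \<Rightarrow> 'a measure \<Rightarrow> bool" where
  "jordan_decomposition \<mu> Q R \<longleftrightarrow>
     finite_measure Q \<and> finite_measure R \<and> sets Q = sets borel \<and> sets R = sets borel \<and>
     \<mu> = sm_of Q - sm_of R \<and>
     (\<exists>D\<in>sets borel. emeasure Q (- D) = 0 \<and> emeasure R D = 0)"

definition pos_part :: "'a::topological_space signed_measure \<Rightarrow> 'a measure" where
  "pos_part \<mu> = (THE Q. \<exists>R. jordan_decomposition \<mu> Q R)"

definition neg_part :: "'a::topological_space signed_measure \<Rightarrow> 'a measure" where
  "neg_part \<mu> = (THE R. \<exists>Q. jordan_decomposition \<mu> Q R)"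

definition is_norm :: "('v::real_vector \<Rightarrow> real) \<Rightarrow> bool" where
  "is_norm N \<longleftrightarrow>
     (\<forall>u. 0 \<le> N u) \<and> (\<forall>u. N u = 0 \<longleftrightarrow> u = 0) \<and>
     (\<forall>u v. N (u + v) \<le> N u + N v) \<and> (\<forall>c u. N (c *\<^sub>R u) = \<bar>c\<bar> * N u)"

text \<open>The library's \<open>esssup\<close> is \<open>\<infinity>\<close> on functions that are not measurable; below, the essential
  supremum is also taken of fibrewise norms, whose measurability is not assumed.\<close>

definition ess_sup :: "'a measure \<Rightarrow> ('a \<Rightarrow> real) \<Rightarrow> ereal" where
  "ess_sup M u = Inf {c. AE x in M. ereal (u x) \<le> c}"


section \<open>Equilibrium states\<close>

definition invariant_prob :: "('a::topological_space \<Rightarrow> 'a) \<Rightarrow> 'a measure \<Rightarrow> bool" where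
  "invariant_prob f \<mu> \<longleftrightarrow> prob_space \<mu> \<and> sets \<mu> = sets borel \<and> distr \<mu> borel f = \<mu>"

text \<open>A finite measurable partition is given by a measurable labelling with finitely many values.
  The labelling \<open>x \<mapsto> [\<xi> x, \<xi> (f x), \<dots>, \<xi> (f\<^sup>n\<^sup>-\<^sup>1 x)]\<close> gives the join of the first \<open>n\<close> preimages of
  the partition.\<close>

definition partition_entropy :: "'a measure \<Rightarrow> ('a \<Rightarrow> 'l) \<Rightarrow> real" where
  "partition_entropy \<mu> \<xi> =
     (\<Sum>a\<in>range \<xi>. - (measure \<mu> (\<xi> -` {a}) * ln (measure \<mu> (\<xi> -` {a}))))"

definition dynamical_entropy :: "('a \<Rightarrow> 'a) \<Rightarrow> 'a measure \<Rightarrow> ('a \<Rightarrow> nat) \<Rightarrow> real" where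
  "dynamical_entropy f \<mu> \<xi> =
     lim (\<lambda>n. partition_entropy \<mu> (\<lambda>x. map (\<lambda>i. \<xi> ((f ^^ i) x)) [0..<n]) / real n)"

definition ks_entropy :: "('a::topological_space \<Rightarrow> 'a) \<Rightarrow> 'a measure \<Rightarrow> ereal" where
  "ks_entropy f \<mu> =
     (SUP \<xi>\<in>{\<xi>. \<xi> \<in> measurable borel (count_space UNIV) \<and> finite (range \<xi>)}.
        ereal (dynamical_entropy f \<mu> \<xi>))"

definition equilibrium_state ::
  "('a::topological_space \<Rightarrow> 'a) \<Rightarrow> ('a \<Rightarrow> real) \<Rightarrow> 'a measure \<Rightarrow> bool" where
  "equilibrium_state f \<phi> \<mu> \<longleftrightarrow>
     invariant_prob f \<mu> \<and> integrable \<mu> \<phi> \<and>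
     ks_entropy f \<mu> + ereal (integral\<^sup>L \<mu> \<phi>) =
       (SUP \<eta>\<in>{\<eta>. invariant_prob f \<eta> \<and> integrable \<eta> \<phi>}. ks_entropy f \<eta> + ereal (integral\<^sup>L \<eta> \<phi>))"


section \<open>The transfer operator of the base map\<close>

definition transfer :: "('a \<Rightarrow> 'a) \<Rightarrow> ('a \<Rightarrow> real) \<Rightarrow> ('a \<Rightarrow> real) \<Rightarrow> 'a \<Rightarrow> real" where
  "transfer f \<phi> g x = (\<Sum>\<^sub>\<infinity>y\<in>f -` {x}. g y * exp (\<phi> y))"

text \<open>The operator \<open>g \<mapsto> \<L>\<^sub>\<phi> (g h) / h\<close>.\<close>

definition transfer_h ::
  "('a \<Rightarrow> 'a) \<Rightarrow> ('a \<Rightarrow> real) \<Rightarrow> ('a \<Rightarrow> real) \<Rightarrow> ('a \<Rightarrow> real) \<Rightarrow> 'a \<Rightarrow> real" where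
  "transfer_h f \<phi> h g x = transfer f \<phi> (\<lambda>y. g y * h y) x / h x"

text \<open>The image of a Borel set under an injective Borel map between Polish spaces is Borel
  (Lusin--Souslin); this is recorded here as part of the meaning of \<open>\<nu> (f ` A)\<close>.\<close>

definition conformal_measure ::
  "('a::topological_space \<Rightarrow> 'a) \<Rightarrow> ('a \<Rightarrow> real) \<Rightarrow> real \<Rightarrow> 'a measure \<Rightarrow> bool" where
  "conformal_measure f \<phi> l \<nu> \<longleftrightarrow>
     sets \<nu> = sets borel \<and> \<phi> \<in> borel_measurable borel \<and>
     (\<forall>A\<in>sets borel. inj_on f A \<longrightarrow>
        f ` A \<in> sets borel \<and>
        emeasure \<nu> (f ` A) = (\<integral>\<^sup>+x\<in>A. ennreal (l * exp (- \<phi> x)) \<partial>\<nu>))"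

definition equilibrium_data ::
  "('a::topological_space \<Rightarrow> 'a) \<Rightarrow> ('a \<Rightarrow> real) \<Rightarrow> 'a measure \<Rightarrow> ('a \<Rightarrow> real) \<Rightarrow> 'a measure \<Rightarrow> real \<Rightarrow> bool" where
  "equilibrium_data f \<phi> m h \<nu> l \<longleftrightarrow>
     equilibrium_state f \<phi> m \<and>
     conformal_measure f \<phi> l \<nu> \<and>
     h \<in> borel_measurable borel \<and>
     bdd_below (range h) \<and> bdd_above (range h) \<and> 0 < Inf (range h) \<and>
     m = density \<nu> (\<lambda>x. ennreal (h x)) \<and>
     0 < l \<and> (AE x in \<nu>. transfer f \<phi> h x = l * h x)"


section \<open>Normed spaces of functions modulo null sets\<close>

text \<open>The function spaces sit inside \<open>L\<^sup>\<infinity>(\<nu>)\<close>, so their elements are classes of functions modulo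
  \<open>\<nu>\<close>-a.e. equality. A space of classes is represented by the set of all representatives of its
  elements; its norm is a functional on representatives that vanishes exactly on the zero class
  (hence depends only on the class), and identities between elements hold \<open>\<nu>\<close>-a.e.\<close>

definition normed_function_space ::
  "'a measure \<Rightarrow> ('a \<Rightarrow> real) set \<Rightarrow> (('a \<Rightarrow> real) \<Rightarrow> real) \<Rightarrow> bool" where
  "normed_function_space \<nu> B N \<longleftrightarrow>
     (\<lambda>_. 0) \<in> B \<and>
     (\<forall>g\<in>B. \<forall>g'\<in>B. (\<lambda>x. g x + g' x) \<in> B) \<and>
     (\<forall>c. \<forall>g\<in>B. (\<lambda>x. c * g x) \<in> B) \<and>
     (\<forall>g\<in>B. \<forall>g'. (AE x in \<nu>. g x = g' x) \<longrightarrow> g' \<in> B) \<and>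
     (\<forall>g\<in>B. 0 \<le> N g \<and> (N g = 0 \<longleftrightarrow> (AE x in \<nu>. g x = 0))) \<and>
     (\<forall>g\<in>B. \<forall>g'\<in>B. N (\<lambda>x. g x + g' x) \<le> N g + N g') \<and>
     (\<forall>c. \<forall>g\<in>B. N (\<lambda>x. c * g x) = \<bar>c\<bar> * N g)"

definition function_space_operator ::
  "'a measure \<Rightarrow> ('a \<Rightarrow> real) set \<Rightarrow> (('a \<Rightarrow> real) \<Rightarrow> 'a \<Rightarrow> real) \<Rightarrow> bool" where
  "function_space_operator \<nu> B T \<longleftrightarrow>
     (\<forall>g\<in>B. T g \<in> B) \<and>
     (\<forall>g\<in>B. \<forall>g'\<in>B. (AE x in \<nu>. g x = g' x) \<longrightarrow> (AE x in \<nu>. T g x = T g' x)) \<and>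
     (\<forall>a b. \<forall>g\<in>B. \<forall>g'\<in>B. AE x in \<nu>. T (\<lambda>y. a * g y + b * g' y) x = a * T g x + b * T g' x)"

text \<open>Spectrum of an operator on a real space, taken on the complexification: with \<open>z = a + ib\<close>, the
  element \<open>u + iv\<close> solves \<open>(z - T) (u + iv) = p + iq\<close> iff \<open>a u - b v - T u = p\<close> and
  \<open>a v + b u - T v = q\<close>. As the space need not be complete, boundedness of the inverse is required
  explicitly.\<close>

definition resolvent_solution ::
  "'a measure \<Rightarrow> (('a \<Rightarrow> real) \<Rightarrow> 'a \<Rightarrow> real) \<Rightarrow> complex \<Rightarrow>
    ('a \<Rightarrow> real) \<Rightarrow> ('a \<Rightarrow> real) \<Rightarrow> ('a \<Rightarrow> real) \<Rightarrow> ('a \<Rightarrow> real) \<Rightarrow> bool" where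
  "resolvent_solution \<nu> T z p q u v \<longleftrightarrow>
     (AE x in \<nu>. Re z * u x - Im z * v x - T u x = p x) \<and>
     (AE x in \<nu>. Re z * v x + Im z * u x - T v x = q x)"

definition resolvent_set ::
  "'a measure \<Rightarrow> ('a \<Rightarrow> real) set \<Rightarrow> (('a \<Rightarrow> real) \<Rightarrow> real) \<Rightarrow> (('a \<Rightarrow> real) \<Rightarrow> 'a \<Rightarrow> real) \<Rightarrow> complex set" where
  "resolvent_set \<nu> B N T =
     {z. \<exists>C. \<forall>p\<in>B. \<forall>q\<in>B.
           (\<exists>u\<in>B. \<exists>v\<in>B. resolvent_solution \<nu> T z p q u v) \<and>
           (\<forall>u\<in>B. \<forall>v\<in>B. resolvent_solution \<nu> T z p q u v \<longrightarrow> N u + N v \<le> C * (N p + N q))}"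

text \<open>The bound in \<open>resolvent_set\<close> with \<open>p = q = 0\<close> gives injectivity of \<open>z - T\<close>.\<close>

definition spectrum ::
  "'a measure \<Rightarrow> ('a \<Rightarrow> real) set \<Rightarrow> (('a \<Rightarrow> real) \<Rightarrow> real) \<Rightarrow> (('a \<Rightarrow> real) \<Rightarrow> 'a \<Rightarrow> real) \<Rightarrow> complex set" where
  "spectrum \<nu> B N T = - resolvent_set \<nu> B N T"

text \<open>The function \<open>g\<^sub>0\<close> expresses that the image of \<open>Pf\<close> is one-dimensional modulo null functions.\<close>

definition spectral_decomposition ::
  "'a measure \<Rightarrow> ('a \<Rightarrow> real) set \<Rightarrow> (('a \<Rightarrow> real) \<Rightarrow> real) \<Rightarrow> (('a \<Rightarrow> real) \<Rightarrow> 'a \<Rightarrow> real) \<Rightarrow>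
    (('a \<Rightarrow> real) \<Rightarrow> 'a \<Rightarrow> real) \<Rightarrow> (('a \<Rightarrow> real) \<Rightarrow> 'a \<Rightarrow> real) \<Rightarrow> bool" where
  "spectral_decomposition \<nu> B N T Pf Nf \<longleftrightarrow>
     function_space_operator \<nu> B Pf \<and> function_space_operator \<nu> B Nf \<and>
     (\<forall>g\<in>B. AE x in \<nu>. T g x = Pf g x + Nf g x) \<and>
     (\<forall>g\<in>B. AE x in \<nu>. Pf (Pf g) x = Pf g x) \<and>
     (\<exists>g\<^sub>0\<in>B. \<not> (AE x in \<nu>. Pf g\<^sub>0 x = 0) \<and> (\<forall>g\<in>B. \<exists>c. AE x in \<nu>. Pf g x = c * Pf g\<^sub>0 x)) \<and>
     (\<forall>g\<in>B. (AE x in \<nu>. Nf (Pf g) x = 0) \<and> (AE x in \<nu>. Pf (Nf g) x = 0)) \<and>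
     (\<exists>C\<^sub>0 r. 0 < C\<^sub>0 \<and> 0 \<le> r \<and> r < 1 \<and> (\<forall>g\<in>B. \<forall>n\<ge>1. N ((Nf ^^ n) g) \<le> C\<^sub>0 * r ^ n * N g))"

text \<open>Closure under multiplication alone does not make multiplication by \<open>h\<close> and \<open>1 / h\<close> continuous
  on \<open>(Bs, ns)\<close> unless that space is complete, so this continuity is stated separately.\<close>

definition spectral_gap_data ::
  "('a \<Rightarrow> 'a) \<Rightarrow> ('a \<Rightarrow> real) \<Rightarrow> ('a \<Rightarrow> real) \<Rightarrow> 'a measure \<Rightarrow> real \<Rightarrow>
    ('a \<Rightarrow> real) set \<Rightarrow> (('a \<Rightarrow> real) \<Rightarrow> real) \<Rightarrow> ('a \<Rightarrow> real) set \<Rightarrow> (('a \<Rightarrow> real) \<Rightarrow> real) \<Rightarrow> bool" where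
  "spectral_gap_data f \<phi> h \<nu> l Bs ns Bw nw \<longleftrightarrow>
     normed_function_space \<nu> Bs ns \<and> normed_function_space \<nu> Bw nw \<and>
     (\<forall>g\<in>Bs. \<forall>g'\<in>Bs. (\<lambda>x. g x * g' x) \<in> Bs) \<and>
     (\<forall>g\<in>Bw. \<forall>g'\<in>Bw. (\<lambda>x. g x * g' x) \<in> Bw) \<and>
     h \<in> Bs \<and> (\<lambda>x. 1 / h x) \<in> Bs \<and>
     (\<exists>C. \<forall>g\<in>Bs. ns (\<lambda>x. g x * h x) \<le> C * ns g \<and> ns (\<lambda>x. g x * (1 / h x)) \<le> C * ns g) \<and>
     Bs \<subseteq> Bw \<and> (\<forall>g\<in>Bs. nw g \<le> ns g) \<and>
     function_space_operator \<nu> Bs (transfer f \<phi>) \<and>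
     (\<exists>U \<rho>. spectrum \<nu> Bs ns (transfer f \<phi>) = insert (of_real l) U \<and> U \<subseteq> cball 0 \<rho> \<and> \<rho> < \<bar>l\<bar>) \<and>
     (\<exists>Pf Nf. spectral_decomposition \<nu> Bs ns (\<lambda>g x. transfer f \<phi> g x / l) Pf Nf)"

text \<open>The sets \<open>P i\<close>, \<open>i < d\<close>, carry the inverse branches of \<open>f\<close>.\<close>

definition branch_partition ::
  "('a::topological_space \<Rightarrow> 'a) \<Rightarrow> 'a measure \<Rightarrow> nat \<Rightarrow> (nat \<Rightarrow> 'a set) \<Rightarrow> bool" where
  "branch_partition f \<nu> d P \<longleftrightarrow>
     (\<forall>i<d. P i \<in> sets borel) \<and> disjoint_family_on P {..<d} \<and>
     (\<forall>i<d. bij_betw f (P i) UNIV) \<and>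
     emeasure \<nu> (\<Union>i<d. P i) = emeasure \<nu> UNIV"


section \<open>Disintegration along the fibres\<close>

text \<open>\<open>\<kappa> \<gamma>\<close> is the conditional probability on the fibre over \<open>\<gamma>\<close>, and \<open>\<phi>\<^sub>1\<close> is the density with respect
  to \<open>m\<close> of the projection of \<open>Q\<close> to the base.\<close>

definition disintegration ::
  "'m::topological_space measure \<Rightarrow> ('m \<times> 'k::topological_space) measure \<Rightarrow>
    ('m \<Rightarrow> ('m \<times> 'k) measure) \<Rightarrow> ('m \<Rightarrow> real) \<Rightarrow> bool" where
  "disintegration m Q \<kappa> \<phi>\<^sub>1 \<longleftrightarrow>
     \<kappa> \<in> measurable borel (prob_algebra borel) \<and>
     \<phi>\<^sub>1 \<in> borel_measurable borel \<and> (\<forall>\<gamma>. 0 \<le> \<phi>\<^sub>1 \<gamma>) \<and>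
     distr Q borel fst = density m (\<lambda>\<gamma>. ennreal (\<phi>\<^sub>1 \<gamma>)) \<and>
     (AE \<gamma> in distr Q borel fst. emeasure (\<kappa> \<gamma>) ({\<gamma>} \<times> UNIV) = 1) \<and>
     (\<forall>E\<in>sets borel. emeasure Q E = (\<integral>\<^sup>+\<gamma>. emeasure (\<kappa> \<gamma>) E \<partial>distr Q borel fst))"

definition the_disintegration ::
  "'m::topological_space measure \<Rightarrow> ('m \<times> 'k::topological_space) measure \<Rightarrow>
    ('m \<Rightarrow> ('m \<times> 'k) measure) \<times> ('m \<Rightarrow> real)" where
  "the_disintegration m Q = (SOME d. disintegration m Q (fst d) (snd d))"

abbreviation cond_measure ::
  "'m::topological_space measure \<Rightarrow> ('m \<times> 'k::topological_space) measure \<Rightarrow> 'm \<Rightarrow> ('m \<times> 'k) measure" where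
  "cond_measure m Q \<equiv> fst (the_disintegration m Q)"

abbreviation base_density ::
  "'m::topological_space measure \<Rightarrow> ('m \<times> 'k::topological_space) measure \<Rightarrow> 'm \<Rightarrow> real" where
  "base_density m Q \<equiv> snd (the_disintegration m Q)"

definition AB ::
  "'m::topological_space measure \<Rightarrow> ('m \<times> 'k::topological_space) signed_measure set" where
  "AB m = {\<mu>. absolutely_continuous m (distr (pos_part \<mu>) borel fst) \<and>
              absolutely_continuous m (distr (neg_part \<mu>) borel fst)}"

definition restriction_pos ::
  "'m::topological_space measure \<Rightarrow> ('m \<times> 'k::topological_space) measure \<Rightarrow> 'm \<Rightarrow> 'k signed_measure" where
  "restriction_pos m Q \<gamma> = base_density m Q \<gamma> *\<^sub>R sm_of (distr (cond_measure m Q \<gamma>) borel snd)"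

definition restriction ::
  "'m::topological_space measure \<Rightarrow> ('m \<times> 'k::topological_space) signed_measure \<Rightarrow> 'm \<Rightarrow> 'k signed_measure" where
  "restriction m \<mu> \<gamma> = restriction_pos m (pos_part \<mu>) \<gamma> - restriction_pos m (neg_part \<mu>) \<gamma>"

definition marginal_density ::
  "'m::topological_space measure \<Rightarrow> ('m \<times> 'k::topological_space) signed_measure \<Rightarrow> 'm \<Rightarrow> real" where
  "marginal_density m \<mu> \<gamma> = base_density m (pos_part \<mu>) \<gamma> - base_density m (neg_part \<mu>) \<gamma>"

definition norm_infty ::
  "('k::topological_space signed_measure \<Rightarrow> real) \<Rightarrow> 'm::topological_space measure \<Rightarrow>
    ('m \<times> 'k) signed_measure \<Rightarrow> ereal" where
  "norm_infty no m \<mu> = ess_sup m (\<lambda>\<gamma>. no (restriction m \<mu> \<gamma>))"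

definition L_infty ::
  "('k::topological_space signed_measure \<Rightarrow> real) \<Rightarrow> 'm::topological_space measure \<Rightarrow>
    ('m \<times> 'k) signed_measure set" where
  "L_infty no m = {\<mu> \<in> AB m. norm_infty no m \<mu> < \<infinity>}"

definition S_infty ::
  "('k::topological_space signed_measure \<Rightarrow> real) \<Rightarrow> 'm::topological_space measure \<Rightarrow> ('m \<Rightarrow> real) set \<Rightarrow>
    ('m \<times> 'k) signed_measure set" where
  "S_infty no m Bs = {\<mu> \<in> L_infty no m. marginal_density m \<mu> \<in> Bs}"

definition norm_S_infty ::
  "('k::topological_space signed_measure \<Rightarrow> real) \<Rightarrow> 'm::topological_space measure \<Rightarrow>
    (('m \<Rightarrow> real) \<Rightarrow> real) \<Rightarrow> ('m \<times> 'k) signed_measure \<Rightarrow> real" where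
  "norm_S_infty no m ns \<mu> = ns (marginal_density m \<mu>) + real_of_ereal (norm_infty no m \<mu>)"


section \<open>The transfer operator of the skew product\<close>

definition skew_product ::
  "('m \<Rightarrow> 'm) \<Rightarrow> ('m \<times> 'k \<Rightarrow> 'k) \<Rightarrow> 'm \<times> 'k \<Rightarrow> 'm \<times> 'k" where
  "skew_product f G z = (f (fst z), G z)"

text \<open>Image of a positive measure \<open>Q\<close>: the measure \<open>R\<close> with base density \<open>transfer_h f \<phi> h \<phi>\<^sub>1\<close> and with
  the prescribed conditional measures where this density does not vanish. The conditional measures
  elsewhere do not affect \<open>R\<close>.\<close>

definition skew_transfer_pos ::
  "('m::topological_space \<Rightarrow> 'm) \<Rightarrow> ('m \<times> 'k::topological_space \<Rightarrow> 'k) \<Rightarrow> ('m \<Rightarrow> real) \<Rightarrow> ('m \<Rightarrow> real) \<Rightarrow>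
    'm measure \<Rightarrow> nat \<Rightarrow> (nat \<Rightarrow> 'm set) \<Rightarrow> ('m \<times> 'k) measure \<Rightarrow> ('m \<times> 'k) measure" where
  "skew_transfer_pos f G \<phi> h m d P Q = (THE R.
     finite_measure R \<and> sets R = sets borel \<and>
     (\<exists>\<kappa>' \<psi>. disintegration m R \<kappa>' \<psi> \<and>
        (AE \<gamma> in m. \<psi> \<gamma> = transfer_h f \<phi> h (base_density m Q) \<gamma>) \<and>
        (AE \<gamma> in m. transfer_h f \<phi> h (base_density m Q) \<gamma> \<noteq> 0 \<longrightarrow>
           (\<forall>E\<in>sets borel. measure (\<kappa>' \<gamma>) E =
              1 / (h \<gamma> * transfer_h f \<phi> h (base_density m Q) \<gamma>) *
              (\<Sum>i<d. let \<gamma>\<^sub>i = the_inv_into (P i) f \<gamma> in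
                 base_density m Q \<gamma>\<^sub>i * h \<gamma>\<^sub>i * exp (\<phi> \<gamma>\<^sub>i) *
                 measure (distr (cond_measure m Q \<gamma>\<^sub>i) borel (skew_product f G)) E)))))"

definition skew_transfer ::
  "('m::topological_space \<Rightarrow> 'm) \<Rightarrow> ('m \<times> 'k::topological_space \<Rightarrow> 'k) \<Rightarrow> ('m \<Rightarrow> real) \<Rightarrow> ('m \<Rightarrow> real) \<Rightarrow>
    'm measure \<Rightarrow> nat \<Rightarrow> (nat \<Rightarrow> 'm set) \<Rightarrow> ('m \<times> 'k) signed_measure \<Rightarrow> ('m \<times> 'k) signed_measure" where
  "skew_transfer f G \<phi> h m d P \<mu> =
     sm_of (skew_transfer_pos f G \<phi> h m d P (pos_part \<mu>)) -
     sm_of (skew_transfer_pos f G \<phi> h m d P (neg_part \<mu>))"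

definition linear_operator_on :: "'v::real_vector set \<Rightarrow> ('v \<Rightarrow> 'v) \<Rightarrow> bool" where
  "linear_operator_on V T \<longleftrightarrow>
     (\<forall>u\<in>V. T u \<in> V) \<and> (\<forall>a b. \<forall>u\<in>V. \<forall>v\<in>V. T (a *\<^sub>R u + b *\<^sub>R v) = a *\<^sub>R T u + b *\<^sub>R T v)"

end

theory Submission
  imports Defs
begin

text \<open>
  By conformality of \<open>\<nu>\<close>, the normalised operator is just the push-forward of signed measures under
  the skew product \<open>F\<close>: on the fibre over \<open>\<gamma>\<close> the image of \<open>\<mu>\<close> restricts to a convex combination of
  push-forwards of the restrictions of \<open>\<mu>\<close> to the fibres over the preimages of \<open>\<gamma>\<close>. Averaging (G1)
  with these weights gives the Lasota--Yorke inequality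
  \<open>\<parallel>F\<^sub>* \<mu>\<parallel>\<^sub>\<infinity> \<le> \<alpha> \<parallel>\<mu>\<parallel>\<^sub>\<infinity> + |\<phi>\<^sub>1|\<^sub>w\<close>. The marginal density, multiplied by \<open>h\<close>, evolves under the normalised
  base operator, whose spectral projection has the form \<open>g \<mapsto> c g * h\<close>. With the invariant measure \<open>\<mu>\<^sub>0\<close>
  of (P3), the projection is \<open>\<mu> \<mapsto> c (\<phi>\<^sub>1 * h) \<mu>\<^sub>0\<close>. After subtracting it the marginals decay exponentially,
  and by the inequality so do the fibrewise norms.
\<close>

section \<open>Jordan decomposition of signed measures\<close>

text \<open>Conditional measures are chosen by \<open>SOME\<close> after splitting \<mu> into its
  Jordan parts, and neither the splitting nor the choice commutes with sums or with push-forward. So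
  linear identities for \<open>restriction\<close> are not proved from its definition.
  \<open>fibre_rep\<close> says that a family of signed measures on the fibres integrates to \<mu>.
  Such families can be combined linearly and pushed forward, and they are unique almost everywhere;
  an identity thus holds for \<open>restriction\<close> once some representing family satisfies it.
  Fibrewise norms need not be measurable in the base point, so their bounds are kept as a.e.
  inequalities. These are pulled back along inverse branches, which requires that \<open>f\<close>
  maps null sets into null sets. The function space may be incomplete and the spectral projection
  comes with no norm bound, so the coefficient of \<open>\<mu>\<^sub>0\<close> is bounded through
  marginal densities. Push-forward keeps this coefficient and fixes \<open>\<mu>\<^sub>0\<close>, so
  one application of the remainder makes the coefficient zero; from then on the remainder is plain
  push-forward, and the one-step inequality iterates with a geometrically small forcing
  term.\<close>

lemma sm_notin: "A \<notin> sets borel \<Longrightarrow> sm \<mu> A = 0"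
  using sm[of \<mu>] by blast

lemma sm_sums:
  fixes A :: "nat \<Rightarrow> 'a::topological_space set"
  assumes "range A \<subseteq> sets borel" "disjoint_family A"
  shows "(\<lambda>i. sm \<mu> (A i)) sums sm \<mu> (\<Union>i. A i)"
  using sm[of \<mu>] assms by blast

lemma sm_empty [simp]: "sm \<mu> {} = 0"
proof -
  have "(\<lambda>i::nat. sm \<mu> {}) sums sm \<mu> (\<Union>i::nat. {})"
    by (rule sm_sums) (auto simp: disjoint_family_on_def)
  then have "summable (\<lambda>i::nat. sm \<mu> {})" by (rule sums_summable)
  then have "(\<lambda>i::nat. sm \<mu> {}) \<longlonglongrightarrow> 0" by (rule summable_LIMSEQ_zero)
  then show ?thesis by (simp add: LIMSEQ_const_iff)
qed

lemma sm_union: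
  assumes "A \<in> sets borel" "B \<in> sets borel" "A \<inter> B = {}"
  shows "sm \<mu> (A \<union> B) = sm \<mu> A + sm \<mu> B"
proof -
  have "(\<lambda>i. sm \<mu> (binaryset A B i)) sums sm \<mu> (\<Union>i. binaryset A B i)"
    using assms by (intro sm_sums) (auto simp: disjoint_family_on_def binaryset_def)
  moreover have "(\<lambda>i. sm \<mu> (binaryset A B i)) sums (sm \<mu> A + sm \<mu> B)"
    by (rule binaryset_sums) simp
  ultimately show ?thesis
    by (simp add: UN_binaryset_eq sums_unique2)
qed

lemma sm_diff:
  assumes "A \<in> sets borel" "B \<in> sets borel" "A \<subseteq> B"
  shows "sm \<mu> (B - A) = sm \<mu> B - sm \<mu> A"
  using sm_union[of A "B - A" \<mu>] assms by (auto simp: Un_absorb1)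

lemma sm_split:
  assumes "A \<in> sets borel" "B \<in> sets borel"
  shows "sm \<mu> A = sm \<mu> (A \<inter> B) + sm \<mu> (A - B)"
  using sm_union[of "A \<inter> B" "A - B" \<mu>] assms by (simp add: Int_Diff_Un Int_Diff_disjoint)

lemma sm_incseq:
  fixes A :: "nat \<Rightarrow> 'a::topological_space set"
  assumes A: "\<And>i. A i \<in> sets borel" "incseq A"
  shows "(\<lambda>i. sm \<mu> (A i)) \<longlonglongrightarrow> sm \<mu> (\<Union>i. A i)"
proof -
  have D: "range (disjointed A) \<subseteq> sets borel"
    using A by (intro sets.range_disjointed_sets) auto
  have "(\<lambda>i. sm \<mu> (disjointed A i)) sums sm \<mu> (\<Union>i. disjointed A i)"
    using D by (intro sm_sums disjoint_family_disjointed)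
  then have *: "(\<lambda>n. \<Sum>i<Suc n. sm \<mu> (disjointed A i)) \<longlonglongrightarrow> sm \<mu> (\<Union>i. A i)"
    unfolding sums_def UN_disjointed_eq by (rule LIMSEQ_Suc)
  have "(\<Sum>i<Suc n. sm \<mu> (disjointed A i)) = sm \<mu> (A n)" for n
  proof (induction n)
    case 0 then show ?case by (simp add: disjointed_def)
  next
    case (Suc n)
    have "disjointed A (Suc n) = A (Suc n) - A n"
      using A(2) by (rule disjointed_mono)
    moreover have "A n \<subseteq> A (Suc n)" using A(2) by (auto simp: incseq_def)
    ultimately show ?case using Suc A(1) by (simp add: sm_diff)
  qed
  with * show ?thesis by simp
qed

lemma sm_decseq:
  fixes A :: "nat \<Rightarrow> 'a::topological_space set"
  assumes A: "\<And>i. A i \<in> sets borel" "decseq A"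
  shows "(\<lambda>i. sm \<mu> (A i)) \<longlonglongrightarrow> sm \<mu> (\<Inter>i. A i)"
proof -
  have "(\<lambda>i. sm \<mu> (- A i)) \<longlonglongrightarrow> sm \<mu> (\<Union>i. - A i)"
    using A by (intro sm_incseq) (auto simp: incseq_def decseq_def borel_comp)
  moreover have *: "sm \<mu> (- B) = sm \<mu> UNIV - sm \<mu> B" if "B \<in> sets borel" for B
    using sm_diff[of B UNIV \<mu>] that by (simp add: Compl_eq_Diff_UNIV)
  moreover have "(\<Union>i. - A i) = - (\<Inter>i. A i)" by auto
  moreover have "(\<Inter>i. A i) \<in> sets borel" using A(1) by auto
  ultimately have "(\<lambda>i. sm \<mu> UNIV - sm \<mu> (A i)) \<longlonglongrightarrow> sm \<mu> UNIV - sm \<mu> (\<Inter>i. A i)"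
    using A(1) by (simp only: *)
  from tendsto_diff[OF tendsto_const[of "sm \<mu> UNIV"] this] show ?thesis by simp
qed

lemma sm_eqI: "(\<And>A. A \<in> sets borel \<Longrightarrow> sm \<mu> A = sm \<eta> A) \<Longrightarrow> \<mu> = \<eta>"
  by (metis sm_inject sm_notin ext)

text \<open>The sets on which two signed measures agree form a Dynkin system. Membership of
  \<open>UNIV\<close> in the generator is what gives closure under complements.\<close>

lemma sm_eqI_generator:
  fixes \<mu> \<eta> :: "'a::topological_space signed_measure"
  assumes G: "Int_stable G" "borel = sigma UNIV G" "UNIV \<in> G"
    and eq: "\<And>A. A \<in> G \<Longrightarrow> sm \<mu> A = sm \<eta> A"
  shows "\<mu> = \<eta>"
proof (rule sm_eqI)
  fix A :: "'a set" assume "A \<in> sets borel"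
  then have "A \<in> sigma_sets UNIV G" by (simp add: G(2))
  have s: "sigma_sets UNIV G = sets borel" by (simp add: G(2))
  show "sm \<mu> A = sm \<eta> A"
  proof (rule sigma_sets_induct_disjoint[OF G(1) _ \<open>A \<in> sigma_sets UNIV G\<close>])
    fix A assume "A \<in> sigma_sets UNIV G" "sm \<mu> A = sm \<eta> A"
    then show "sm \<mu> (UNIV - A) = sm \<eta> (UNIV - A)"
      using eq[OF G(3)] unfolding s by (simp add: sm_diff)
  next
    fix A :: "nat \<Rightarrow> 'a set"
    assume union: "disjoint_family A" "range A \<subseteq> sigma_sets UNIV G" "\<And>i. sm \<mu> (A i) = sm \<eta> (A i)"
    have "(\<lambda>i. sm \<mu> (A i)) sums sm \<mu> (\<Union>i. A i)" "(\<lambda>i. sm \<eta> (A i)) sums sm \<eta> (\<Union>i. A i)"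
      using union(1,2) unfolding s by (auto intro!: sm_sums)
    then show "sm \<mu> (\<Union>i. A i) = sm \<eta> (\<Union>i. A i)"
      unfolding union(3) by (rule sums_unique2)
  qed (use eq in auto)
qed

text \<open>Finite intersections of a countable base. Countability matters in
  \<open>fibre_rep_unique\<close>, where one null set is discarded for each generator;
  \<open>UNIV\<close> is the empty intersection.\<close>

lemma countable_borel_generator:
  obtains G :: "'a::second_countable_topology set set"
  where "countable G" "Int_stable G" "borel = sigma UNIV G" "UNIV \<in> G" "G \<subseteq> sets borel"
proof -
  obtain B :: "'a set set" where B: "countable B" "topological_basis B"
    using ex_countable_basis by blast
  define G where "G = Inter ` {b. b \<subseteq> B \<and> finite b}"
  have "open b" if "b \<in> B" for b using B(2) that by (rule topological_basis_open)
  then have op: "open g" if "g \<in> G" for g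
    using that by (auto simp: G_def intro!: open_Inter)
  have "countable G"
    unfolding G_def using B(1) by (intro countable_image) (simp add: conj_commute countable_Collect_finite_subset)
  moreover have "Int_stable G"
  proof (rule Int_stableI)
    fix a b assume "a \<in> G" "b \<in> G"
    then obtain a' b' where ab: "a' \<subseteq> B" "finite a'" "b' \<subseteq> B" "finite b'" "a = \<Inter>a'" "b = \<Inter>b'"
      by (auto simp: G_def)
    then have "a \<inter> b = \<Inter>(a' \<union> b')" by auto
    with ab show "a \<inter> b \<in> G" unfolding G_def by (intro image_eqI[of _ _ "a' \<union> b'"]) auto
  qed
  moreover have "borel = sigma UNIV G"
  proof (rule borel_eq_sigmaI1[OF borel_eq_countable_basis[OF B], of "\<lambda>x. x" G, simplified])
    fix b assume "b \<in> B"
    then have "b \<in> G" unfolding G_def by (intro image_eqI[of _ _ "{b}"]) auto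
    then show "b \<in> sigma_sets UNIV G" by auto
  qed (use op in auto)
  moreover have "UNIV \<in> G" unfolding G_def by (intro image_eqI[of _ _ "{}"]) auto
  moreover have "G \<subseteq> sets borel" using op by auto
  ultimately show thesis by (rule that)
qed

section \<open>Hahn and Jordan decompositions\<close>

text \<open>If \<mu> is unbounded on the subsets of a set, the set can be cut so that \<mu> is large
  on one piece and still unbounded on its subsets. Repeating this gives a decreasing sequence of
  sets with values tending to infinity in modulus, against continuity from above.\<close>

lemma sm_bounded: "\<exists>b. \<forall>A\<in>sets borel. \<bar>sm \<mu> A\<bar> \<le> b"
proof (rule ccontr)
  define bad where "bad E \<longleftrightarrow> E \<in> sets borel \<and> \<not> (\<exists>b. \<forall>A\<in>sets borel. A \<subseteq> E \<longrightarrow> \<bar>sm \<mu> A\<bar> \<le> b)" for E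
  have badD: "\<exists>A\<in>sets borel. A \<subseteq> E \<and> b < \<bar>sm \<mu> A\<bar>" if "bad E" for E b
    using that unfolding bad_def by (metis not_less)
  assume "\<not> ?thesis"
  then have bad_UNIV: "bad UNIV" unfolding bad_def by simp
  have step: "\<exists>E'. bad E' \<and> E' \<subseteq> E \<and> \<bar>sm \<mu> E'\<bar> \<ge> b" if E: "bad E" for E b
  proof -
    \<comment> \<open>The surplus over the modulus of \<mu> at \<open>E\<close> makes the value at
      \<open>E - A\<close> large as well, so it does not matter which of the two pieces is
      bad.\<close>
    obtain A where A: "A \<in> sets borel" "A \<subseteq> E" "\<bar>sm \<mu> A\<bar> > \<bar>b\<bar> + \<bar>sm \<mu> E\<bar>"
      using badD[OF E] by blast
    have E': "E \<in> sets borel" using E by (simp add: bad_def)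
    have d: "\<bar>sm \<mu> (E - A)\<bar> \<ge> b" using sm_diff[OF A(1) E' A(2), of \<mu>] A(3) by linarith
    have "bad A \<or> bad (E - A)"
    proof (rule ccontr)
      assume "\<not> ?thesis"
      then have "\<not> bad A" "\<not> bad (E - A)" by auto
      moreover have "E - A \<in> sets borel" using A(1) E' by auto
      ultimately obtain b1 b2 where b: "\<forall>C\<in>sets borel. C \<subseteq> A \<longrightarrow> \<bar>sm \<mu> C\<bar> \<le> b1"
        "\<forall>C\<in>sets borel. C \<subseteq> E - A \<longrightarrow> \<bar>sm \<mu> C\<bar> \<le> b2"
        using A(1) unfolding bad_def by auto
      obtain C where C: "C \<in> sets borel" "C \<subseteq> E" "\<bar>sm \<mu> C\<bar> > b1 + b2"
        using badD[OF E] by blast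
      have "C \<inter> A \<in> sets borel" "C - A \<in> sets borel" using C A by auto
      then have "\<bar>sm \<mu> (C \<inter> A)\<bar> \<le> b1" "\<bar>sm \<mu> (C - A)\<bar> \<le> b2"
        using C(2) b(1)[rule_format, of "C \<inter> A"] b(2)[rule_format, of "C - A"] by auto
      with C(3) sm_split[OF C(1) A(1), of \<mu>] show False by linarith
    qed
    moreover have "b \<le> \<bar>sm \<mu> A\<bar>" using A(3) by linarith
    ultimately show ?thesis using A(2) d by blast
  qed
  then obtain g where g: "\<And>E b. bad E \<Longrightarrow> bad (g E b) \<and> g E b \<subseteq> E \<and> \<bar>sm \<mu> (g E b)\<bar> \<ge> b"
    by metis
  define S where "S = rec_nat UNIV (\<lambda>n E. g E (real (Suc n)))"
  have S0: "S 0 = UNIV" and SS: "S (Suc n) = g (S n) (real (Suc n))" for n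
    by (simp_all add: S_def)
  have bS: "bad (S n)" for n
    by (induction n) (simp_all add: S0 SS bad_UNIV g)
  have "decseq S" by (rule decseq_SucI) (simp add: SS g bS)
  then have "(\<lambda>n. sm \<mu> (S n)) \<longlonglongrightarrow> sm \<mu> (\<Inter>n. S n)"
    using bS by (intro sm_decseq) (auto simp: bad_def)
  then have "Bseq (\<lambda>n. sm \<mu> (S n))" by (rule convergent_imp_Bseq[OF convergentI])
  then obtain c where c: "\<And>n. \<bar>sm \<mu> (S n)\<bar> \<le> c" by (auto simp: Bseq_def)
  obtain n where "c < real n" using reals_Archimedean2[of c] by auto
  moreover have "\<bar>sm \<mu> (S (Suc n))\<bar> \<ge> real (Suc n)" using g[OF bS[of n]] by (simp add: SS)
  ultimately show False using c[of "Suc n"] by auto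
qed

text \<open>The supremum of \<mu> is finite by \<open>sm_bounded\<close>, and it is attained at a
  set \<open>D\<close>. Removing a subset of negative mass from \<open>D\<close>, or adding a
  disjoint set of positive mass, would exceed the supremum.\<close>

lemma sm_Hahn:
  obtains D where "D \<in> sets borel" "\<And>A. A \<in> sets borel \<Longrightarrow> A \<subseteq> D \<Longrightarrow> 0 \<le> sm \<mu> A"
    "\<And>A. A \<in> sets borel \<Longrightarrow> A \<inter> D = {} \<Longrightarrow> sm \<mu> A \<le> 0"
proof -
  obtain b where b: "\<And>A. A \<in> sets borel \<Longrightarrow> \<bar>sm \<mu> A\<bar> \<le> b"
    using sm_bounded[of \<mu>] by auto
  define s where "s = Sup (sm \<mu> ` sets borel)"
  have bdd: "bdd_above (sm \<mu> ` sets borel)"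
    using b by (auto intro!: bdd_aboveI[of _ b] dest: abs_le_D1)
  have le_s: "sm \<mu> A \<le> s" if "A \<in> sets borel" for A
    unfolding s_def using that bdd by (auto intro: cSup_upper)
  have "\<exists>A\<in>sets borel. sm \<mu> A > s - (1/2) ^ n" for n
  proof -
    have "\<exists>x\<in>sm \<mu> ` sets borel. s - (1/2)^n < x"
      unfolding s_def by (subst less_cSup_iff[symmetric]) (auto simp: bdd)
    then show ?thesis by auto
  qed
  then obtain A where A: "\<And>n. A n \<in> sets borel" "\<And>n. sm \<mu> (A n) > s - (1/2) ^ n"
    by metis
  define C where "C n k = (\<Inter>j\<in>{n..n+k}. A j)" for n k :: nat
  have Cb: "C n k \<in> sets borel" for n k
    unfolding C_def using A(1) by (intro sets.finite_INT) auto
  \<comment> \<open>Since the union of \<open>C n k\<close> and the next set has mass at most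
    \<open>s\<close>, intersecting costs at most \<open>(1/2) ^ (n + k + 1)\<close>. Together with
    the initial \<open>(1/2) ^ n\<close> these losses sum to
    \<open>2 * (1/2) ^ n - (1/2) ^ (n + k)\<close>.\<close>
  have C: "sm \<mu> (C n k) \<ge> s - 2 * (1/2) ^ n + (1/2)^(n+k)" for n k
  proof (induction k)
    case 0 then show ?case using A(2)[of n] by (simp add: C_def)
  next
    case (Suc k)
    let ?B = "A (n + Suc k)"
    have e: "C n (Suc k) = C n k \<inter> ?B" by (auto simp: C_def le_Suc_eq)
    have "sm \<mu> (C n k \<union> ?B) = sm \<mu> (C n k - ?B) + sm \<mu> ?B"
    proof -
      have "(C n k - ?B) \<inter> ?B = {}" by blast
      from sm_union[OF sets.Diff[OF Cb A(1)] A(1) this] show ?thesis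
        by (simp only: Un_Diff_cancel2)
    qed
    moreover have "sm \<mu> (C n k \<union> ?B) \<le> s" using Cb A(1) by (intro le_s) auto
    moreover have "sm \<mu> (C n k) = sm \<mu> (C n k \<inter> ?B) + sm \<mu> (C n k - ?B)"
      using Cb A(1) by (rule sm_split)
    moreover have "sm \<mu> ?B > s - (1/2)^(n + Suc k)" by (rule A(2))
    moreover have "(1/2::real) ^ (n+k) = 2 * (1/2)^(n + Suc k)" by simp
    ultimately show ?case using Suc unfolding e by linarith
  qed
  define I where "I n = (\<Inter>k. C n k)" for n
  have Ib: "I n \<in> sets borel" for n unfolding I_def using Cb by auto
  have I: "sm \<mu> (I n) \<ge> s - 2 * (1/2)^n" for n
  proof -
    have "(\<lambda>k. sm \<mu> (C n k)) \<longlonglongrightarrow> sm \<mu> (I n)"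
      unfolding I_def using Cb by (intro sm_decseq) (auto simp: decseq_def C_def)
    moreover have "sm \<mu> (C n k) \<ge> s - 2 * (1/2)^n" for k
      using C[of n k] by (smt (verit) zero_less_power half_gt_zero)
    ultimately show ?thesis by (auto intro!: LIMSEQ_le_const)
  qed
  \<comment> \<open>The lower limit of the sets \<open>A n\<close>; the losses
    \<open>2 * (1/2) ^ n\<close> disappear along the increasing union.\<close>
  define D where "D = (\<Union>n. I n)"
  have Db: "D \<in> sets borel" unfolding D_def using Ib by auto
  have "(\<lambda>n. sm \<mu> (I n)) \<longlonglongrightarrow> sm \<mu> D"
    unfolding D_def
  proof (rule sm_incseq)
    show "incseq I"
    proof (rule incseq_SucI, unfold I_def C_def, safe)
      fix n x k j assume *: "x \<in> (\<Inter>k. \<Inter>j\<in>{n..n+k}. A j)" "j \<in> {Suc n..Suc n + k}"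
      have "x \<in> (\<Inter>j\<in>{n..n+Suc k}. A j)" using *(1) by blast
      then show "x \<in> A j" using *(2) by auto
    qed
  qed (rule Ib)
  moreover have "(\<lambda>n. s - 2 * (1/2)^n) \<longlonglongrightarrow> s - 2 * 0"
    by (intro tendsto_intros LIMSEQ_power_zero) auto
  ultimately have "s \<le> sm \<mu> D" using I by (auto intro: LIMSEQ_le)
  then have sD: "sm \<mu> D = s" using le_s[OF Db] by simp
  show thesis
  proof (rule that[OF Db])
    fix A :: "'a set" assume A: "A \<in> sets borel" "A \<subseteq> D"
    then show "0 \<le> sm \<mu> A"
      using sm_diff[OF A(1) Db A(2), of \<mu>] le_s[of "D - A"] Db sD by auto
  next
    fix A :: "'a set" assume A: "A \<in> sets borel" "A \<inter> D = {}"
    then show "sm \<mu> A \<le> 0"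
      using sm_union[OF A(1) Db A(2), of \<mu>] le_s[of "A \<union> D"] Db sD by auto
  qed
qed

lemma measure_of_sm:
  assumes pos: "\<And>A. A \<in> sets borel \<Longrightarrow> 0 \<le> sm \<eta> A"
  obtains Q where "finite_measure Q" "sets Q = sets borel" "\<And>A. A \<in> sets borel \<Longrightarrow> emeasure Q A = ennreal (sm \<eta> A)"
    "sm_of Q = \<eta>"
proof -
  define Q where "Q = measure_of UNIV (sets borel) (\<lambda>A. ennreal (sm \<eta> A))"
  have sQ: "sets Q = sets borel"
    unfolding Q_def using sets.sigma_sets_eq[of borel] by simp
  have Q: "emeasure Q A = ennreal (sm \<eta> A)" if "A \<in> sets borel" for A
    unfolding Q_def
  proof (rule emeasure_measure_of_sigma)
    show "sigma_algebra UNIV (sets borel)"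
      using sets.sigma_algebra_axioms[of borel] by simp
    show "positive (sets borel) (\<lambda>A. ennreal (sm \<eta> A))"
      by (simp add: positive_def)
    show "countably_additive (sets borel) (\<lambda>A. ennreal (sm \<eta> A))"
    proof (rule countably_additiveI)
      fix A :: "nat \<Rightarrow> 'a set" assume A: "range A \<subseteq> sets borel" "disjoint_family A"
      have "(\<lambda>i. sm \<eta> (A i)) sums sm \<eta> (\<Union>i. A i)" using A by (rule sm_sums)
      then show "(\<Sum>i. ennreal (sm \<eta> (A i))) = ennreal (sm \<eta> (\<Union>i. A i))"
        using A pos by (intro suminf_ennreal_eq) auto
    qed
  qed (use that in simp)
  have fQ: "finite_measure Q"
    using Q[of UNIV] sets_eq_imp_space_eq[OF sQ] by (intro finite_measureI) simp
  moreover have "sm_of Q = \<eta>"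
    using fQ sQ Q pos by (intro sm_eqI) (simp add: sm_sm_of measure_def)
  ultimately show thesis using Q sQ by (intro that[of Q]) auto
qed

definition sm_restrict :: "'a::topological_space set \<Rightarrow> 'a signed_measure \<Rightarrow> 'a signed_measure" where
  "sm_restrict D \<mu> = Abs_sm (\<lambda>A. if A \<in> sets borel then sm \<mu> (A \<inter> D) else 0)"

lemma sm_sm_restrict:
  assumes D: "D \<in> sets borel" and B: "B \<in> sets borel"
  shows "sm (sm_restrict D \<mu>) B = sm \<mu> (B \<inter> D)"
proof -
  have "(\<lambda>i. if A i \<in> sets borel then sm \<mu> (A i \<inter> D) else 0) sums
    (if \<Union> (range A) \<in> sets borel then sm \<mu> (\<Union> (range A) \<inter> D) else 0)"
    if A: "range A \<subseteq> sets borel" "disjoint_family A" for A :: "nat \<Rightarrow> 'a set"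
  proof -
    have A': "A i \<in> sets borel" for i using A by auto
    have "(\<lambda>i. sm \<mu> (A i \<inter> D)) sums sm \<mu> (\<Union>i. A i \<inter> D)"
      using D A A' by (intro sm_sums) (auto simp: disjoint_family_on_def)
    moreover have "\<Union> (range A) \<in> sets borel" using A' by auto
    ultimately show ?thesis using A' by simp
  qed
  then have "(\<lambda>A. if A \<in> sets borel then sm \<mu> (A \<inter> D) else 0) \<in> {\<mu>.
      (\<forall>A. A \<notin> sets borel \<longrightarrow> \<mu> A = 0) \<and>
      (\<forall>A. range A \<subseteq> sets borel \<longrightarrow> disjoint_family A \<longrightarrow> (\<lambda>i::nat. \<mu> (A i)) sums \<mu> (\<Union>i. A i))}"
    by simp
  then show ?thesis
    unfolding sm_restrict_def using B by (simp add: Abs_sm_inverse)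
qed

lemma jordan_decomposition_exists: "\<exists>Q R. jordan_decomposition \<mu> Q R"
proof -
  obtain D where D: "D \<in> sets borel" "\<And>A. A \<in> sets borel \<Longrightarrow> A \<subseteq> D \<Longrightarrow> 0 \<le> sm \<mu> A"
    "\<And>A. A \<in> sets borel \<Longrightarrow> A \<inter> D = {} \<Longrightarrow> sm \<mu> A \<le> 0"
    using sm_Hahn[of \<mu>] by metis
  have cD: "- D \<in> sets borel" using D(1) by (simp add: borel_comp)
  obtain Q where Q: "finite_measure Q" "sets Q = sets borel"
    "\<And>A. A \<in> sets borel \<Longrightarrow> emeasure Q A = ennreal (sm (sm_restrict D \<mu>) A)" "sm_of Q = sm_restrict D \<mu>"
    by (rule measure_of_sm[of "sm_restrict D \<mu>"]) (use D in \<open>auto simp: sm_sm_restrict\<close>)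
  obtain R where R: "finite_measure R" "sets R = sets borel"
    "\<And>A. A \<in> sets borel \<Longrightarrow> emeasure R A = ennreal (sm (- sm_restrict (- D) \<mu>) A)" "sm_of R = - sm_restrict (- D) \<mu>"
    by (rule measure_of_sm[of "- sm_restrict (- D) \<mu>"])
      (use D cD in \<open>auto simp: sm_sm_restrict uminus_signed_measure.rep_eq intro!: D(3)\<close>)
  have "\<mu> = sm_of Q - sm_of R"
    unfolding Q(4) R(4)
  proof (rule sm_eqI)
    fix A :: "'a set" assume A: "A \<in> sets borel"
    show "sm \<mu> A = sm (sm_restrict D \<mu> - - sm_restrict (- D) \<mu>) A"
      using sm_split[OF A D(1), of \<mu>] A D(1) cD
      by (simp add: plus_signed_measure.rep_eq sm_sm_restrict Diff_eq)
  qed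
  moreover have "emeasure Q (- D) = 0" "emeasure R D = 0"
    using D(1) cD by (simp_all add: Q R sm_sm_restrict uminus_signed_measure.rep_eq)
  ultimately show ?thesis
    using Q R D(1) unfolding jordan_decomposition_def by blast
qed

lemma jordan_decomposition_emeasure:
  assumes "jordan_decomposition \<mu> Q R"
  obtains D where "D \<in> sets borel" "\<And>A. A \<in> sets borel \<Longrightarrow> emeasure Q A = ennreal (sm \<mu> (A \<inter> D))"
    "\<And>A. A \<in> sets borel \<Longrightarrow> emeasure R A = ennreal (- sm \<mu> (A - D))"
proof -
  from assms obtain D where D: "finite_measure Q" "finite_measure R" "sets Q = sets borel" "sets R = sets borel"
    "\<mu> = sm_of Q - sm_of R" "D \<in> sets borel" "emeasure Q (- D) = 0" "emeasure R D = 0"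
    unfolding jordan_decomposition_def by blast
  interpret Q: finite_measure Q by fact
  interpret R: finite_measure R by fact
  have \<mu>: "sm \<mu> A = measure Q A - measure R A" for A
    unfolding D(5) using D by (simp add: minus_signed_measure.rep_eq sm_sm_of)
  have m0: "measure Q (- D) = 0" "measure R D = 0" using D by (simp_all add: measure_def)
  show thesis
  proof (rule that[OF D(6)])
    fix A :: "'a set" assume A: "A \<in> sets borel"
    have R0: "measure R (A \<inter> D) = 0"
      using R.finite_measure_mono[of "A \<inter> D" D] D m0 by (simp add: measure_le_0_iff)
    have Q0: "measure Q (A - D) = 0"
      using Q.finite_measure_mono[of "A - D" "- D"] D m0 by (auto simp add: measure_le_0_iff borel_comp)
    have "measure Q A = measure Q (A \<inter> D) + measure Q (A - D)"
      using A D Q.finite_measure_Diff'[of A D] by simp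
    then show "emeasure Q A = ennreal (sm \<mu> (A \<inter> D))"
      by (simp add: \<mu> R0 Q0 Q.emeasure_eq_measure)
    have "measure R A = measure R (A \<inter> D) + measure R (A - D)"
      using A D R.finite_measure_Diff'[of A D] by simp
    then show "emeasure R A = ennreal (- sm \<mu> (A - D))"
      by (simp add: \<mu> R0 Q0 R.emeasure_eq_measure)
  qed
qed

text \<open>Minimality of the Jordan parts: on a Hahn set of the first decomposition,
  \<open>Q\<close> is \<mu> itself, which is at most \<open>Q'\<close> because \<open>R'\<close> is
  subtracted; dually for \<open>R\<close> off that set.\<close>

lemma jordan_decomposition_le:
  assumes "jordan_decomposition \<mu> Q R" "jordan_decomposition \<mu> Q' R'" and A: "A \<in> sets borel"
  shows "emeasure Q A \<le> emeasure Q' A" "emeasure R A \<le> emeasure R' A"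
proof -
  obtain D where D: "D \<in> sets borel" "\<And>A. A \<in> sets borel \<Longrightarrow> emeasure Q A = ennreal (sm \<mu> (A \<inter> D))"
    "\<And>A. A \<in> sets borel \<Longrightarrow> emeasure R A = ennreal (- sm \<mu> (A - D))"
    using jordan_decomposition_emeasure[OF assms(1)] by metis
  from assms(2) have q: "finite_measure Q'" "finite_measure R'" "sets Q' = sets borel" "sets R' = sets borel"
    "\<mu> = sm_of Q' - sm_of R'"
    unfolding jordan_decomposition_def by blast+
  interpret Q: finite_measure Q' by fact
  interpret R: finite_measure R' by fact
  have \<mu>: "sm \<mu> A = measure Q' A - measure R' A" for A
    unfolding q(5) using q by (simp add: minus_signed_measure.rep_eq sm_sm_of)
  have "emeasure Q A \<le> emeasure Q' (A \<inter> D)"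
    using A by (simp add: D \<mu> Q.emeasure_eq_measure ennreal_leI)
  also have "\<dots> \<le> emeasure Q' A" using A q by (intro emeasure_mono) auto
  finally show "emeasure Q A \<le> emeasure Q' A" .
  have "emeasure R A \<le> emeasure R' (A - D)"
    using A by (simp add: D \<mu> R.emeasure_eq_measure ennreal_leI)
  also have "\<dots> \<le> emeasure R' A" using A q by (intro emeasure_mono) auto
  finally show "emeasure R A \<le> emeasure R' A" .
qed

lemma jordan_decomposition_unique:
  assumes "jordan_decomposition \<mu> Q R" "jordan_decomposition \<mu> Q' R'"
  shows "Q = Q'" "R = R'"
proof -
  have "sets Q = sets borel" "sets Q' = sets borel" "sets R = sets borel" "sets R' = sets borel"
    using assms unfolding jordan_decomposition_def by blast+
  note * = this jordan_decomposition_le[OF assms] jordan_decomposition_le[OF assms(2,1)]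
  show "Q = Q'" by (rule measure_eqI) (use * in \<open>auto intro: order.antisym\<close>)
  show "R = R'" by (rule measure_eqI) (use * in \<open>auto intro: order.antisym\<close>)
qed

text \<open>Existence and uniqueness justify the definite descriptions in \<open>pos_part\<close>
  and \<open>neg_part\<close>.\<close>

lemma jordan_decomposition_parts: "jordan_decomposition \<mu> (pos_part \<mu>) (neg_part \<mu>)"
proof -
  obtain Q R where QR: "jordan_decomposition \<mu> Q R" using jordan_decomposition_exists by blast
  have "pos_part \<mu> = Q"
    unfolding pos_part_def using QR jordan_decomposition_unique[OF _ QR] by blast
  moreover have "neg_part \<mu> = R"
    unfolding neg_part_def using QR jordan_decomposition_unique[OF _ QR] by blast
  ultimately show ?thesis using QR by simp
qed

section \<open>Disintegration of measures on products of Polish spaces\<close>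

lemma measurable_fst_borel [measurable]:
  "fst \<in> borel_measurable (borel :: ('a::second_countable_topology \<times> 'b::second_countable_topology) measure)"
  unfolding borel_prod[symmetric] by measurable

lemma measurable_snd_borel [measurable]:
  "snd \<in> borel_measurable (borel :: ('a::second_countable_topology \<times> 'b::second_countable_topology) measure)"
  unfolding borel_prod[symmetric] by measurable

lemma measurable_Pair_borel [measurable (raw)]:
  fixes f :: "'c \<Rightarrow> 'a::second_countable_topology" and g :: "'c \<Rightarrow> 'b::second_countable_topology"
  assumes "f \<in> borel_measurable M" "g \<in> borel_measurable M"
  shows "(\<lambda>x. (f x, g x)) \<in> borel_measurable M"
  using measurable_Pair[OF assms] unfolding borel_prod .

lemma Pair_vimage_borel:
  fixes E :: "('a::second_countable_topology \<times> 'b::second_countable_topology) set"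
  assumes "E \<in> sets borel"
  shows "Pair \<gamma> -` E \<in> sets borel"
proof -
  have "(\<lambda>y::'b. (\<gamma>, y)) \<in> borel_measurable borel"
    by (rule measurable_Pair_borel[of "\<lambda>_. \<gamma>" borel "\<lambda>y. y"]) simp_all
  from measurable_sets[OF this assms] show ?thesis by simp
qed

lemma Times_in_borel [simp, intro]:
  fixes A :: "'a::second_countable_topology set" and B :: "'b::second_countable_topology set"
  assumes "A \<in> sets borel" "B \<in> sets borel"
  shows "A \<times> B \<in> sets borel"
  using pair_measureI[OF assms] unfolding borel_prod .

lemma borel_prod_generator:
  "Int_stable {A \<times> B |A B. A \<in> sets borel \<and> B \<in> sets borel}"
  "sets (borel :: ('a::second_countable_topology \<times> 'b::second_countable_topology) measure) =
    sigma_sets UNIV {A \<times> B |A B. A \<in> sets borel \<and> B \<in> sets borel}"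
proof -
  show "Int_stable {A \<times> B |A B. A \<in> sets borel \<and> B \<in> sets borel}"
    by (rule Int_stable_pair_measure_generator)
  show "sets (borel :: ('a \<times> 'b) measure) =
    sigma_sets UNIV {A \<times> B |A B. A \<in> sets borel \<and> B \<in> sets borel}"
    unfolding borel_prod[symmetric] sets_pair_measure by simp
qed

lemma measure_eqI_rectangles:
  fixes Q R :: "('a::second_countable_topology \<times> 'b::second_countable_topology) measure"
  assumes Q: "finite_measure Q" "sets Q = sets borel" and R: "sets R = sets borel"
    and eq: "\<And>A B. A \<in> sets borel \<Longrightarrow> B \<in> sets borel \<Longrightarrow> emeasure Q (A \<times> B) = emeasure R (A \<times> B)"
  shows "Q = R"
proof (rule measure_eqI_generator_eq[where \<Omega> = UNIV and A = "\<lambda>_. UNIV"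
      and E = "{A \<times> B |A B. A \<in> sets borel \<and> B \<in> sets borel}"])
  interpret finite_measure Q by fact
  show "emeasure Q UNIV \<noteq> \<infinity>" by simp
  show "range (\<lambda>i::nat. UNIV) \<subseteq> {A \<times> B |A B. A \<in> sets (borel::'a measure) \<and> B \<in> sets (borel::'b measure)}"
    by (auto intro!: exI[of _ UNIV])
qed (use Q R eq borel_prod_generator in auto)

section \<open>Conditional distributions of a real second coordinate\<close>

text \<open>For fixed \<open>C\<close> the measure of \<open>A \<times> C\<close> is dominated by
  that of \<open>A \<times> UNIV\<close>, so the Radon-Nikodym theorem applies with respect to the
  first marginal.\<close>

lemma slice_density:
  fixes Q :: "('m::second_countable_topology \<times> 'k::second_countable_topology) measure"
  assumes "finite_measure Q" and sQ [measurable_cong]: "sets Q = sets borel" and C: "C \<in> sets borel"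
  obtains g where "g \<in> borel_measurable borel"
    "\<And>A. A \<in> sets borel \<Longrightarrow> emeasure Q (A \<times> C) = (\<integral>\<^sup>+\<gamma>\<in>A. g \<gamma> \<partial>distr Q borel fst)"
proof -
  interpret Q: finite_measure Q by fact
  interpret Q1: finite_measure "distr Q borel fst" by (rule Q.finite_measure_distr) measurable
  have UC: "UNIV \<times> C \<in> sets Q" using C sQ by simp
  define N where "N = distr (density Q (indicator (UNIV \<times> C))) borel fst"
  have sp: "space Q = UNIV" using sets_eq_imp_space_eq[OF sQ] by simp
  have N: "emeasure N A = emeasure Q (A \<times> C)" if A: "A \<in> sets borel" for A
  proof -
    have "emeasure N A = emeasure (density Q (indicator (UNIV \<times> C))) (A \<times> UNIV)"
      unfolding N_def using A by (subst emeasure_distr) (auto simp: sp intro!: arg_cong2[where f = emeasure])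
    also have "\<dots> = emeasure Q ((UNIV \<times> C) \<inter> (A \<times> UNIV))"
      using A UC sQ by (intro emeasure_restricted) auto
    also have "(UNIV \<times> C) \<inter> (A \<times> UNIV) = A \<times> C" by auto
    finally show ?thesis .
  qed
  have Q1: "emeasure (distr Q borel fst) A = emeasure Q (A \<times> UNIV)" if A: "A \<in> sets borel" for A
    using A by (subst emeasure_distr) (auto simp: sp intro!: arg_cong2[where f = emeasure])
  have "absolutely_continuous (distr Q borel fst) N"
    unfolding absolutely_continuous_def
  proof
    fix A assume "A \<in> null_sets (distr Q borel fst)"
    then have A: "A \<in> sets borel" "emeasure Q (A \<times> UNIV) = 0" by (auto simp: null_sets_def Q1)
    have "emeasure Q (A \<times> C) \<le> emeasure Q (A \<times> UNIV)" using A sQ by (intro emeasure_mono) auto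
    with A show "A \<in> null_sets N" by (auto simp: null_sets_def N) (simp add: N_def)
  qed
  then obtain g where g: "g \<in> borel_measurable (distr Q borel fst)" "density (distr Q borel fst) g = N"
    using Q1.Radon_Nikodym[of N] by (auto simp: N_def)
  have "emeasure Q (A \<times> C) = (\<integral>\<^sup>+\<gamma>\<in>A. g \<gamma> \<partial>distr Q borel fst)" if A: "A \<in> sets borel" for A
    using N[OF A] g A by (metis emeasure_density sets_distr)
  with g(1) show thesis by (intro that[of g]) auto
qed

text \<open>The conditional distribution functions are regularised by taking infima over larger rationals,
  which makes them monotone and right continuous everywhere rather than almost everywhere.\<close>

lemma real_kernel_exists:
  fixes Q :: "('m::second_countable_topology \<times> real) measure"
  assumes fQ: "finite_measure Q" and sQ [measurable_cong]: "sets Q = sets borel"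
    and supp: "emeasure Q (UNIV \<times> (- {0..<1})) = 0"
  obtains \<kappa> where "\<kappa> \<in> measurable borel (prob_algebra borel)"
    "\<And>A C. A \<in> sets borel \<Longrightarrow> C \<in> sets borel \<Longrightarrow>
      emeasure Q (A \<times> C) = (\<integral>\<^sup>+\<gamma>\<in>A. emeasure (\<kappa> \<gamma>) C \<partial>distr Q borel fst)"
proof -
  interpret Q: finite_measure Q by fact
  let ?Q1 = "distr Q borel fst"
  interpret Q1: finite_measure ?Q1 by (rule Q.finite_measure_distr) measurable
  have sp: "space Q = UNIV" using sets_eq_imp_space_eq[OF sQ] by simp
  have Q1e: "emeasure ?Q1 A = emeasure Q (A \<times> UNIV)" if A: "A \<in> sets borel" for A
    using A by (subst emeasure_distr) (auto simp: sp intro!: arg_cong2[where f = emeasure])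
  have "\<forall>C\<in>sets borel. \<exists>g. g \<in> borel_measurable borel \<and>
    (\<forall>A\<in>sets borel. emeasure Q (A \<times> C) = (\<integral>\<^sup>+\<gamma>\<in>A. g \<gamma> \<partial>?Q1))"
    using slice_density[OF fQ sQ] by metis
  then obtain g where g: "\<And>C. C \<in> sets borel \<Longrightarrow> g C \<in> borel_measurable borel"
    "\<And>A C. C \<in> sets borel \<Longrightarrow> A \<in> sets borel \<Longrightarrow> emeasure Q (A \<times> C) = (\<integral>\<^sup>+\<gamma>\<in>A. g C \<gamma> \<partial>?Q1)"
    by metis
  \<comment> \<open>The densities \<open>g C\<close> are chosen independently for each
    \<open>C\<close>. Monotonicity and normalisation therefore hold only a.e., and are obtained by
    comparing integrals over Borel sets.\<close>
  have AE_eqI: "AE \<gamma> in ?Q1. u \<gamma> = v \<gamma>"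
    if "u \<in> borel_measurable borel" "v \<in> borel_measurable borel"
      "\<And>A. A \<in> sets borel \<Longrightarrow> (\<integral>\<^sup>+\<gamma>\<in>A. u \<gamma> \<partial>?Q1) = (\<integral>\<^sup>+\<gamma>\<in>A. v \<gamma> \<partial>?Q1)" for u v
    using that by (intro Q1.density_unique2) auto
  have g_UNIV: "AE \<gamma> in ?Q1. g UNIV \<gamma> = 1"
    by (rule AE_eqI) (use g(1) in \<open>auto simp: g(2)[symmetric] Q1e\<close>)
  have g_mono: "AE \<gamma> in ?Q1. g C \<gamma> \<le> g C' \<gamma>" if C: "C \<in> sets borel" "C' \<in> sets borel" "C \<subseteq> C'" for C C'
  proof -
    have D: "C' - C \<in> sets borel" using C by auto
    have "AE \<gamma> in ?Q1. g C \<gamma> + g (C' - C) \<gamma> = g C' \<gamma>"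
    proof (rule AE_eqI)
      fix A :: "'m set" assume A: "A \<in> sets borel"
      have "(\<integral>\<^sup>+\<gamma>\<in>A. (g C \<gamma> + g (C' - C) \<gamma>) \<partial>?Q1) =
        (\<integral>\<^sup>+\<gamma>\<in>A. g C \<gamma> \<partial>?Q1) + (\<integral>\<^sup>+\<gamma>\<in>A. g (C' - C) \<gamma> \<partial>?Q1)"
        unfolding distrib_right using g(1) C D A by (intro nn_integral_add) auto
      also have "\<dots> = emeasure Q (A \<times> C) + emeasure Q (A \<times> (C' - C))"
        by (simp only: g(2)[OF C(1) A] g(2)[OF D A])
      also have "\<dots> = emeasure Q (A \<times> C \<union> A \<times> (C' - C))"
        using A C D sQ by (intro plus_emeasure) auto
      also have "A \<times> C \<union> A \<times> (C' - C) = A \<times> C'" using C(3) by auto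
      also have "emeasure Q (A \<times> C') = (\<integral>\<^sup>+\<gamma>\<in>A. g C' \<gamma> \<partial>?Q1)" by (rule g(2)[OF C(2) A])
      finally show "(\<integral>\<^sup>+\<gamma>\<in>A. (g C \<gamma> + g (C' - C) \<gamma>) \<partial>?Q1) = (\<integral>\<^sup>+\<gamma>\<in>A. g C' \<gamma> \<partial>?Q1)" .
    qed (use g(1) C D in auto)
    then show ?thesis by eventually_elim (metis le_iff_add)
  qed
  have g_le: "AE \<gamma> in ?Q1. g C \<gamma> \<le> 1" if "C \<in> sets borel" for C
    using g_UNIV g_mono[OF that _ subset_UNIV] by (auto elim: AE_mp)
  have g_neg: "AE \<gamma> in ?Q1. g {..q} \<gamma> = 0" if "q < 0" for q
  proof -
    have "AE \<gamma> in ?Q1. g {..q} \<gamma> = (\<lambda>_. 0) \<gamma>"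
    proof (rule AE_eqI)
      fix A :: "'m set" assume A: "A \<in> sets borel"
      have "emeasure Q (A \<times> {..q}) \<le> emeasure Q (UNIV \<times> (- {0..<1}))"
        using A that sQ by (intro emeasure_mono) (auto simp: borel_comp)
      then show "(\<integral>\<^sup>+\<gamma>\<in>A. g {..q} \<gamma> \<partial>?Q1) = (\<integral>\<^sup>+\<gamma>\<in>A. 0 \<partial>?Q1)"
        by (simp add: g(2)[OF _ A, symmetric] supp)
    qed (use g(1) in auto)
    then show ?thesis by simp
  qed
  have g_one: "AE \<gamma> in ?Q1. g {..q} \<gamma> = 1" if "1 \<le> q" for q
  proof -
    have "AE \<gamma> in ?Q1. g {..q} \<gamma> = (\<lambda>_. 1) \<gamma>"
    proof (rule AE_eqI)
      fix A :: "'m set" assume A: "A \<in> sets borel"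
      have "emeasure Q (A \<times> {q<..}) \<le> emeasure Q (UNIV \<times> (- {0..<1}))"
        using A that sQ by (intro emeasure_mono) (auto simp: borel_comp)
      then have "emeasure Q (A \<times> {q<..}) = 0" using supp by simp
      moreover have "emeasure Q (A \<times> {..q}) + emeasure Q (A \<times> {q<..}) = emeasure Q (A \<times> {..q} \<union> A \<times> {q<..})"
        using A sQ by (intro plus_emeasure) auto
      moreover have "A \<times> {..q} \<union> A \<times> {q<..} = A \<times> UNIV" by auto
      ultimately show "(\<integral>\<^sup>+\<gamma>\<in>A. g {..q} \<gamma> \<partial>?Q1) = (\<integral>\<^sup>+\<gamma>\<in>A. 1 \<partial>?Q1)"
        using A by (simp add: g(2)[OF _ A, symmetric] Q1e)
    qed (use g(1) in auto)
    then show ?thesis by simp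
  qed
  \<comment> \<open>Outside \<open>{0..<1}\<close> the values are prescribed and inside they are cut
    at 1. The limits at both infinities then hold for every \<gamma>, and the support assumption
    makes the change invisible a.e.\<close>
  define F where "F q \<gamma> = (if q < 0 then 0 else if q \<ge> 1 then 1 else enn2real (min 1 (g {..q} \<gamma>)))" for q :: real and \<gamma>
  have F01: "0 \<le> F q \<gamma>" "F q \<gamma> \<le> 1" for q \<gamma>
    by (auto simp: F_def enn2real_leI)
  have F_meas [measurable]: "F q \<in> borel_measurable borel" for q
    using g(1)[of "{..q}"] unfolding F_def by measurable
  have F_g: "AE \<gamma> in ?Q1. ennreal (F q \<gamma>) = g {..q} \<gamma>" for q
  proof -
    have "AE \<gamma> in ?Q1. g {..q} \<gamma> \<le> 1" by (rule g_le) simp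
    moreover have "AE \<gamma> in ?Q1. q < 0 \<longrightarrow> g {..q} \<gamma> = 0" using g_neg[of q] by (cases "q < 0") auto
    moreover have "AE \<gamma> in ?Q1. 1 \<le> q \<longrightarrow> g {..q} \<gamma> = 1" using g_one[of q] by (cases "1 \<le> q") auto
    ultimately show ?thesis
      by eventually_elim (auto simp: F_def min_absorb2 intro!: ennreal_enn2real order.strict_trans1[OF _ ennreal_one_less_top])
  qed
  define J where "J x = {q \<in> \<rat>. x < q}" for x :: real
  have J: "countable (J x)" "J x \<noteq> {}" for x
    unfolding J_def using countable_rat Rats_dense_in_real[of x "x + 1"] by (auto intro: countable_subset)
  define H where "H \<gamma> x = (INF q\<in>J x. F q \<gamma>)" for \<gamma> x
  have bddF: "bdd_below ((\<lambda>q. F q \<gamma>) ` X)" for \<gamma> X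
    using F01 by (auto intro!: bdd_belowI[of _ 0])
  have H_le: "H \<gamma> x \<le> F q \<gamma>" if "q \<in> \<rat>" "x < q" for \<gamma> x q
    unfolding H_def using that by (intro cINF_lower bddF) (auto simp: J_def)
  have H_ge: "c \<le> H \<gamma> x" if "\<And>q. q \<in> \<rat> \<Longrightarrow> x < q \<Longrightarrow> c \<le> F q \<gamma>" for \<gamma> x c
    unfolding H_def using that J(2) by (intro cINF_greatest) (auto simp: J_def)
  have H0: "0 \<le> H \<gamma> x" for \<gamma> x by (rule H_ge) (rule F01)
  have H_neg: "H \<gamma> x = 0" if neg: "x < 0" for \<gamma> x
  proof -
    obtain q where q: "q \<in> \<rat>" "x < q" "q < 0" using Rats_dense_in_real[OF neg] by auto
    have "H \<gamma> x \<le> F q \<gamma>" using q by (intro H_le)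
    with q(3) H0[of \<gamma> x] show ?thesis by (simp add: F_def)
  qed
  have H_one: "H \<gamma> x = 1" if "1 \<le> x" for \<gamma> x
  proof -
    have "1 \<le> H \<gamma> x" using that by (intro H_ge) (auto simp: F_def)
    moreover obtain q where "q \<in> \<rat>" "x < q" using Rats_dense_in_real[of x "x + 1"] by auto
    then have "H \<gamma> x \<le> 1" using H_le F01(2) order_trans by blast
    ultimately show ?thesis by simp
  qed
  have H_mono: "H \<gamma> x \<le> H \<gamma> y" if "x \<le> y" for \<gamma> x y
    using that by (intro H_ge H_le) auto
  have H_rc: "continuous (at_right x) (H \<gamma>)" for \<gamma> x
    unfolding continuous_within
  proof (rule tendstoI)
    fix e :: real assume e: "0 < e"
    have "\<exists>q\<in>J x. F q \<gamma> < H \<gamma> x + e"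
    proof (rule ccontr)
      assume "\<not> ?thesis"
      then have "H \<gamma> x + e \<le> H \<gamma> x" by (intro H_ge) (auto simp: J_def not_less)
      with e show False by simp
    qed
    then obtain q where q: "q \<in> \<rat>" "x < q" "F q \<gamma> < H \<gamma> x + e" by (auto simp: J_def)
    have "dist (H \<gamma> y) (H \<gamma> x) < e" if "x < y" "y < q" for y
      using H_mono[where \<gamma> = \<gamma> and x = x and y = y] H_le[OF q(1) that(2), of \<gamma>] q(3) that by (simp add: dist_real_def)
    then show "\<forall>\<^sub>F y in at_right x. dist (H \<gamma> y) (H \<gamma> x) < e"
      using q(2) by (auto simp: eventually_at_right)
  qed
  have H_bot: "(H \<gamma> \<longlongrightarrow> 0) at_bot" for \<gamma>
    by (rule tendsto_eventually) (auto simp: eventually_at_bot_dense H_neg intro!: exI[of _ 0])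
  have H_top: "(H \<gamma> \<longlongrightarrow> 1) at_top" for \<gamma>
    by (rule tendsto_eventually) (auto simp: eventually_at_top_linorder H_one intro!: exI[of _ 1])
  define \<kappa> where "\<kappa> \<gamma> = interval_measure (H \<gamma>)" for \<gamma>
  have \<kappa>_real: "real_distribution (\<kappa> \<gamma>)" for \<gamma>
    unfolding \<kappa>_def by (rule real_distribution_interval_measure[OF H_mono H_rc H_bot H_top])
  have \<kappa>_Iic: "emeasure (\<kappa> \<gamma>) {..x} = ennreal (H \<gamma> x)" for \<gamma> x
    unfolding \<kappa>_def by (rule emeasure_interval_measure_Iic[OF H_mono H_rc H_bot])
  have H_meas: "(\<lambda>\<gamma>. H \<gamma> x) \<in> borel_measurable borel" for x
    unfolding H_def using J(1) by (intro borel_measurable_cINF_real F_meas)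
  have gen: "sets (borel::real measure) = sigma_sets UNIV (range atMost)"
    by (subst borel_eq_atMost) simp
  have \<kappa>_meas: "\<kappa> \<in> measurable borel (prob_algebra borel)"
  proof (rule measurable_prob_algebra_generated[where \<Omega> = UNIV and G = "range atMost"])
    show "sets (borel::real measure) = sigma_sets UNIV (range atMost)" by (rule gen)
    show "Int_stable (range (atMost :: real \<Rightarrow> _))" by (auto simp: Int_stable_def)
    show "prob_space (\<kappa> \<gamma>)" "sets (\<kappa> \<gamma>) = sets borel" for \<gamma>
      using \<kappa>_real[of \<gamma>] by (auto simp: real_distribution_def real_distribution_axioms_def)
    show "(\<lambda>a. emeasure (\<kappa> a) A) \<in> borel_measurable borel" if "A \<in> range atMost" for A
      using that H_meas by (auto simp: \<kappa>_Iic)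
  qed auto
  \<comment> \<open>One inequality holds because \<open>g {..x}\<close> is a.e. below
    \<open>F q\<close> for all rational \<open>q > x\<close> at once, hence below their infimum. For
    the other, \<open>H\<close> is below each such \<open>F q\<close>, and \<open>Q\<close> is
    continuous from above as \<open>q\<close> decreases to \<open>x\<close>.\<close>
  have Iic: "emeasure Q (A \<times> {..x}) = (\<integral>\<^sup>+\<gamma>\<in>A. emeasure (\<kappa> \<gamma>) {..x} \<partial>?Q1)" if A: "A \<in> sets borel" for A x
  proof (rule antisym)
    have "AE \<gamma> in ?Q1. \<forall>q\<in>J x. g {..x} \<gamma> \<le> ennreal (F q \<gamma>)"
    proof (subst AE_ball_countable[OF J(1)], rule ballI)
      fix q assume "q \<in> J x"
      then have "AE \<gamma> in ?Q1. g {..x} \<gamma> \<le> g {..q} \<gamma>" by (intro g_mono) (auto simp: J_def)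
      with F_g[of q] show "AE \<gamma> in ?Q1. g {..x} \<gamma> \<le> ennreal (F q \<gamma>)" by eventually_elim simp
    qed
    with F_g[of x] have "AE \<gamma> in ?Q1. g {..x} \<gamma> \<le> ennreal (H \<gamma> x)"
    proof eventually_elim
      fix \<gamma> assume *: "ennreal (F x \<gamma>) = g {..x} \<gamma>" "\<forall>q\<in>J x. g {..x} \<gamma> \<le> ennreal (F q \<gamma>)"
      have "F x \<gamma> \<le> H \<gamma> x"
        by (rule H_ge) (use * F01 in \<open>auto simp: *(1)[symmetric] J_def\<close>)
      then show "g {..x} \<gamma> \<le> ennreal (H \<gamma> x)" by (simp add: *(1)[symmetric] ennreal_leI)
    qed
    then have "(\<integral>\<^sup>+\<gamma>\<in>A. g {..x} \<gamma> \<partial>?Q1) \<le> (\<integral>\<^sup>+\<gamma>\<in>A. ennreal (H \<gamma> x) \<partial>?Q1)"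
      by (intro nn_integral_mono_AE) (auto elim!: AE_mp simp: indicator_def)
    then show "emeasure Q (A \<times> {..x}) \<le> (\<integral>\<^sup>+\<gamma>\<in>A. emeasure (\<kappa> \<gamma>) {..x} \<partial>?Q1)"
      by (simp add: g(2)[OF _ A] \<kappa>_Iic)
  next
    have le: "(\<integral>\<^sup>+\<gamma>\<in>A. emeasure (\<kappa> \<gamma>) {..x} \<partial>?Q1) \<le> emeasure Q (A \<times> {..q})" if q: "q \<in> \<rat>" "x < q" for q
    proof -
      have "(\<integral>\<^sup>+\<gamma>\<in>A. ennreal (H \<gamma> x) \<partial>?Q1) \<le> (\<integral>\<^sup>+\<gamma>\<in>A. ennreal (F q \<gamma>) \<partial>?Q1)"
        using H_le[OF q] by (intro nn_integral_mono mult_right_mono ennreal_leI) auto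
      also have "\<dots> = (\<integral>\<^sup>+\<gamma>\<in>A. g {..q} \<gamma> \<partial>?Q1)"
        using F_g[of q] by (intro nn_integral_cong_AE) (auto elim!: AE_mp)
      finally show ?thesis by (simp add: g(2)[OF _ A] \<kappa>_Iic)
    qed
    have "\<exists>q\<in>\<rat>. x < q \<and> q < x + 1 / real (Suc n)" for n
      using Rats_dense_in_real[of x "x + 1 / real (Suc n)"] by auto
    then obtain q where q: "\<And>n. q n \<in> \<rat>" "\<And>n. x < q n" "\<And>n. q n < x + 1 / real (Suc n)" by metis
    have le': "(\<integral>\<^sup>+\<gamma>\<in>A. emeasure (\<kappa> \<gamma>) {..x} \<partial>?Q1) \<le> emeasure Q (A \<times> {..x + 1 / real (Suc n)})" for n
    proof -
      have "emeasure Q (A \<times> {..q n}) \<le> emeasure Q (A \<times> {..x + 1 / real (Suc n)})"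
        using q(3)[of n] A sQ by (intro emeasure_mono) auto
      with le[OF q(1,2), of n] show ?thesis by simp
    qed
    have lim: "(\<lambda>n. emeasure Q (A \<times> {..x + 1 / real (Suc n)})) \<longlonglongrightarrow> emeasure Q (\<Inter>n. A \<times> {..x + 1 / real (Suc n)})"
    proof (rule Lim_emeasure_decseq)
      show "decseq (\<lambda>n. A \<times> {..x + 1 / real (Suc n)})"
      proof (rule decseq_SucI)
        fix n
        have "1 / real (Suc (Suc n)) \<le> 1 / real (Suc n)" by (intro frac_le) auto
        then show "A \<times> {..x + 1 / real (Suc (Suc n))} \<subseteq> A \<times> {..x + 1 / real (Suc n)}"
          by (intro Sigma_mono) auto
      qed
      show "range (\<lambda>n. A \<times> {..x + 1 / real (Suc n)}) \<subseteq> sets Q"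
        using A sQ by (simp add: image_subset_iff)
    qed simp
    have int: "(\<Inter>n. A \<times> {..x + 1 / real (Suc n)}) = A \<times> {..x}"
    proof -
      have "y \<le> x" if "\<And>n. y \<le> x + 1 / real (Suc n)" for y
      proof (rule field_le_epsilon)
        fix e :: real assume "0 < e"
        then obtain n where "1 / real (Suc n) < e" by (metis nat_approx_posE)
        with that[of n] show "y \<le> x + e" by simp
      qed
      moreover have "y \<le> x + 1 / real (Suc n)" if "y \<le> x" for y n
      proof -
        have "0 \<le> 1 / real (Suc n)" by simp
        with that show ?thesis by linarith
      qed
      ultimately have "(\<forall>n. y \<le> x + 1 / real (Suc n)) \<longleftrightarrow> y \<le> x" for y by blast
      then show ?thesis by (simp add: set_eq_iff del: of_nat_Suc)
    qed
    show "(\<integral>\<^sup>+\<gamma>\<in>A. emeasure (\<kappa> \<gamma>) {..x} \<partial>?Q1) \<le> emeasure Q (A \<times> {..x})"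
      using le' by (intro LIMSEQ_le_const[OF lim[unfolded int]]) blast
  qed
  show thesis
  proof (rule that[OF \<kappa>_meas])
    fix A :: "'m set" and C :: "real set" assume A: "A \<in> sets borel" and C: "C \<in> sets borel"
    \<comment> \<open>With \<open>A\<close> fixed, both sides of the claim are finite measures in
      \<open>C\<close>; they agree on half-lines and hence everywhere.\<close>
    define R1 where "R1 = distr (density Q (indicator (A \<times> UNIV))) borel snd"
    define R2 where "R2 = density ?Q1 (indicator A) \<bind> \<kappa>"
    have R1: "emeasure R1 D = emeasure Q (A \<times> D)" if D: "D \<in> sets borel" for D
    proof -
      have "emeasure R1 D = emeasure (density Q (indicator (A \<times> UNIV))) (UNIV \<times> D)"
        unfolding R1_def using D by (subst emeasure_distr) (auto simp: sp intro!: arg_cong2[where f = emeasure])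
      also have "\<dots> = emeasure Q ((A \<times> UNIV) \<inter> (UNIV \<times> D))"
        using A D sQ by (intro emeasure_restricted) auto
      also have "(A \<times> UNIV) \<inter> (UNIV \<times> D) = A \<times> D" by auto
      finally show ?thesis .
    qed
    have \<kappa>_sub: "\<kappa> \<in> measurable borel (subprob_algebra borel)"
      by (rule measurable_prob_algebraD[OF \<kappa>_meas])
    have R2: "emeasure R2 D = (\<integral>\<^sup>+\<gamma>\<in>A. emeasure (\<kappa> \<gamma>) D \<partial>?Q1)" if D: "D \<in> sets borel" for D
    proof -
      have [measurable]: "(\<lambda>\<gamma>. emeasure (\<kappa> \<gamma>) D) \<in> borel_measurable borel"
        using measurable_emeasure_kernel[OF \<kappa>_sub D] .
      have "emeasure R2 D = (\<integral>\<^sup>+\<gamma>. emeasure (\<kappa> \<gamma>) D \<partial>density ?Q1 (indicator A))"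
        unfolding R2_def using D \<kappa>_sub
        by (intro emeasure_bind) (auto simp: cong: measurable_cong_sets)
      also have "\<dots> = (\<integral>\<^sup>+\<gamma>\<in>A. emeasure (\<kappa> \<gamma>) D \<partial>?Q1)"
        using A by (subst nn_integral_density) (auto simp: mult.commute)
      finally show ?thesis .
    qed
    have "R1 = R2"
    proof (rule measure_eqI_generator_eq[where \<Omega> = UNIV and E = "range atMost" and A = "\<lambda>n. {..real n}"])
      show "Int_stable (range (atMost :: real \<Rightarrow> _))" by (auto simp: Int_stable_def)
      show "emeasure R1 X = emeasure R2 X" if "X \<in> range atMost" for X
        using that Iic[OF A] by (auto simp: R1 R2)
      show "sets R1 = sigma_sets UNIV (range atMost)"
        by (simp add: R1_def gen)
      have "sets R2 = sets borel"
        unfolding R2_def by (intro sets_bind) (simp_all add: \<kappa>_def)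
      then show "sets R2 = sigma_sets UNIV (range atMost)"
        by (simp add: gen)
      show "(\<Union>i. {..real i}) = UNIV" using real_arch_simple by auto
      show "emeasure R1 {..real i} \<noteq> \<infinity>" for i by (simp add: R1)
    qed auto
    then show "emeasure Q (A \<times> C) = (\<integral>\<^sup>+\<gamma>\<in>A. emeasure (\<kappa> \<gamma>) C \<partial>?Q1)"
      using R1[OF C] R2[OF C] by simp
  qed
qed

section \<open>Borel coding of Polish spaces by reals\<close>

text \<open>With digits 0 and 1 only, every tail of a base 4 expansion is at most 1/3. There is no
  carry and no double representation, so the digits can be read off by floor and remainder.\<close>

lemma base4_digit:
  fixes b :: "nat \<Rightarrow> bool"
  defines "s \<equiv> (\<Sum>k. of_bool (b k) * (1/4) ^ Suc k :: real)"
  shows "0 \<le> s" "s < 1" "\<lfloor>4 ^ Suc j * s\<rfloor> mod 4 = of_bool (b j)"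
proof -
  have geo: "(\<lambda>k. (1/4::real) ^ Suc k) sums (1/3)"
    using sums_mult[OF geometric_sums[of "1/4::real"], of "1/4"] by simp
  have summ: "summable (\<lambda>k. of_bool (c k) * (1/4::real) ^ Suc k)" for c :: "nat \<Rightarrow> bool"
    by (rule summable_comparison_test'[OF sums_summable[OF geo]]) (auto simp: of_bool_def)
  have bound: "0 \<le> (\<Sum>k. of_bool (c k) * (1/4::real) ^ Suc k) \<and> (\<Sum>k. of_bool (c k) * (1/4::real) ^ Suc k) \<le> 1/3"
    for c :: "nat \<Rightarrow> bool"
  proof
    show "0 \<le> (\<Sum>k. of_bool (c k) * (1/4::real) ^ Suc k)"
      by (rule suminf_nonneg[OF summ]) simp
    have "(\<Sum>k. of_bool (c k) * (1/4::real) ^ Suc k) \<le> (\<Sum>k. (1/4::real) ^ Suc k)"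
      by (rule suminf_le[OF _ summ sums_summable[OF geo]]) (simp add: of_bool_def)
    then show "(\<Sum>k. of_bool (c k) * (1/4::real) ^ Suc k) \<le> 1/3"
      by (simp only: sums_unique[OF geo, symmetric])
  qed
  show "0 \<le> s" "s < 1" using bound[of b] by (auto simp: s_def)
  \<comment> \<open>Shifting by \<open>Suc j\<close> places leaves four times the integer
    \<open>I\<close> of earlier digits, the digit \<open>b j\<close>, and the fractional tail
    \<open>t\<close>.\<close>
  define t where "t = (\<Sum>k. of_bool (b (k + Suc j)) * (1/4::real) ^ Suc k)"
  define I where "I = (\<Sum>k<j. of_bool (b k) * 4 ^ (j - Suc k) :: int)"
  have "s = (\<Sum>k. of_bool (b (k + Suc j)) * (1/4::real) ^ Suc (k + Suc j)) + (\<Sum>k<Suc j. of_bool (b k) * (1/4) ^ Suc k)"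
    unfolding s_def by (rule suminf_split_initial_segment[OF summ])
  also have "(\<Sum>k. of_bool (b (k + Suc j)) * (1/4::real) ^ Suc (k + Suc j)) = (1/4) ^ Suc j * t"
    unfolding t_def by (subst suminf_mult[OF summ, symmetric]) (simp add: power_add algebra_simps)
  finally have "4 ^ Suc j * s = t + 4 ^ Suc j * (\<Sum>k<Suc j. of_bool (b k) * (1/4) ^ Suc k)"
    by (simp add: algebra_simps power_divide)
  also have "4 ^ Suc j * (\<Sum>k<Suc j. of_bool (b k) * (1/4::real) ^ Suc k) = of_int (4 * I + of_bool (b j))"
  proof -
    have "4 ^ Suc j * (of_bool (b k) * (1/4::real) ^ Suc k) = 4 * (of_bool (b k) * 4 ^ (j - Suc k))" if "k < j" for k
    proof -
      have "(4::real) ^ Suc j = 4 ^ Suc k * (4 * 4 ^ (j - Suc k))"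
        using that by (simp add: power_add[symmetric] power_Suc[symmetric] Suc_diff_Suc del: power_Suc)
      then show ?thesis by (simp add: power_divide)
    qed
    then have "(\<Sum>k<j. 4 ^ Suc j * (of_bool (b k) * (1/4::real) ^ Suc k)) = (\<Sum>k<j. 4 * (of_bool (b k) * 4 ^ (j - Suc k)))"
      by (intro sum.cong) auto
    moreover have "4 ^ Suc j * (of_bool (b j) * (1/4::real) ^ Suc j) = of_bool (b j)"
      by (simp add: power_divide)
    ultimately have "4 ^ Suc j * (\<Sum>k<Suc j. of_bool (b k) * (1/4::real) ^ Suc k) =
      (\<Sum>k<j. 4 * (of_bool (b k) * 4 ^ (j - Suc k))) + of_bool (b j)"
      by (simp only: sum.lessThan_Suc distrib_left sum_distrib_left)
    then show ?thesis
      by (simp only: I_def of_int_add of_int_mult of_int_sum of_int_of_bool of_int_power of_int_numeral sum_distrib_left)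
  qed
  finally have *: "4 ^ Suc j * s = of_int (4 * I + of_bool (b j)) + t" by simp
  have "\<lfloor>4 ^ Suc j * s\<rfloor> = 4 * I + of_bool (b j)"
    unfolding * using bound[of "\<lambda>k. b (k + Suc j)"] by (intro floor_unique) (auto simp: t_def)
  then show "\<lfloor>4 ^ Suc j * s\<rfloor> mod 4 = of_bool (b j)" by simp
qed

text \<open>A Borel coding of a Polish space by reals: the base 4 digits of the code of a point record which
  balls around the points of a dense sequence contain it. Only a Borel left inverse of the coding is
  needed, so the range of the coding need not be known to be Borel.\<close>

lemma polish_real_coding:
  obtains a :: "'k::polish_space \<Rightarrow> real" and p :: "real \<Rightarrow> 'k"
  where "a \<in> borel_measurable borel" "p \<in> borel_measurable borel" "\<And>y. p (a y) = y" "\<And>y. a y \<in> {0..<1}"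
proof -
  obtain D :: "'k set" where D: "countable D" "\<And>X. open X \<Longrightarrow> X \<noteq> {} \<Longrightarrow> \<exists>d\<in>D. d \<in> X"
    using countable_dense_setE by blast
  have "D \<noteq> {}" using D(2)[of UNIV] by auto
  define c where "c = from_nat_into D"
  have c: "\<exists>i. dist y (c i) < e" if e: "0 < e" for y e
  proof -
    have "\<exists>d\<in>D. d \<in> ball y e" using e by (intro D(2)) auto
    then obtain d where "d \<in> D" "d \<in> ball y e" by blast
    moreover obtain i where "c i = d"
      unfolding c_def using from_nat_into_surj[OF D(1) \<open>d \<in> D\<close>] by blast
    ultimately show ?thesis by auto
  qed
  \<comment> \<open>The index \<open>j\<close> encodes a pair: the first component fixes the radius,
    the second the centre in the dense sequence.\<close>
  define b where "b y j \<longleftrightarrow> dist y (c (snd (prod_decode j))) < (1/2) ^ fst (prod_decode j)" for y j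
  define a where "a y = (\<Sum>k. of_bool (b y k) * (1/4) ^ Suc k :: real)" for y
  define dig where "dig j x \<longleftrightarrow> \<lfloor>4 ^ Suc j * x\<rfloor> mod 4 = 1" for j and x :: real
  have dig: "dig j (a y) = b y j" for j y
    using base4_digit(3)[of j "b y"] by (simp add: dig_def a_def)
  \<comment> \<open>The decoder at precision \<open>n\<close>: the first centre whose ball of radius
    \<open>(1/2) ^ n\<close> is recorded in the digits of \<open>x\<close>. On codes it is within
    that radius of the coded point.\<close>
  define q where "q n x = c (LEAST i. dig (prod_encode (n, i)) x)" for n x
  \<comment> \<open>Reals that are not codes may give divergent sequences; testing the Cauchy
    property, with default value \<open>c 0\<close>, makes the limit a Borel function on all
    reals.\<close>
  define p where "p x = (if Cauchy (\<lambda>n. q n x) then lim (\<lambda>n. q n x) else c 0)" for x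
  have q_close: "dist y (q n (a y)) < (1/2) ^ n" for n y
  proof -
    obtain i where "dist y (c i) < (1/2) ^ n" using c[of "(1/2) ^ n" y] by auto
    then have "dig (prod_encode (n, i)) (a y)" by (simp add: dig b_def)
    then have "dig (prod_encode (n, LEAST i. dig (prod_encode (n, i)) (a y))) (a y)" by (rule LeastI)
    then show ?thesis by (simp add: dig b_def q_def)
  qed
  have q_lim: "(\<lambda>n. q n (a y)) \<longlonglongrightarrow> y" for y
  proof (rule metric_LIMSEQ_I)
    fix r :: real assume "0 < r"
    then obtain N where N: "(1/2::real) ^ N < r" using real_arch_pow_inv[of r "1/2"] by auto
    have "dist (q n (a y)) y < r" if "N \<le> n" for n
    proof -
      have "dist (q n (a y)) y < (1/2) ^ n" using q_close[of y n] by (simp add: dist_commute)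
      also have "(1/2::real) ^ n \<le> (1/2) ^ N" using that by (intro power_decreasing) auto
      finally show ?thesis using N by simp
    qed
    then show "\<exists>N. \<forall>n\<ge>N. dist (q n (a y)) y < r" by blast
  qed
  have [measurable]: "Measurable.pred borel (dig j)" for j
    unfolding dig_def by measurable
  have q_meas [measurable]: "q n \<in> borel_measurable borel" for n
    unfolding q_def by measurable
  have "p \<in> borel_measurable borel"
  proof (rule borel_measurable_LIMSEQ_metric)
    show "(\<lambda>x. if Cauchy (\<lambda>n. q n x) then q i x else c 0) \<in> borel_measurable borel" for i
      by measurable
    show "(\<lambda>i. if Cauchy (\<lambda>n. q n x) then q i x else c 0) \<longlonglongrightarrow> p x" for x
      unfolding p_def by (auto simp: Cauchy_convergent_iff convergent_LIMSEQ_iff)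
  qed
  moreover have "p (a y) = y" for y
    using q_lim[of y] by (auto simp: p_def Cauchy_convergent_iff convergent_def intro!: limI)
  moreover have "a \<in> borel_measurable borel"
  proof -
    have [measurable]: "Measurable.pred borel (\<lambda>y. b y k)" for k unfolding b_def by measurable
    show ?thesis unfolding a_def by measurable
  qed
  moreover have "a y \<in> {0..<1}" for y
    using base4_digit(1,2)[of "b y"] by (simp add: a_def)
  ultimately show thesis by (intro that[of a p]) auto
qed

section \<open>Disintegrations with Polish fibres\<close>

text \<open>Code the second coordinate by a real, take the real kernel, and push it back by the
  decoder. Since \<open>p\<close> is a left inverse of \<open>a\<close>, the preimage of
  \<open>C\<close> under \<open>p\<close> after \<open>a\<close> is \<open>C\<close> again.\<close>

lemma kernel_exists:
  fixes Q :: "('m::second_countable_topology \<times> 'k::polish_space) measure"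
  assumes fQ: "finite_measure Q" and sQ [measurable_cong]: "sets Q = sets borel"
  obtains \<kappa> :: "'m \<Rightarrow> 'k measure" where "\<kappa> \<in> measurable borel (prob_algebra borel)"
    "\<And>A C. A \<in> sets borel \<Longrightarrow> C \<in> sets borel \<Longrightarrow>
      emeasure Q (A \<times> C) = (\<integral>\<^sup>+\<gamma>\<in>A. emeasure (\<kappa> \<gamma>) C \<partial>distr Q borel fst)"
proof -
  interpret Q: finite_measure Q by fact
  obtain a :: "'k \<Rightarrow> real" and p where ap [measurable]: "a \<in> borel_measurable borel" "p \<in> borel_measurable borel"
    and pa: "\<And>y. p (a y) = y" and a01: "\<And>y. a y \<in> {0..<1}"
    using polish_real_coding by metis
  have sp: "space Q = UNIV" using sets_eq_imp_space_eq[OF sQ] by simp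
  define Q' where "Q' = distr Q borel (\<lambda>z. (fst z, a (snd z)))"
  have m: "(\<lambda>z. (fst z, a (snd z))) \<in> measurable Q borel" by measurable
  have Q': "emeasure Q' (A \<times> C) = emeasure Q (A \<times> a -` C)" if "A \<in> sets borel" "C \<in> sets borel" for A C
    unfolding Q'_def using that m
    by (subst emeasure_distr) (auto simp: sp intro!: arg_cong2[where f = emeasure])
  have marg: "distr Q' borel fst = distr Q borel fst"
    unfolding Q'_def using m by (subst distr_distr) (auto simp: comp_def)
  have fQ': "finite_measure Q'" unfolding Q'_def by (rule Q.finite_measure_distr[OF m])
  have sQ': "sets Q' = sets borel" by (simp add: Q'_def)
  have "a -` (- {0..<1}) = {}" using a01 by auto
  then have "emeasure Q' (UNIV \<times> - {0..<1}) = 0"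
    by (subst Q') (auto simp: borel_comp)
  from real_kernel_exists[OF fQ' sQ' this]
  obtain \<kappa> where \<kappa>: "\<kappa> \<in> measurable borel (prob_algebra borel)"
    "\<And>A C. A \<in> sets borel \<Longrightarrow> C \<in> sets borel \<Longrightarrow>
      emeasure Q' (A \<times> C) = (\<integral>\<^sup>+\<gamma>\<in>A. emeasure (\<kappa> \<gamma>) C \<partial>distr Q' borel fst)"
    by metis
  show thesis
  proof (rule that)
    show "(\<lambda>\<gamma>. distr (\<kappa> \<gamma>) borel p) \<in> measurable borel (prob_algebra borel)"
      using measurable_compose[OF \<kappa>(1) measurable_distr_prob_space[OF ap(2)]] .
    fix A :: "'m set" and C :: "'k set" assume A: "A \<in> sets borel" and C: "C \<in> sets borel"
    have pC: "p -` C \<in> sets borel" using measurable_sets[OF ap(2) C] by simp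
    have \<kappa>s: "sets (\<kappa> \<gamma>) = sets borel" for \<gamma>
      using measurable_space[OF \<kappa>(1), of \<gamma>] by (simp add: space_prob_algebra)
    have *: "emeasure (distr (\<kappa> \<gamma>) borel p) C = emeasure (\<kappa> \<gamma>) (p -` C)" for \<gamma>
      using C sets_eq_imp_space_eq[OF \<kappa>s[of \<gamma>]] ap(2)
      by (subst emeasure_distr) (auto simp: measurable_cong_sets[OF \<kappa>s refl])
    have "a -` p -` C = C" using pa by auto
    then have "emeasure Q (A \<times> C) = emeasure Q' (A \<times> p -` C)" using A pC by (simp add: Q')
    also have "\<dots> = (\<integral>\<^sup>+\<gamma>\<in>A. emeasure (\<kappa> \<gamma>) (p -` C) \<partial>distr Q' borel fst)"
      using A pC by (rule \<kappa>(2))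
    finally show "emeasure Q (A \<times> C) = (\<integral>\<^sup>+\<gamma>\<in>A. emeasure (distr (\<kappa> \<gamma>) borel p) C \<partial>distr Q borel fst)"
      by (simp only: * marg)
  qed
qed

lemma disintegration_exists:
  fixes Q :: "('m::polish_space \<times> 'k::polish_space) measure"
  assumes fQ: "finite_measure Q" and sQ [measurable_cong]: "sets Q = sets borel"
    and m: "finite_measure m" "sets m = sets borel"
    and ac: "absolutely_continuous m (distr Q borel fst)"
  shows "\<exists>\<kappa> \<phi>\<^sub>1. disintegration m Q \<kappa> \<phi>\<^sub>1"
proof -
  interpret Q: finite_measure Q by fact
  interpret m: finite_measure m by fact
  let ?Q1 = "distr Q borel fst"
  interpret Q1: finite_measure ?Q1 by (rule Q.finite_measure_distr) measurable
  have sp: "space Q = UNIV" using sets_eq_imp_space_eq[OF sQ] by simp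
  have s1: "sets ?Q1 = sets m" using m(2) by simp
  \<comment> \<open>A version of the Radon-Nikodym derivative that is real and nonnegative
    everywhere, as \<open>disintegration\<close> demands.\<close>
  obtain u where u: "u \<in> borel_measurable m" "\<And>x. 0 \<le> u x" "AE x in m. RN_deriv m ?Q1 x = ennreal (u x)"
    using m.real_RN_deriv[OF Q1.finite_measure_axioms ac s1] by metis
  have du: "density m (\<lambda>x. ennreal (u x)) = ?Q1"
    using u by (subst m.density_RN_deriv[OF ac s1, symmetric]) (auto intro!: density_cong)
  obtain \<kappa> :: "'m \<Rightarrow> 'k measure" where \<kappa>: "\<kappa> \<in> measurable borel (prob_algebra borel)"
    "\<And>A C. A \<in> sets borel \<Longrightarrow> C \<in> sets borel \<Longrightarrow>
      emeasure Q (A \<times> C) = (\<integral>\<^sup>+\<gamma>\<in>A. emeasure (\<kappa> \<gamma>) C \<partial>?Q1)"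
    using kernel_exists[OF fQ sQ] by metis
  have \<kappa>s: "sets (\<kappa> \<gamma>) = sets borel" "prob_space (\<kappa> \<gamma>)" for \<gamma>
    using measurable_space[OF \<kappa>(1), of \<gamma>] by (simp_all add: space_prob_algebra)
  have \<kappa>sp: "space (\<kappa> \<gamma>) = UNIV" for \<gamma> using sets_eq_imp_space_eq[OF \<kappa>s(1)[of \<gamma>]] by simp
  have Pm: "Pair \<gamma> \<in> measurable (\<kappa> \<gamma>) borel" for \<gamma>
    unfolding measurable_cong_sets[OF \<kappa>s(1) refl] by measurable
  \<comment> \<open>The conditional measures in \<open>disintegration\<close> live on the product
    space, so the kernel on \<open>'k\<close> is placed on the fibre over \<gamma>.\<close>
  define K where "K \<gamma> = distr (\<kappa> \<gamma>) borel (Pair \<gamma>)" for \<gamma>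
  have K: "emeasure (K \<gamma>) E = emeasure (\<kappa> \<gamma>) (Pair \<gamma> -` E)" if "E \<in> sets borel" for E \<gamma>
    unfolding K_def using that Pm by (subst emeasure_distr) (auto simp: \<kappa>sp)
  have K_rect: "emeasure (K \<gamma>) (A \<times> C) = indicator A \<gamma> * emeasure (\<kappa> \<gamma>) C" if "A \<in> sets borel" "C \<in> sets borel" for A C \<gamma>
    using that by (subst K) (auto simp: indicator_def)
  have K_meas: "K \<in> measurable borel (prob_algebra borel)"
  proof (rule measurable_prob_algebra_generated[where \<Omega> = UNIV])
    show "Int_stable {A \<times> B |A B. A \<in> sets (borel::'m measure) \<and> B \<in> sets (borel::'k measure)}"
      by (rule borel_prod_generator)
    show "sets (borel :: ('m \<times> 'k) measure) = sigma_sets UNIV {A \<times> B |A B. A \<in> sets borel \<and> B \<in> sets borel}"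
      by (rule borel_prod_generator)
    show "prob_space (K \<gamma>)" for \<gamma>
      unfolding K_def using \<kappa>s(2) Pm by (rule prob_space.prob_space_distr)
    show "sets (K \<gamma>) = sets borel" for \<gamma> by (simp add: K_def)
    fix E assume "E \<in> {A \<times> B |A B. A \<in> sets (borel::'m measure) \<and> B \<in> sets (borel::'k measure)}"
    then obtain A B where E: "E = A \<times> B" and [measurable]: "A \<in> sets borel" "B \<in> sets borel" by auto
    have [measurable]: "(\<lambda>\<gamma>. emeasure (\<kappa> \<gamma>) B) \<in> borel_measurable borel"
      using measurable_emeasure_kernel[OF measurable_prob_algebraD[OF \<kappa>(1)]] by simp
    show "(\<lambda>\<gamma>. emeasure (K \<gamma>) E) \<in> borel_measurable borel"
      unfolding E by (simp add: K_rect)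
  qed auto
  have K_sub: "K \<in> measurable borel (subprob_algebra borel)"
    by (rule measurable_prob_algebraD[OF K_meas])
  define R where "R = ?Q1 \<bind> K"
  have R: "emeasure R E = (\<integral>\<^sup>+\<gamma>. emeasure (K \<gamma>) E \<partial>?Q1)" if "E \<in> sets borel" for E
    unfolding R_def using that K_sub by (intro emeasure_bind) (auto cong: measurable_cong_sets)
  have "Q = R"
  proof (rule measure_eqI_rectangles[OF fQ sQ])
    show "sets R = sets borel"
      unfolding R_def by (intro sets_bind) (simp_all add: K_def)
    fix A :: "'m set" and B :: "'k set" assume *: "A \<in> sets borel" "B \<in> sets borel"
    then show "emeasure Q (A \<times> B) = emeasure R (A \<times> B)"
      by (simp add: R K_rect \<kappa>(2) mult.commute)
  qed
  moreover have "emeasure (K \<gamma>) ({\<gamma>} \<times> UNIV) = 1" for \<gamma>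
    using prob_space.emeasure_space_1[OF \<kappa>s(2)[of \<gamma>]] by (simp add: K_rect \<kappa>sp)
  ultimately have "disintegration m Q K u"
    unfolding disintegration_def using u du K_meas R m(2) by (auto cong: measurable_cong_sets)
  then show ?thesis by blast
qed

lemma the_disintegration:
  fixes Q :: "('m::polish_space \<times> 'k::polish_space) measure"
  assumes "finite_measure Q" "sets Q = sets borel" "finite_measure m" "sets m = sets borel"
    and "absolutely_continuous m (distr Q borel fst)"
  shows "disintegration m Q (cond_measure m Q) (base_density m Q)"
proof -
  have "\<exists>d. disintegration m Q (fst d) (snd d)"
    using disintegration_exists[OF assms] by auto
  then show ?thesis
    unfolding the_disintegration_def by (rule someI_ex)
qed

section \<open>Fibrewise representation of signed measures\<close>

text \<open>The formula says that \<mu> is the integral over \<open>m\<close> of the measures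
  \<open>R \<gamma>\<close> placed on the fibres. No Jordan parts and no normalisation enter, which
  makes the notion linear in \<open>R\<close> and \<mu> together.\<close>

definition fibre_rep ::
  "'m::topological_space measure \<Rightarrow> ('m \<Rightarrow> 'k::topological_space signed_measure) \<Rightarrow> ('m \<times> 'k) signed_measure \<Rightarrow> bool" where
  "fibre_rep m R \<mu> \<longleftrightarrow> (\<forall>E\<in>sets borel. integrable m (\<lambda>\<gamma>. sm (R \<gamma>) (Pair \<gamma> -` E)) \<and>
     sm \<mu> E = (\<integral>\<gamma>. sm (R \<gamma>) (Pair \<gamma> -` E) \<partial>m))"

lemma fibre_repD:
  assumes "fibre_rep m R \<mu>" "E \<in> sets borel"
  shows "integrable m (\<lambda>\<gamma>. sm (R \<gamma>) (Pair \<gamma> -` E))" "sm \<mu> E = (\<integral>\<gamma>. sm (R \<gamma>) (Pair \<gamma> -` E) \<partial>m)"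
  using assms unfolding fibre_rep_def by auto

lemma fibre_rep_lin:
  assumes "fibre_rep m R \<mu>" "fibre_rep m R' \<eta>"
  shows "fibre_rep m (\<lambda>\<gamma>. a *\<^sub>R R \<gamma> + b *\<^sub>R R' \<gamma>) (a *\<^sub>R \<mu> + b *\<^sub>R \<eta>)"
  using assms unfolding fibre_rep_def
  by (simp add: plus_signed_measure.rep_eq scaleR_signed_measure.rep_eq)

lemma fibre_rep_diff:
  assumes "fibre_rep m R \<mu>" "fibre_rep m R' \<eta>"
  shows "fibre_rep m (\<lambda>\<gamma>. R \<gamma> - R' \<gamma>) (\<mu> - \<eta>)"
  using fibre_rep_lin[OF assms, of 1 "-1"] by simp

lemma sm_indicator_rect:
  assumes "B \<in> sets borel"
  shows "sm \<mu> (Pair \<gamma> -` (A \<times> B)) = indicator A \<gamma> * sm \<mu> B"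
  by (simp add: indicator_def)

lemma prob_kernel_distr_snd:
  fixes \<kappa> :: "'m::polish_space \<Rightarrow> ('m \<times> 'k::polish_space) measure"
  assumes \<kappa>: "\<kappa> \<in> measurable borel (prob_algebra borel)"
  shows "sets (\<kappa> \<gamma>) = sets borel" "prob_space (\<kappa> \<gamma>)"
    "finite_measure (distr (\<kappa> \<gamma>) borel snd)" "prob_space (distr (\<kappa> \<gamma>) borel snd)"
    "B \<in> sets borel \<Longrightarrow> measure (distr (\<kappa> \<gamma>) borel snd) B = measure (\<kappa> \<gamma>) (UNIV \<times> B)"
proof -
  have s: "sets (\<kappa> \<gamma>) = sets borel" "prob_space (\<kappa> \<gamma>)"
    using measurable_space[OF \<kappa>, of \<gamma>] by (simp_all add: space_prob_algebra)
  then show "sets (\<kappa> \<gamma>) = sets borel" "prob_space (\<kappa> \<gamma>)" by auto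
  interpret prob_space "\<kappa> \<gamma>" by fact
  have m: "snd \<in> measurable (\<kappa> \<gamma>) borel"
    unfolding measurable_cong_sets[OF s(1) refl] by measurable
  show "prob_space (distr (\<kappa> \<gamma>) borel snd)" using m by (rule prob_space_distr)
  then show "finite_measure (distr (\<kappa> \<gamma>) borel snd)" by (rule prob_space.finite_measure)
  show "measure (distr (\<kappa> \<gamma>) borel snd) B = measure (\<kappa> \<gamma>) (UNIV \<times> B)" if "B \<in> sets borel"
    using that m sets_eq_imp_space_eq[OF s(1)]
    by (subst measure_distr) (auto intro!: arg_cong2[where f = measure])
qed

text \<open>A probability carried by one fibre sees only the section of \<open>E\<close> over that
  fibre. This translates conditional measures on the product into measures on
  \<open>'k\<close>.\<close>

lemma fibre_measure_section:
  fixes K :: "('m::polish_space \<times> 'k::polish_space) measure"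
  assumes K: "sets K = sets borel" "prob_space K" "emeasure K ({\<gamma>} \<times> UNIV) = 1" and E: "E \<in> sets borel"
  shows "measure K E = measure K (UNIV \<times> (Pair \<gamma> -` E))"
proof -
  interpret prob_space K by fact
  have "AE z in K. z \<in> {\<gamma>} \<times> UNIV"
    using K E by (intro AE_prob_1) (simp add: measure_def)
  then show ?thesis
    using K E Pair_vimage_borel[OF E, of \<gamma>]
    by (intro finite_measure_eq_AE) (auto elim!: AE_mp)
qed

lemma fibre_rep_restriction_pos:
  fixes Q :: "('m::polish_space \<times> 'k::polish_space) measure"
  assumes fQ: "finite_measure Q" and sQ: "sets Q = sets borel"
    and m: "finite_measure m" "sets m = sets borel"
    and ac: "absolutely_continuous m (distr Q borel fst)"
  shows "fibre_rep m (restriction_pos m Q) (sm_of Q)"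
  unfolding fibre_rep_def
proof (intro ballI)
  fix E :: "('m \<times> 'k) set" assume E: "E \<in> sets borel"
  interpret Q: finite_measure Q by fact
  let ?Q1 = "distr Q borel fst"
  define \<kappa> where "\<kappa> = cond_measure m Q"
  define u where "u = base_density m Q"
  have "disintegration m Q \<kappa> u"
    unfolding \<kappa>_def u_def by (rule the_disintegration) fact+
  then have \<kappa>: "\<kappa> \<in> measurable borel (prob_algebra borel)" and u [measurable]: "u \<in> borel_measurable borel"
    and u0: "\<And>\<gamma>. 0 \<le> u \<gamma>" and Q1: "?Q1 = density m (\<lambda>\<gamma>. ennreal (u \<gamma>))"
    and fib: "AE \<gamma> in ?Q1. emeasure (\<kappa> \<gamma>) ({\<gamma>} \<times> UNIV) = 1"
    and Q: "emeasure Q E = (\<integral>\<^sup>+\<gamma>. emeasure (\<kappa> \<gamma>) E \<partial>?Q1)"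
    using E unfolding disintegration_def by auto
  note \<kappa>' = prob_kernel_distr_snd[OF \<kappa>]
  have um: "(\<lambda>\<gamma>. ennreal (u \<gamma>)) \<in> borel_measurable m"
    unfolding measurable_cong_sets[OF m(2) refl] by measurable
  have R: "sm (restriction_pos m Q \<gamma>) (Pair \<gamma> -` E) = u \<gamma> * measure (\<kappa> \<gamma>) (UNIV \<times> (Pair \<gamma> -` E))" for \<gamma>
    using \<kappa>'(3,5)[where \<gamma> = \<gamma>] Pair_vimage_borel[OF E, of \<gamma>]
    by (simp add: restriction_pos_def scaleR_signed_measure.rep_eq sm_sm_of flip: \<kappa>_def u_def)
  \<comment> \<open>Both the measure and the set vary with \<gamma>. The graph of the varying set is
    the preimage of \<open>E\<close> under forgetting the middle coordinate, hence Borel.\<close>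
  have meas [measurable]: "(\<lambda>\<gamma>. measure (\<kappa> \<gamma>) (UNIV \<times> (Pair \<gamma> -` E))) \<in> borel_measurable borel"
  proof (rule measure_measurable_prob_algebra2[OF _ \<kappa>])
    have "(\<lambda>w. (fst w, snd (snd w))) \<in> borel_measurable (borel :: ('m \<times> 'm \<times> 'k) measure)"
      by measurable
    from measurable_sets[OF this E]
    have "{w :: 'm \<times> 'm \<times> 'k. (fst w, snd (snd w)) \<in> E} \<in> sets borel" by (simp add: vimage_def)
    moreover have "Sigma (space borel) (\<lambda>\<gamma>. (UNIV :: 'm set) \<times> Pair \<gamma> -` E) = {w :: 'm \<times> 'm \<times> 'k. (fst w, snd (snd w)) \<in> E}"
      by auto
    ultimately show "Sigma (space borel) (\<lambda>\<gamma>. (UNIV :: 'm set) \<times> Pair \<gamma> -` E) \<in> sets (borel \<Otimes>\<^sub>M borel)"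
      by (simp only: borel_prod)
  qed
  have rm: "(\<lambda>\<gamma>. sm (restriction_pos m Q \<gamma>) (Pair \<gamma> -` E)) \<in> borel_measurable m"
    unfolding R measurable_cong_sets[OF m(2) refl] by measurable
  have "AE \<gamma> in ?Q1. emeasure (\<kappa> \<gamma>) E = ennreal (measure (\<kappa> \<gamma>) (UNIV \<times> (Pair \<gamma> -` E)))"
    using fib
  proof eventually_elim
    case (elim \<gamma>)
    interpret K: prob_space "\<kappa> \<gamma>" by (rule \<kappa>')
    show ?case using fibre_measure_section[OF \<kappa>'(1,2) elim E] by (simp add: K.emeasure_eq_measure)
  qed
  then have "emeasure Q E = (\<integral>\<^sup>+\<gamma>. ennreal (measure (\<kappa> \<gamma>) (UNIV \<times> (Pair \<gamma> -` E))) \<partial>?Q1)"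
    unfolding Q by (rule nn_integral_cong_AE)
  also have "\<dots> = (\<integral>\<^sup>+\<gamma>. ennreal (u \<gamma>) * ennreal (measure (\<kappa> \<gamma>) (UNIV \<times> (Pair \<gamma> -` E))) \<partial>m)"
    unfolding Q1 using um by (intro nn_integral_density) (auto simp: measurable_cong_sets[OF m(2) refl])
  also have "\<dots> = (\<integral>\<^sup>+\<gamma>. ennreal (sm (restriction_pos m Q \<gamma>) (Pair \<gamma> -` E)) \<partial>m)"
    by (simp add: R ennreal_mult u0)
  finally have *: "emeasure Q E = (\<integral>\<^sup>+\<gamma>. ennreal (sm (restriction_pos m Q \<gamma>) (Pair \<gamma> -` E)) \<partial>m)" .
  have nn: "0 \<le> sm (restriction_pos m Q \<gamma>) (Pair \<gamma> -` E)" for \<gamma>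
    by (simp add: R u0)
  have "integrable m (\<lambda>\<gamma>. sm (restriction_pos m Q \<gamma>) (Pair \<gamma> -` E))"
    using nn rm by (intro integrableI_nonneg) (simp_all add: *[symmetric] Q.emeasure_finite less_top[symmetric])
  moreover have "sm (sm_of Q) E = (\<integral>\<gamma>. sm (restriction_pos m Q \<gamma>) (Pair \<gamma> -` E) \<partial>m)"
    using nn rm by (subst integral_eq_nn_integral) (simp_all add: sm_sm_of[OF fQ sQ] *[symmetric] measure_def)
  ultimately show "integrable m (\<lambda>\<gamma>. sm (restriction_pos m Q \<gamma>) (Pair \<gamma> -` E)) \<and>
    sm (sm_of Q) E = (\<integral>\<gamma>. sm (restriction_pos m Q \<gamma>) (Pair \<gamma> -` E) \<partial>m)" by blast
qed

text \<open>Testing on \<open>A \<times> B\<close> with \<open>A\<close> arbitrary identifies the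
  functions \<gamma> \<mapsto> \<open>sm (R \<gamma>) B\<close> a.e. for each \<open>B\<close>.
  Doing this for a countable generator leaves one null set, off which the fibre measures
  coincide.\<close>

lemma fibre_rep_unique:
  fixes \<mu> :: "('m::polish_space \<times> 'k::polish_space) signed_measure"
  assumes m: "finite_measure m" "sets m = sets borel"
    and R: "fibre_rep m R \<mu>" "fibre_rep m R' \<mu>"
  shows "AE \<gamma> in m. R \<gamma> = R' \<gamma>"
proof -
  interpret finite_measure m by fact
  obtain G :: "'k set set" where G: "countable G" "Int_stable G" "borel = sigma UNIV G" "UNIV \<in> G" "G \<subseteq> sets borel"
    using countable_borel_generator by metis
  have "AE \<gamma> in m. sm (R \<gamma>) B = sm (R' \<gamma>) B" if "B \<in> G" for B
  proof -
    have B: "B \<in> sets borel" using that G(5) by auto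
    have UB: "(UNIV :: 'm set) \<times> B \<in> sets borel" using B by auto
    have v: "Pair \<gamma> -` (UNIV \<times> B) = B" for \<gamma> :: 'm by auto
    show ?thesis
    proof (rule density_unique_real)
      show "integrable m (\<lambda>\<gamma>. sm (R \<gamma>) B)" using fibre_repD(1)[OF R(1) UB] by (simp add: v)
      show "integrable m (\<lambda>\<gamma>. sm (R' \<gamma>) B)" using fibre_repD(1)[OF R(2) UB] by (simp add: v)
      fix A assume "A \<in> sets m"
      then have A: "A \<times> B \<in> sets borel" using B m(2) by auto
      show "(\<integral>\<gamma>\<in>A. sm (R \<gamma>) B \<partial>m) = (\<integral>\<gamma>\<in>A. sm (R' \<gamma>) B \<partial>m)"
        using fibre_repD(2)[OF R(1) A, unfolded sm_indicator_rect[OF B]]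
          fibre_repD(2)[OF R(2) A, unfolded sm_indicator_rect[OF B]]
        by (simp add: set_lebesgue_integral_def)
    qed
  qed
  then have "AE \<gamma> in m. \<forall>B\<in>G. sm (R \<gamma>) B = sm (R' \<gamma>) B"
    by (subst AE_ball_countable[OF G(1)]) simp
  then show ?thesis
    by eventually_elim (rule sm_eqI_generator[OF G(2-4)], simp)
qed

lemma fibre_rep_restriction:
  fixes \<mu> :: "('m::polish_space \<times> 'k::polish_space) signed_measure"
  assumes m: "finite_measure m" "sets m = sets borel" and \<mu>: "\<mu> \<in> AB m"
  shows "fibre_rep m (restriction m \<mu>) \<mu>"
proof -
  have J: "jordan_decomposition \<mu> (pos_part \<mu>) (neg_part \<mu>)" by (rule jordan_decomposition_parts)
  then have fin: "finite_measure (pos_part \<mu>)" "finite_measure (neg_part \<mu>)"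
    and s: "sets (pos_part \<mu>) = sets borel" "sets (neg_part \<mu>) = sets borel"
    and eq: "\<mu> = sm_of (pos_part \<mu>) - sm_of (neg_part \<mu>)"
    unfolding jordan_decomposition_def by blast+
  have "fibre_rep m (\<lambda>\<gamma>. restriction_pos m (pos_part \<mu>) \<gamma> - restriction_pos m (neg_part \<mu>) \<gamma>)
    (sm_of (pos_part \<mu>) - sm_of (neg_part \<mu>))"
    using \<mu> fin s m by (intro fibre_rep_diff fibre_rep_restriction_pos) (auto simp: AB_def)
  then show ?thesis
    unfolding eq[symmetric] by (simp add: restriction_def[abs_def])
qed

text \<open>Over a null set of base points \<mu> vanishes on every Borel subset, not only on the
  full cylinder. Applied to the two pieces cut out by a Hahn set, this makes both Jordan parts
  vanish there.\<close>

lemma fibre_rep_imp_AB: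
  fixes \<mu> :: "('m::polish_space \<times> 'k::polish_space) signed_measure"
  assumes m: "sets m = sets borel" and R: "fibre_rep m R \<mu>"
  shows "\<mu> \<in> AB m"
proof -
  have J: "jordan_decomposition \<mu> (pos_part \<mu>) (neg_part \<mu>)" by (rule jordan_decomposition_parts)
  then have s: "sets (pos_part \<mu>) = sets borel" "sets (neg_part \<mu>) = sets borel"
    unfolding jordan_decomposition_def by blast+
  obtain D where D: "D \<in> sets borel" "\<And>A. A \<in> sets borel \<Longrightarrow> emeasure (pos_part \<mu>) A = ennreal (sm \<mu> (A \<inter> D))"
    "\<And>A. A \<in> sets borel \<Longrightarrow> emeasure (neg_part \<mu>) A = ennreal (- sm \<mu> (A - D))"
    using jordan_decomposition_emeasure[OF J] by metis
  have null: "sm \<mu> E = 0" if "E \<in> sets borel" "E \<subseteq> A \<times> UNIV" "A \<in> null_sets m" for E A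
  proof -
    have "AE \<gamma> in m. sm (R \<gamma>) (Pair \<gamma> -` E) = 0"
      using AE_not_in[OF that(3)]
    proof eventually_elim
      case (elim \<gamma>)
      then have "Pair \<gamma> -` E = {}" using that(2) by auto
      then show ?case by simp
    qed
    then have "(\<integral>\<gamma>. sm (R \<gamma>) (Pair \<gamma> -` E) \<partial>m) = 0" by (rule integral_eq_zero_AE)
    then show ?thesis using fibre_repD(2)[OF R that(1)] by simp
  qed
  have fstm: "fst \<in> measurable (pos_part \<mu>) borel" "fst \<in> measurable (neg_part \<mu>) borel"
    unfolding measurable_cong_sets[OF s(1) refl] measurable_cong_sets[OF s(2) refl] by measurable
  have v: "fst -` A \<inter> space M = A \<times> UNIV" if "sets M = sets borel" for A and M :: "('m \<times> 'k) measure"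
    using sets_eq_imp_space_eq[OF that] by auto
  show ?thesis
    unfolding AB_def absolutely_continuous_def
  proof (safe)
    fix A assume A: "A \<in> null_sets m"
    then have Ab: "A \<in> sets borel" using m by auto
    have "sm \<mu> (A \<times> UNIV \<inter> D) = 0" "sm \<mu> (A \<times> UNIV - D) = 0"
      using Ab D(1) by (auto intro!: null[OF _ _ A])
    then show "A \<in> null_sets (distr (pos_part \<mu>) borel fst)" "A \<in> null_sets (distr (neg_part \<mu>) borel fst)"
      using fstm Ab by (simp_all add: null_sets_def emeasure_distr v s D)
  qed
qed

lemma restriction_AE_eq:
  fixes \<mu> :: "('m::polish_space \<times> 'k::polish_space) signed_measure"
  assumes m: "finite_measure m" "sets m = sets borel" and R: "fibre_rep m R \<mu>"
  shows "AE \<gamma> in m. restriction m \<mu> \<gamma> = R \<gamma>"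
  using fibre_rep_unique[OF m fibre_rep_restriction[OF m fibre_rep_imp_AB[OF m(2) R]] R] .

text \<open>The Jordan parts of a combination are not the combinations of the Jordan parts, so this
  rests on a.e. uniqueness of representing families.\<close>

lemma AB_lin:
  fixes \<mu> \<eta> :: "('m::polish_space \<times> 'k::polish_space) signed_measure"
  assumes m: "finite_measure m" "sets m = sets borel" and *: "\<mu> \<in> AB m" "\<eta> \<in> AB m"
  shows "a *\<^sub>R \<mu> + b *\<^sub>R \<eta> \<in> AB m"
    "AE \<gamma> in m. restriction m (a *\<^sub>R \<mu> + b *\<^sub>R \<eta>) \<gamma> = a *\<^sub>R restriction m \<mu> \<gamma> + b *\<^sub>R restriction m \<eta> \<gamma>"
proof -
  have F: "fibre_rep m (\<lambda>\<gamma>. a *\<^sub>R restriction m \<mu> \<gamma> + b *\<^sub>R restriction m \<eta> \<gamma>) (a *\<^sub>R \<mu> + b *\<^sub>R \<eta>)"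
    by (intro fibre_rep_lin fibre_rep_restriction m *)
  show "a *\<^sub>R \<mu> + b *\<^sub>R \<eta> \<in> AB m" by (rule fibre_rep_imp_AB[OF m(2) F])
  show "AE \<gamma> in m. restriction m (a *\<^sub>R \<mu> + b *\<^sub>R \<eta>) \<gamma> = a *\<^sub>R restriction m \<mu> \<gamma> + b *\<^sub>R restriction m \<eta> \<gamma>"
    by (rule restriction_AE_eq[OF m F])
qed

lemma sm_restriction_pos_UNIV:
  fixes Q :: "('m::polish_space \<times> 'k::polish_space) measure"
  assumes "finite_measure Q" "sets Q = sets borel" "finite_measure m" "sets m = sets borel"
    and "absolutely_continuous m (distr Q borel fst)"
  shows "sm (restriction_pos m Q \<gamma>) UNIV = base_density m Q \<gamma>"
proof -
  have \<kappa>: "cond_measure m Q \<in> measurable borel (prob_algebra borel)"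
    using the_disintegration[OF assms] unfolding disintegration_def by blast
  note \<kappa>' = prob_kernel_distr_snd[OF \<kappa>, where \<gamma> = \<gamma>]
  interpret prob_space "distr (cond_measure m Q \<gamma>) borel snd" by (rule \<kappa>')
  show ?thesis
    using prob_space by (simp add: restriction_pos_def scaleR_signed_measure.rep_eq sm_sm_of[OF \<kappa>'(3)])
qed

text \<open>Marginal densities are total masses of restrictions, so facts about marginals follow
  from facts about restrictions. The identity holds at every \<gamma> because both sides use the
  same chosen disintegration.\<close>

lemma sm_restriction_UNIV:
  fixes \<mu> :: "('m::polish_space \<times> 'k::polish_space) signed_measure"
  assumes m: "finite_measure m" "sets m = sets borel" and \<mu>: "\<mu> \<in> AB m"
  shows "sm (restriction m \<mu> \<gamma>) UNIV = marginal_density m \<mu> \<gamma>"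
proof -
  have J: "jordan_decomposition \<mu> (pos_part \<mu>) (neg_part \<mu>)" by (rule jordan_decomposition_parts)
  then have fin: "finite_measure (pos_part \<mu>)" "finite_measure (neg_part \<mu>)"
    and s: "sets (pos_part \<mu>) = sets borel" "sets (neg_part \<mu>) = sets borel"
    unfolding jordan_decomposition_def by blast+
  show ?thesis
    using \<mu> fin s m unfolding restriction_def marginal_density_def AB_def
    by (simp add: minus_signed_measure.rep_eq sm_restriction_pos_UNIV)
qed

section \<open>The transfer operator as a push-forward\<close>

lemma sm_sum: "sm (\<Sum>i\<in>I. R i) A = (\<Sum>i\<in>I. sm (R i) A)"
  by (induction I rule: infinite_finite_induct)
    (simp_all add: zero_signed_measure.rep_eq plus_signed_measure.rep_eq)

lemma sm_push_lin:
  assumes "g \<in> borel_measurable borel"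
  shows "sm_push g (a *\<^sub>R \<mu> + b *\<^sub>R \<eta>) = a *\<^sub>R sm_push g \<mu> + b *\<^sub>R sm_push g \<eta>"
  by (rule sm_eqI) (simp add: sm_sm_push[OF assms] plus_signed_measure.rep_eq scaleR_signed_measure.rep_eq)

lemma sm_of_distr:
  fixes g :: "'a::topological_space \<Rightarrow> 'b::topological_space"
  assumes Q: "finite_measure Q" "sets Q = sets borel" and g: "g \<in> borel_measurable borel"
  shows "sm_of (distr Q borel g) = sm_push g (sm_of Q)"
proof (rule sm_eqI)
  interpret finite_measure Q by fact
  have g': "g \<in> measurable Q borel" unfolding measurable_cong_sets[OF Q(2) refl] by (rule g)
  fix A :: "'b set" assume A: "A \<in> sets borel"
  show "sm (sm_of (distr Q borel g)) A = sm (sm_push g (sm_of Q)) A"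
    using A g g' Q sets_eq_imp_space_eq[OF Q(2)]
    by (simp add: sm_sm_of finite_measure_distr sm_sm_push measure_distr)
qed

lemma sm_of_scale_measure:
  assumes Q: "finite_measure Q" "sets Q = sets borel" and "0 \<le> c"
  shows "sm_of (scale_measure (ennreal c) Q) = c *\<^sub>R sm_of Q"
proof (rule sm_eqI)
  interpret finite_measure Q by fact
  have "finite_measure (scale_measure (ennreal c) Q)"
    by (rule finite_measureI) (simp add: ennreal_mult_eq_top_iff)
  then show "sm (sm_of (scale_measure (ennreal c) Q)) A = sm (c *\<^sub>R sm_of Q) A" for A
    using assms by (simp add: sm_sm_of scaleR_signed_measure.rep_eq)
qed

section \<open>Inverse branches and change of variables on the base\<close>

text \<open>On null subsets of the \<open>P i\<close>, the condition \<open>null_image\<close>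
  follows from conformality. It also speaks about the null set outside their union, where
  \<open>f\<close> may be far from injective; the transfer operator on the function space supplies
  that part.\<close>

locale skew_system =
  fixes f :: "'m::polish_space \<Rightarrow> 'm" and G :: "'m \<times> 'k::polish_space \<Rightarrow> 'k"
    and \<phi> h :: "'m \<Rightarrow> real" and m \<nu> :: "'m measure" and l :: real and d :: nat and P :: "nat \<Rightarrow> 'm set"
  assumes f_meas [measurable]: "f \<in> borel_measurable borel"
    and G_meas [measurable]: "G \<in> borel_measurable borel"
    and data: "equilibrium_data f \<phi> m h \<nu> l"
    and branches: "branch_partition f \<nu> d P"
    and null_image: "\<And>N. N \<in> null_sets \<nu> \<Longrightarrow> \<exists>N'\<in>null_sets \<nu>. f ` N \<subseteq> N'"
begin

abbreviation F where "F \<equiv> skew_product f G"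

definition branch :: "nat \<Rightarrow> 'm \<Rightarrow> 'm" where "branch i = the_inv_into (P i) f"

text \<open>Normalising by \<open>l * h \<gamma>\<close> makes these a probability vector for a.e.
  \<gamma>, by the eigenvalue equation for \<open>h\<close>.\<close>

definition weight :: "nat \<Rightarrow> 'm \<Rightarrow> real" where "weight i \<gamma> = h (branch i \<gamma>) * exp (\<phi> (branch i \<gamma>)) / (l * h \<gamma>)"

lemma F_meas [measurable]: "F \<in> borel_measurable borel"
  unfolding skew_product_def[abs_def] by measurable

lemma G_fibre_meas [measurable]: "(\<lambda>y. G (\<gamma>, y)) \<in> borel_measurable borel"
  by measurable

lemma sets_\<nu> [measurable_cong]: "sets \<nu> = sets borel"
  and \<phi>_meas [measurable]: "\<phi> \<in> borel_measurable borel"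
  and conformal: "\<And>A. A \<in> sets borel \<Longrightarrow> inj_on f A \<Longrightarrow> f ` A \<in> sets borel \<and>
      emeasure \<nu> (f ` A) = (\<integral>\<^sup>+x\<in>A. ennreal (l * exp (- \<phi> x)) \<partial>\<nu>)"
  and h_meas [measurable]: "h \<in> borel_measurable borel"
  and m_density: "m = density \<nu> (\<lambda>x. ennreal (h x))"
  and l_pos: "0 < l"
  and h_eigen: "AE x in \<nu>. transfer f \<phi> h x = l * h x"
  and sets_m [measurable_cong]: "sets m = sets borel"
  and m_inv: "distr m borel f = m"
  using data unfolding equilibrium_data_def conformal_measure_def equilibrium_state_def invariant_prob_def
  by auto

lemma prob_m: "prob_space m"
  using data unfolding equilibrium_data_def equilibrium_state_def invariant_prob_def by auto

lemma finite_m: "finite_measure m"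
  using prob_m by (rule prob_space.finite_measure)

lemma space_m [simp]: "space m = UNIV" and space_\<nu> [simp]: "space \<nu> = UNIV"
  using sets_eq_imp_space_eq[OF sets_m] sets_eq_imp_space_eq[OF sets_\<nu>] by auto

lemma h_lower: obtains c where "0 < c" "\<And>x. c \<le> h x"
proof -
  have "bdd_below (range h)" "0 < Inf (range h)" using data unfolding equilibrium_data_def by auto
  then show thesis by (intro that[of "Inf (range h)"]) (auto intro: cInf_lower)
qed

lemma h_pos: "0 < h x"
  using h_lower by (metis order_less_le_trans)

text \<open>The density \<open>h\<close> is bounded below by a positive constant and
  \<open>m\<close> has total mass one.\<close>

lemma finite_\<nu>: "finite_measure \<nu>"
proof
  obtain c where c: "0 < c" "\<And>x. c \<le> h x" using h_lower by metis
  have "ennreal c * emeasure \<nu> (space \<nu>) = (\<integral>\<^sup>+x. ennreal c \<partial>\<nu>)" by simp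
  also have "\<dots> \<le> (\<integral>\<^sup>+x. ennreal (h x) \<partial>\<nu>)" using c by (intro nn_integral_mono ennreal_leI)
  also have "\<dots> = emeasure m UNIV"
    unfolding m_density using sets_\<nu> by (subst emeasure_density) auto
  also have "\<dots> = 1" using prob_space.emeasure_space_1[OF prob_m] by simp
  finally have "ennreal c * emeasure \<nu> (space \<nu>) \<noteq> \<infinity>" by (auto simp: top_unique)
  then show "emeasure \<nu> (space \<nu>) \<noteq> \<infinity>" using c(1) by (auto simp: ennreal_mult_eq_top_iff)
qed

lemma AE_m_iff: "(AE x in m. Q x) \<longleftrightarrow> (AE x in \<nu>. Q x)"
  unfolding m_density using h_pos by (subst AE_density) auto

lemma P_borel: "i < d \<Longrightarrow> P i \<in> sets borel"
  and P_disjoint: "disjoint_family_on P {..<d}"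
  and P_bij: "i < d \<Longrightarrow> bij_betw f (P i) UNIV"
  and P_full: "emeasure \<nu> (\<Union>i<d. P i) = emeasure \<nu> UNIV"
  using branches unfolding branch_partition_def by auto

lemma branch_in: "i < d \<Longrightarrow> branch i x \<in> P i" and f_branch: "i < d \<Longrightarrow> f (branch i x) = x"
  using P_bij[of i] the_inv_into_into[of f "P i" x "P i"] f_the_inv_into_f[of f "P i" x]
  by (auto simp: branch_def bij_betw_def)

lemma branch_f: "i < d \<Longrightarrow> x \<in> P i \<Longrightarrow> branch i (f x) = x"
  using P_bij[of i] by (auto simp: branch_def bij_betw_def the_inv_into_f_f)

lemma inj_P: "i < d \<Longrightarrow> inj_on f (A \<inter> P i)"
  using P_bij[of i] by (auto simp: bij_betw_def intro: inj_on_subset)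

lemma branch_vimage: "i < d \<Longrightarrow> branch i -` A = f ` (A \<inter> P i)"
proof (intro equalityI subsetI)
  fix x assume i: "i < d"
  show "x \<in> f ` (A \<inter> P i)" if "x \<in> branch i -` A"
    using that branch_in[OF i] f_branch[OF i, of x] by (intro image_eqI[of _ _ "branch i x"]) auto
  show "x \<in> branch i -` A" if "x \<in> f ` (A \<inter> P i)"
    using that branch_f[OF i] by auto
qed

text \<open>The preimage of a Borel set under a branch is the image under \<open>f\<close> of a
  Borel set on which \<open>f\<close> is injective, and \<open>conformal_measure\<close> makes such
  images Borel.\<close>

lemma branch_meas: "i < d \<Longrightarrow> branch i \<in> borel_measurable borel"
  using conformal[OF sets.Int[OF _ P_borel] inj_P]
  by (intro measurableI) (auto simp: branch_vimage)

text \<open>The Jacobian formula for \<open>f\<close> on \<open>P i\<close>, read as a change of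
  variables for the inverse branch.\<close>

lemma distr_branch:
  assumes i: "i < d"
  shows "distr \<nu> borel (branch i) = density \<nu> (\<lambda>x. ennreal (l * exp (- \<phi> x)) * indicator (P i) x)"
proof (rule measure_eqI)
  have [measurable]: "branch i \<in> borel_measurable borel" "P i \<in> sets borel" using branch_meas P_borel i by auto
  fix A assume "A \<in> sets (distr \<nu> borel (branch i))"
  then have [measurable]: "A \<in> sets borel" by simp
  have "emeasure (distr \<nu> borel (branch i)) A = emeasure \<nu> (f ` (A \<inter> P i))"
    by (subst emeasure_distr) (auto simp: branch_vimage[OF i])
  also have "\<dots> = (\<integral>\<^sup>+x\<in>A \<inter> P i. ennreal (l * exp (- \<phi> x)) \<partial>\<nu>)"
    using conformal[OF _ inj_P[OF i]] by auto
  also have "\<dots> = emeasure (density \<nu> (\<lambda>x. ennreal (l * exp (- \<phi> x)) * indicator (P i) x)) A"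
    by (subst emeasure_density) (auto intro!: nn_integral_cong simp: indicator_def)
  finally show "emeasure (distr \<nu> borel (branch i)) A = \<dots>" .
qed (simp add: sets_\<nu>)

lemma AE_branches:
  assumes "AE x in \<nu>. Q x"
  shows "AE x in \<nu>. \<forall>i<d. Q (branch i x)"
proof -
  from AE_E[OF assms] obtain N where N: "{x\<in>space \<nu>. \<not> Q x} \<subseteq> N" "emeasure \<nu> N = 0" "N \<in> sets \<nu>" .
  then have "N \<in> null_sets \<nu>" by (simp add: null_sets_def)
  from null_image[OF this] obtain N' where N': "N' \<in> null_sets \<nu>" "f ` N \<subseteq> N'" by blast
  show ?thesis
    using AE_not_in[OF N'(1)]
  proof eventually_elim
    case (elim x)
    show ?case
    proof (intro allI impI)
      fix i assume "i < d"
      have "f (branch i x) \<notin> N'" using elim f_branch[OF \<open>i < d\<close>, of x] by simp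
      then have "branch i x \<notin> N" using N'(2) by auto
      then show "Q (branch i x)" using N(1) by auto
    qed
  qed
qed

lemma P_compl_null: "UNIV - (\<Union>i<d. P i) \<in> null_sets \<nu>"
proof -
  interpret finite_measure \<nu> by (rule finite_\<nu>)
  have U: "(\<Union>i<d. P i) \<in> sets \<nu>" using P_borel sets_\<nu> by auto
  have "emeasure \<nu> (UNIV - (\<Union>i<d. P i)) = 0"
    using emeasure_compl[OF U] P_full by simp
  then show ?thesis
    using U sets_\<nu> by (simp add: null_sets_def)
qed

text \<open>Further preimages can exist only over the image of the null set outside the
  \<open>P i\<close>, which is again contained in a null set.\<close>

lemma AE_preimage: "AE x in \<nu>. f -` {x} = (\<lambda>i. branch i x) ` {..<d}"
proof -
  obtain N' where N': "N' \<in> null_sets \<nu>" "f ` (UNIV - (\<Union>i<d. P i)) \<subseteq> N'"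
    using null_image[OF P_compl_null] by blast
  show ?thesis
    using AE_not_in[OF N'(1)]
  proof eventually_elim
    case (elim x)
    show ?case
    proof (intro equalityI subsetI)
      fix y assume "y \<in> f -` {x}"
      then have y: "f y = x" by simp
      then have "y \<in> (\<Union>i<d. P i)" using elim N'(2) by blast
      then obtain i where "i < d" "y \<in> P i" by auto
      then show "y \<in> (\<lambda>i. branch i x) ` {..<d}" using branch_f y by (auto intro!: image_eqI[of _ _ i])
    qed (auto simp: f_branch)
  qed
qed

lemma transfer_sum:
  assumes "f -` {x} = (\<lambda>i. branch i x) ` {..<d}"
  shows "transfer f \<phi> g x = (\<Sum>i<d. g (branch i x) * exp (\<phi> (branch i x)))"
proof -
  have inj: "inj_on (\<lambda>i. branch i x) {..<d}"
  proof (rule inj_onI)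
    fix i j assume *: "i \<in> {..<d}" "j \<in> {..<d}" "branch i x = branch j x"
    then have "branch i x \<in> P i \<inter> P j" using branch_in[of i x] branch_in[of j x] by simp
    then show "i = j" using P_disjoint * unfolding disjoint_family_on_def by blast
  qed
  have "transfer f \<phi> g x = (\<Sum>y\<in>(\<lambda>i. branch i x) ` {..<d}. g y * exp (\<phi> y))"
    unfolding transfer_def assms by (rule infsum_finite) simp
  then show ?thesis by (simp add: sum.reindex[OF inj])
qed

text \<open>The exceptional set depends only on the shape of the preimage of \<open>x\<close>, so it
  is the same for all \<open>g\<close>.\<close>

lemma AE_transfer: "AE x in \<nu>. \<forall>g. transfer f \<phi> g x = (\<Sum>i<d. g (branch i x) * exp (\<phi> (branch i x)))"
  using AE_preimage by eventually_elim (simp add: transfer_sum)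

lemma AE_transfer_weight: "AE x in \<nu>. \<forall>g. transfer f \<phi> (\<lambda>y. g y * h y) x / (l * h x) = (\<Sum>i<d. weight i x * g (branch i x))"
  using AE_transfer by eventually_elim (simp add: weight_def sum_divide_distrib mult_ac)

lemma weight_nonneg: "0 \<le> weight i x"
  unfolding weight_def using h_pos[of x] h_pos[of "branch i x"] l_pos by simp

lemma AE_sum_weight: "AE x in \<nu>. (\<Sum>i<d. weight i x) = 1"
  using AE_transfer_weight h_eigen
proof eventually_elim
  case (elim x)
  have "(\<Sum>i<d. weight i x) = transfer f \<phi> h x / (l * h x)" using elim(1)[rule_format, of "\<lambda>_. 1"] by simp
  then show ?case using elim(2) h_pos[of x] l_pos by simp
qed

text \<open>Substitute the branch point as the new variable. The Jacobian
  \<open>l * exp (- \<phi> x)\<close> cancels the potential and \<open>l\<close> in the weight, and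
  the density \<open>h\<close> of \<open>m\<close> cancels the denominator
  \<open>h \<gamma>\<close>, leaving \<open>h\<close> at the branch point.\<close>

lemma branch_integral:
  fixes u :: "'m \<Rightarrow> real"
  assumes i: "i < d" and u: "integrable m u"
  shows "integrable m (\<lambda>\<gamma>. weight i \<gamma> * u (branch i \<gamma>))"
    "(\<integral>\<gamma>. weight i \<gamma> * u (branch i \<gamma>) \<partial>m) = (\<integral>\<gamma>. indicator (P i) \<gamma> * u \<gamma> \<partial>m)"
proof -
  have [measurable]: "branch i \<in> borel_measurable borel" "P i \<in> sets borel" using branch_meas P_borel i by auto
  have um [measurable]: "u \<in> borel_measurable borel"
    using borel_measurable_integrable[OF u] by (simp add: measurable_cong_sets[OF sets_m refl])
  \<comment> \<open>The integrand with respect to \<nu>, after cancelling \<open>h \<gamma>\<close>,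
    written as a function of the branch point alone.\<close>
  define v where "v x = h x * exp (\<phi> x) / l * u x" for x
  have vm [measurable]: "v \<in> borel_measurable borel" unfolding v_def by measurable
  have h0: "h x \<noteq> 0" "0 \<le> h x" for x using h_pos[of x] by auto
  have dm: "integrable m g \<longleftrightarrow> integrable \<nu> (\<lambda>x. h x * g x)" "(\<integral>x. g x \<partial>m) = (\<integral>x. h x * g x \<partial>\<nu>)"
    if "g \<in> borel_measurable borel" for g :: "'m \<Rightarrow> real"
    unfolding m_density using that h0(2)
    by (auto simp: integrable_real_density integral_real_density measurable_cong_sets[OF sets_\<nu> refl])
  have W: "h x * (weight i x * u (branch i x)) = v (branch i x)" for x
    unfolding v_def weight_def using h0[of x] by simp
  have V: "(l * exp (- \<phi> x) * indicator (P i) x) * v x = h x * (indicator (P i) x * u x)" for x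
    unfolding v_def using l_pos by (simp add: exp_minus)
  have dens: "distr \<nu> borel (branch i) = density \<nu> (\<lambda>x. ennreal (l * exp (- \<phi> x) * indicator (P i) x))"
    unfolding distr_branch[OF i] using l_pos by (intro density_cong) (auto simp: indicator_def)
  have nn: "0 \<le> l * exp (- \<phi> x) * indicator (P i) x" for x using l_pos by simp
  have sm: "branch i \<in> measurable \<nu> borel" by measurable
  have vn: "v \<in> borel_measurable \<nu>" by measurable
  have "integrable m (\<lambda>x. indicator (P i) x * u x)"
    using integrable_mult_indicator[OF _ u, of "P i"] sets_m by simp
  then have "integrable \<nu> (\<lambda>x. (l * exp (- \<phi> x) * indicator (P i) x) * v x)"
    unfolding V by (subst (asm) dm) auto
  then have "integrable (distr \<nu> borel (branch i)) v"
    unfolding dens using nn vn by (subst integrable_real_density) auto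
  then have "integrable \<nu> (\<lambda>x. v (branch i x))"
    by (rule integrable_distr[OF sm])
  moreover have wm: "(\<lambda>\<gamma>. weight i \<gamma> * u (branch i \<gamma>)) \<in> borel_measurable borel"
    unfolding weight_def by measurable
  ultimately show "integrable m (\<lambda>\<gamma>. weight i \<gamma> * u (branch i \<gamma>))"
    by (simp add: dm W)
  have "(\<integral>\<gamma>. weight i \<gamma> * u (branch i \<gamma>) \<partial>m) = (\<integral>x. v (branch i x) \<partial>\<nu>)"
    using wm by (simp add: dm W)
  also have "\<dots> = (\<integral>x. v x \<partial>distr \<nu> borel (branch i))"
    by (rule integral_distr[OF sm vm, symmetric])
  also have "\<dots> = (\<integral>x. (l * exp (- \<phi> x) * indicator (P i) x) * v x \<partial>\<nu>)"
    unfolding dens using nn vn by (subst integral_real_density) auto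
  also have "\<dots> = (\<integral>\<gamma>. indicator (P i) \<gamma> * u \<gamma> \<partial>m)"
    unfolding V by (subst dm) auto
  finally show "(\<integral>\<gamma>. weight i \<gamma> * u (branch i \<gamma>) \<partial>m) = (\<integral>\<gamma>. indicator (P i) \<gamma> * u \<gamma> \<partial>m)" .
qed

text \<open>Add the substitution formulas over all branches; the sets \<open>P i\<close> cover
  almost every point exactly once.\<close>

lemma transfer_integral:
  fixes u :: "'m \<Rightarrow> real"
  assumes u: "integrable m u"
  shows "integrable m (\<lambda>\<gamma>. \<Sum>i<d. weight i \<gamma> * u (branch i \<gamma>))"
    "(\<integral>\<gamma>. (\<Sum>i<d. weight i \<gamma> * u (branch i \<gamma>)) \<partial>m) = (\<integral>\<gamma>. u \<gamma> \<partial>m)"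
proof -
  show "integrable m (\<lambda>\<gamma>. \<Sum>i<d. weight i \<gamma> * u (branch i \<gamma>))"
    using branch_integral(1)[OF _ u] by (intro Bochner_Integration.integrable_sum) auto
  have ii: "integrable m (\<lambda>x. indicator (P i) x * u x)" if "i < d" for i
    using integrable_mult_indicator[OF _ u, of "P i"] sets_m P_borel[OF that] by simp
  have "(\<integral>\<gamma>. (\<Sum>i<d. weight i \<gamma> * u (branch i \<gamma>)) \<partial>m) = (\<Sum>i<d. \<integral>\<gamma>. indicator (P i) \<gamma> * u \<gamma> \<partial>m)"
    using branch_integral[OF _ u] by (subst Bochner_Integration.integral_sum) auto
  also have "\<dots> = (\<integral>\<gamma>. (\<Sum>i<d. indicator (P i) \<gamma> * u \<gamma>) \<partial>m)"
    using ii by (subst Bochner_Integration.integral_sum) auto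
  also have "\<dots> = (\<integral>\<gamma>. u \<gamma> \<partial>m)"
  proof (rule integral_cong_AE)
    have um [measurable]: "u \<in> borel_measurable m" using borel_measurable_integrable[OF u] .
    have "(\<lambda>\<gamma>. indicator (P i) \<gamma> * u \<gamma>) \<in> borel_measurable m" if "i < d" for i
      using ii[OF that] by (rule borel_measurable_integrable)
    then show "(\<lambda>\<gamma>. \<Sum>i<d. indicator (P i) \<gamma> * u \<gamma>) \<in> borel_measurable m"
      by (intro borel_measurable_sum) auto
    show "AE x in m. (\<Sum>i<d. indicator (P i) x * u x) = u x"
    proof -
      have "AE x in \<nu>. x \<in> (\<Union>i<d. P i)"
        using AE_not_in[OF P_compl_null] by eventually_elim blast
      then have "AE x in \<nu>. (\<Sum>i<d. indicator (P i) x * u x) = u x"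
      proof eventually_elim
        case (elim x)
        then obtain j where j: "j < d" "x \<in> P j" by auto
        have "indicator (P i) x = (of_bool (i = j) :: real)" if "i < d" for i
          using P_disjoint j that by (auto simp: disjoint_family_on_def indicator_def)
        then have "(\<Sum>i<d. indicator (P i) x * u x) = (\<Sum>i<d. of_bool (i = j) * u x)"
          by (intro sum.cong) auto
        also have "\<dots> = u x" using j(1) by (subst sum.remove[of _ j]) auto
        finally show ?case .
      qed
      then show ?thesis by (simp add: AE_m_iff)
    qed
  qed (use u in auto)
  finally show "(\<integral>\<gamma>. (\<Sum>i<d. weight i \<gamma> * u (branch i \<gamma>)) \<partial>m) = (\<integral>\<gamma>. u \<gamma> \<partial>m)" .
qed

section \<open>Push-forward on the fibres\<close>

definition push_rep :: "('m \<Rightarrow> 'k signed_measure) \<Rightarrow> 'm \<Rightarrow> 'k signed_measure" where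
  "push_rep R \<gamma> = (\<Sum>i<d. weight i \<gamma> *\<^sub>R sm_push (\<lambda>y. G (branch i \<gamma>, y)) (R (branch i \<gamma>)))"

lemma Pair_vimage_F: "Pair \<gamma> -` (F -` E) = (\<lambda>y. G (\<gamma>, y)) -` (Pair (f \<gamma>) -` E)"
  by (auto simp: skew_product_def)

lemma sm_push_rep:
  assumes "E \<in> sets borel"
  shows "sm (push_rep R \<gamma>) (Pair \<gamma> -` E) = (\<Sum>i<d. weight i \<gamma> * sm (R (branch i \<gamma>)) (Pair (branch i \<gamma>) -` (F -` E)))"
  unfolding push_rep_def sm_sum
  by (intro sum.cong refl)
    (simp add: scaleR_signed_measure.rep_eq sm_sm_push Pair_vimage_borel[OF assms] Pair_vimage_F f_branch)

text \<open>The section of the preimage of \<open>E\<close> under \<open>F\<close> over a branch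
  point is the preimage, under the fibre map, of the section of \<open>E\<close> over \<gamma>. Thus
  the claim is \<open>transfer_integral\<close> for the function that sends a base point to the mass
  of this section.\<close>

lemma fibre_rep_push:
  assumes R: "fibre_rep m R \<mu>"
  shows "fibre_rep m (push_rep R) (sm_push F \<mu>)"
  unfolding fibre_rep_def
proof (intro ballI)
  fix E :: "('m \<times> 'k) set" assume E: "E \<in> sets borel"
  have FE: "F -` E \<in> sets borel" using measurable_sets[OF F_meas E] by simp
  show "integrable m (\<lambda>\<gamma>. sm (push_rep R \<gamma>) (Pair \<gamma> -` E)) \<and>
    sm (sm_push F \<mu>) E = (\<integral>\<gamma>. sm (push_rep R \<gamma>) (Pair \<gamma> -` E) \<partial>m)"
    unfolding sm_push_rep[OF E] sm_sm_push[OF F_meas E] fibre_repD(2)[OF R FE]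
    using transfer_integral[OF fibre_repD(1)[OF R FE]] by simp
qed

end

context skew_system
begin

lemma restriction_push:
  assumes "\<mu> \<in> AB m"
  shows "sm_push F \<mu> \<in> AB m"
    "AE \<gamma> in m. restriction m (sm_push F \<mu>) \<gamma> = push_rep (restriction m \<mu>) \<gamma>"
proof -
  have R: "fibre_rep m (push_rep (restriction m \<mu>)) (sm_push F \<mu>)"
    by (intro fibre_rep_push fibre_rep_restriction finite_m sets_m assms)
  show "sm_push F \<mu> \<in> AB m" by (rule fibre_rep_imp_AB[OF sets_m R])
  show "AE \<gamma> in m. restriction m (sm_push F \<mu>) \<gamma> = push_rep (restriction m \<mu>) \<gamma>"
    by (rule restriction_AE_eq[OF finite_m sets_m R])
qed

text \<open>Fibre maps preserve total mass, so evaluating the fibre formula on the whole fibre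
  leaves the weighted sum of the old marginals.\<close>

lemma marginal_push:
  assumes \<mu>: "\<mu> \<in> AB m"
  shows "AE \<gamma> in \<nu>. marginal_density m (sm_push F \<mu>) \<gamma> =
    transfer f \<phi> (\<lambda>x. marginal_density m \<mu> x * h x) \<gamma> / l * (1 / h \<gamma>)"
proof -
  have "AE \<gamma> in \<nu>. restriction m (sm_push F \<mu>) \<gamma> = push_rep (restriction m \<mu>) \<gamma>"
    using restriction_push(2)[OF \<mu>] by (simp add: AE_m_iff)
  then show ?thesis
    using AE_transfer_weight
  proof eventually_elim
    case (elim \<gamma>)
    have "marginal_density m (sm_push F \<mu>) \<gamma> = sm (push_rep (restriction m \<mu>) \<gamma>) UNIV"
      by (simp add: sm_restriction_UNIV[OF finite_m sets_m restriction_push(1)[OF \<mu>], symmetric] elim(1))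
    also have "\<dots> = (\<Sum>i<d. weight i \<gamma> * marginal_density m \<mu> (branch i \<gamma>))"
      using sm_push_rep[of UNIV "restriction m \<mu>" \<gamma>]
      by (simp add: sm_restriction_UNIV[OF finite_m sets_m \<mu>])
    finally show ?case using elim(2)[rule_format, of "marginal_density m \<mu>"] by (simp add: field_simps)
  qed
qed

lemma base_push_ac:
  fixes Q :: "('m \<times> 'k) measure"
  assumes sQ: "sets Q = sets borel" and ac: "absolutely_continuous m (distr Q borel fst)"
  shows "absolutely_continuous m (distr (scale_measure c (distr Q borel F)) borel fst)"
  unfolding absolutely_continuous_def
proof
  fix A assume A: "A \<in> null_sets m"
  then have Ab: "A \<in> sets borel" using sets_m by auto
  have fA: "f -` A \<in> sets borel" using measurable_sets[OF f_meas Ab] by simp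
  have sp: "space Q = UNIV" using sets_eq_imp_space_eq[OF sQ] by simp
  have FQ: "F \<in> measurable Q borel" unfolding measurable_cong_sets[OF sQ refl] by (rule F_meas)
  have fQ: "fst \<in> measurable Q borel" unfolding measurable_cong_sets[OF sQ refl] by measurable
  have f': "f \<in> measurable m borel" unfolding measurable_cong_sets[OF sets_m refl] by measurable
  have "emeasure m (f -` A) = emeasure (distr m borel f) A"
    using Ab f' by (subst emeasure_distr) auto
  also have "\<dots> = 0" using A m_inv by auto
  finally have "f -` A \<in> null_sets (distr Q borel fst)"
    using ac fA sets_m unfolding absolutely_continuous_def by (auto simp: null_sets_def)
  then have 0: "emeasure Q ((f -` A) \<times> UNIV) = 0"
    using fQ fA sp by (auto simp: null_sets_def emeasure_distr vimage_fst)
  have fs: "fst \<in> measurable (scale_measure c (distr Q borel F)) borel"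
    by (subst measurable_cong_sets[OF _ refl, of _ borel]) (simp, measurable)
  have "emeasure (distr (scale_measure c (distr Q borel F)) borel fst) A = c * emeasure (distr Q borel F) (A \<times> UNIV)"
    using Ab fs by (subst emeasure_distr) (auto simp: vimage_fst)
  also have "emeasure (distr Q borel F) (A \<times> UNIV) = emeasure Q ((f -` A) \<times> UNIV)"
    using Ab FQ sp by (subst emeasure_distr) (auto simp: skew_product_def intro!: arg_cong2[where f = emeasure])
  finally show "A \<in> null_sets (distr (scale_measure c (distr Q borel F)) borel fst)"
    using 0 Ab by (auto simp: null_sets_def)
qed

section \<open>Identification of the defined operator with push-forward\<close>

text \<open>The scaled push-forward, with its own disintegration, satisfies the description. No
  other measure does: density and conditional measures determine it, and where the density vanishes
  the conditional measures do not contribute.\<close>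

lemma skew_transfer_pos_eq:
  fixes Q :: "('m \<times> 'k) measure"
  assumes fQ: "finite_measure Q" and sQ: "sets Q = sets borel"
    and ac: "absolutely_continuous m (distr Q borel fst)"
  shows "skew_transfer_pos f G \<phi> h m d P Q = scale_measure (ennreal l) (distr Q borel F)"
proof -
  define u where "u = base_density m Q"
  define \<kappa> where "\<kappa> = cond_measure m Q"
  define T where "T = transfer_h f \<phi> h u"
  define S where "S \<gamma> E = 1 / (h \<gamma> * T \<gamma>) * (\<Sum>i<d. u (branch i \<gamma>) * h (branch i \<gamma>) * exp (\<phi> (branch i \<gamma>)) *
      measure (distr (\<kappa> (branch i \<gamma>)) borel F) E)" for \<gamma> and E :: "('m \<times> 'k) set"
  define good where "good R \<longleftrightarrow> finite_measure R \<and> sets R = sets borel \<and>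
     (\<exists>\<kappa>' \<psi>. disintegration m R \<kappa>' \<psi> \<and> (AE \<gamma> in m. \<psi> \<gamma> = T \<gamma>) \<and>
        (AE \<gamma> in m. T \<gamma> \<noteq> 0 \<longrightarrow> (\<forall>E\<in>sets borel. measure (\<kappa>' \<gamma>) E = S \<gamma> E)))" for R :: "('m \<times> 'k) measure"
  have stp: "skew_transfer_pos f G \<phi> h m d P Q = (THE R. good R)"
    unfolding skew_transfer_pos_def good_def S_def T_def u_def \<kappa>_def branch_def Let_def ..
  have dis: "disintegration m Q \<kappa> u"
    unfolding \<kappa>_def u_def by (rule the_disintegration[OF fQ sQ finite_m sets_m ac])
  have \<kappa>: "\<kappa> \<in> measurable borel (prob_algebra borel)" and u_meas: "u \<in> borel_measurable borel"
    and Q1: "distr Q borel fst = density m (\<lambda>\<gamma>. ennreal (u \<gamma>))" and u0: "\<And>\<gamma>. 0 \<le> u \<gamma>"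
    and \<kappa>_fib: "AE \<gamma> in distr Q borel fst. emeasure (\<kappa> \<gamma>) ({\<gamma>} \<times> UNIV) = 1"
    using dis unfolding disintegration_def by blast+
  note \<kappa>' = prob_kernel_distr_snd[OF \<kappa>]
  have u_meas_m: "(\<lambda>\<gamma>. ennreal (u \<gamma>)) \<in> borel_measurable m"
    unfolding measurable_cong_sets[OF sets_m refl] using u_meas by measurable
  define R0 where "R0 = scale_measure (ennreal l) (distr Q borel F)"
  have FQ: "F \<in> measurable Q borel" unfolding measurable_cong_sets[OF sQ refl] by (rule F_meas)
  have fD: "finite_measure (distr Q borel F)" using finite_measure.finite_measure_distr[OF fQ FQ] .
  have R0: "finite_measure R0" "sets R0 = sets borel"
  proof -
    interpret finite_measure "distr Q borel F" by (rule fD)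
    show "finite_measure R0"
      unfolding R0_def by (rule finite_measureI) (simp add: ennreal_mult_eq_top_iff)
    show "sets R0 = sets borel" by (simp add: R0_def)
  qed
  have acR0: "absolutely_continuous m (distr R0 borel fst)"
    unfolding R0_def by (rule base_push_ac[OF sQ ac])
  have smR0: "sm_of R0 = l *\<^sub>R sm_push F (sm_of Q)"
    unfolding R0_def using l_pos fD by (subst sm_of_scale_measure) (auto simp: sm_of_distr[OF fQ sQ F_meas])
  define \<psi> where "\<psi> = base_density m R0"
  define K where "K = cond_measure m R0"
  have disR0: "disintegration m R0 K \<psi>"
    unfolding K_def \<psi>_def by (rule the_disintegration[OF R0 finite_m sets_m acR0])
  have K: "K \<in> measurable borel (prob_algebra borel)" and \<psi>_meas: "\<psi> \<in> borel_measurable borel"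
    and R01: "distr R0 borel fst = density m (\<lambda>\<gamma>. ennreal (\<psi> \<gamma>))" and \<psi>0: "\<And>\<gamma>. 0 \<le> \<psi> \<gamma>"
    and K_fib: "AE \<gamma> in distr R0 borel fst. emeasure (K \<gamma>) ({\<gamma>} \<times> UNIV) = 1"
    using disR0 unfolding disintegration_def by blast+
  note K' = prob_kernel_distr_snd[OF K]
  have \<psi>_meas_m: "(\<lambda>\<gamma>. ennreal (\<psi> \<gamma>)) \<in> borel_measurable m"
    unfolding measurable_cong_sets[OF sets_m refl] using \<psi>_meas by measurable
  let ?r = "restriction_pos m Q"
  \<comment> \<open>The zero summand specialises linearity of representing families to
    multiplication by \<open>l\<close>.\<close>
  have "fibre_rep m (\<lambda>\<gamma>. l *\<^sub>R push_rep ?r \<gamma> + 0 *\<^sub>R push_rep ?r \<gamma>) (l *\<^sub>R sm_push F (sm_of Q) + 0 *\<^sub>R sm_push F (sm_of Q))"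
    by (intro fibre_rep_lin fibre_rep_push fibre_rep_restriction_pos fQ sQ finite_m sets_m ac)
  then have "fibre_rep m (\<lambda>\<gamma>. l *\<^sub>R push_rep ?r \<gamma>) (sm_of R0)" by (simp add: smR0)
  from fibre_rep_unique[OF finite_m sets_m fibre_rep_restriction_pos[OF R0 finite_m sets_m acR0] this]
  have eq: "AE \<gamma> in \<nu>. restriction_pos m R0 \<gamma> = l *\<^sub>R push_rep ?r \<gamma>" by (simp add: AE_m_iff)
  have eqE: "AE \<gamma> in \<nu>. \<forall>E\<in>sets borel. sm (restriction_pos m R0 \<gamma>) (Pair \<gamma> -` E) =
      1 / h \<gamma> * (\<Sum>i<d. h (branch i \<gamma>) * exp (\<phi> (branch i \<gamma>)) * sm (?r (branch i \<gamma>)) (Pair (branch i \<gamma>) -` (F -` E)))"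
    using eq
  proof eventually_elim
    case (elim \<gamma>)
    show ?case
    proof
      fix E :: "('m \<times> 'k) set" assume E: "E \<in> sets borel"
      have "sm (restriction_pos m R0 \<gamma>) (Pair \<gamma> -` E) =
        l * (\<Sum>i<d. weight i \<gamma> * sm (?r (branch i \<gamma>)) (Pair (branch i \<gamma>) -` (F -` E)))"
        by (simp add: elim scaleR_signed_measure.rep_eq sm_push_rep[OF E])
      also have "\<dots> = 1 / h \<gamma> * (\<Sum>i<d. h (branch i \<gamma>) * exp (\<phi> (branch i \<gamma>)) * sm (?r (branch i \<gamma>)) (Pair (branch i \<gamma>) -` (F -` E)))"
        unfolding sum_distrib_left using l_pos by (intro sum.cong refl) (simp add: weight_def)
      finally show "sm (restriction_pos m R0 \<gamma>) (Pair \<gamma> -` E) =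
        1 / h \<gamma> * (\<Sum>i<d. h (branch i \<gamma>) * exp (\<phi> (branch i \<gamma>)) * sm (?r (branch i \<gamma>)) (Pair (branch i \<gamma>) -` (F -` E)))" .
    qed
  qed
  have r_UNIV: "sm (?r \<gamma>) UNIV = u \<gamma>" for \<gamma>
    unfolding u_def by (rule sm_restriction_pos_UNIV[OF fQ sQ finite_m sets_m ac])
  have R0_UNIV: "sm (restriction_pos m R0 \<gamma>) UNIV = \<psi> \<gamma>" for \<gamma>
    unfolding \<psi>_def by (rule sm_restriction_pos_UNIV[OF R0 finite_m sets_m acR0])
  have \<psi>T: "AE \<gamma> in \<nu>. \<psi> \<gamma> = T \<gamma>"
    using eqE AE_transfer
  proof eventually_elim
    case (elim \<gamma>)
    have "\<psi> \<gamma> = 1 / h \<gamma> * (\<Sum>i<d. h (branch i \<gamma>) * exp (\<phi> (branch i \<gamma>)) * u (branch i \<gamma>))"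
      using elim(1)[rule_format, of UNIV] by (simp add: R0_UNIV r_UNIV)
    also have "\<dots> = T \<gamma>"
      using elim(2)[rule_format, of "\<lambda>y. u y * h y"] by (simp add: T_def transfer_h_def mult_ac)
    finally show ?case .
  qed
  \<comment> \<open>Concentration on the fibre is known a.e. for the base projection, whose density
    may vanish; for \<nu> it is therefore claimed only where the density is nonzero.\<close>
  have fib1: "AE \<gamma> in \<nu>. \<psi> \<gamma> \<noteq> 0 \<longrightarrow> emeasure (K \<gamma>) ({\<gamma>} \<times> UNIV) = 1"
  proof -
    have "AE \<gamma> in m. 0 < ennreal (\<psi> \<gamma>) \<longrightarrow> emeasure (K \<gamma>) ({\<gamma>} \<times> UNIV) = 1"
      using K_fib unfolding R01 AE_density[OF \<psi>_meas_m] .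
    then have "AE \<gamma> in m. \<psi> \<gamma> \<noteq> 0 \<longrightarrow> emeasure (K \<gamma>) ({\<gamma>} \<times> UNIV) = 1"
      by eventually_elim (use \<psi>0 in \<open>auto simp: less_le\<close>)
    then show ?thesis by (simp add: AE_m_iff)
  qed
  have fib0: "AE \<gamma> in \<nu>. u \<gamma> \<noteq> 0 \<longrightarrow> emeasure (\<kappa> \<gamma>) ({\<gamma>} \<times> UNIV) = 1"
  proof -
    have "AE \<gamma> in m. 0 < ennreal (u \<gamma>) \<longrightarrow> emeasure (\<kappa> \<gamma>) ({\<gamma>} \<times> UNIV) = 1"
      using \<kappa>_fib unfolding Q1 AE_density[OF u_meas_m] .
    then have "AE \<gamma> in m. u \<gamma> \<noteq> 0 \<longrightarrow> emeasure (\<kappa> \<gamma>) ({\<gamma>} \<times> UNIV) = 1"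
      by eventually_elim (use u0 in \<open>auto simp: less_le\<close>)
    then show ?thesis by (simp add: AE_m_iff)
  qed
  have K_section: "measure (K \<gamma>) E = sm (restriction_pos m R0 \<gamma>) (Pair \<gamma> -` E) / \<psi> \<gamma>"
    if "emeasure (K \<gamma>) ({\<gamma>} \<times> UNIV) = 1" "\<psi> \<gamma> \<noteq> 0" "E \<in> sets borel" for \<gamma> E
  proof -
    have "measure (K \<gamma>) E = measure (K \<gamma>) (UNIV \<times> (Pair \<gamma> -` E))"
      by (rule fibre_measure_section[OF K'(1,2) that(1,3)])
    moreover have "sm (restriction_pos m R0 \<gamma>) (Pair \<gamma> -` E) = \<psi> \<gamma> * measure (K \<gamma>) (UNIV \<times> (Pair \<gamma> -` E))"
      using K'(3,5)[where \<gamma> = \<gamma>] Pair_vimage_borel[OF that(3), of \<gamma>]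
      by (simp add: restriction_pos_def scaleR_signed_measure.rep_eq sm_sm_of flip: K_def \<psi>_def)
    ultimately show ?thesis using that(2) by simp
  qed
  \<comment> \<open>Where \<open>u\<close> vanishes the conditional measure may sit on other fibres,
    but then both sides are zero.\<close>
  have \<kappa>_section: "sm (?r \<gamma>) (Pair \<gamma> -` (F -` E)) = u \<gamma> * measure (distr (\<kappa> \<gamma>) borel F) E"
    if "u \<gamma> \<noteq> 0 \<longrightarrow> emeasure (\<kappa> \<gamma>) ({\<gamma>} \<times> UNIV) = 1" "E \<in> sets borel" for \<gamma> E
  proof -
    have FE: "F -` E \<in> sets borel" using measurable_sets[OF F_meas that(2)] by simp
    have F\<kappa>: "F \<in> measurable (\<kappa> \<gamma>) borel" unfolding measurable_cong_sets[OF \<kappa>'(1) refl] by (rule F_meas)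
    have "measure (distr (\<kappa> \<gamma>) borel F) E = measure (\<kappa> \<gamma>) (F -` E)"
      using F\<kappa> that(2) sets_eq_imp_space_eq[OF \<kappa>'(1)[of \<gamma>]] by (simp add: measure_distr)
    moreover have "u \<gamma> \<noteq> 0 \<Longrightarrow> measure (\<kappa> \<gamma>) (F -` E) = measure (\<kappa> \<gamma>) (UNIV \<times> (Pair \<gamma> -` (F -` E)))"
      using that(1) by (intro fibre_measure_section[OF \<kappa>'(1,2) _ FE]) simp
    moreover have "sm (?r \<gamma>) (Pair \<gamma> -` (F -` E)) = u \<gamma> * measure (\<kappa> \<gamma>) (UNIV \<times> (Pair \<gamma> -` (F -` E)))"
      using \<kappa>'(3,5)[where \<gamma> = \<gamma>] Pair_vimage_borel[OF FE, of \<gamma>]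
      by (simp add: restriction_pos_def scaleR_signed_measure.rep_eq sm_sm_of flip: \<kappa>_def u_def)
    ultimately show ?thesis by (cases "u \<gamma> = 0") simp_all
  qed
  \<comment> \<open>Concentration is needed for \<kappa> at the preimages of \<gamma>, hence
    \<open>AE_branches\<close>; for \<open>K\<close> it is needed at \<gamma> itself.\<close>
  have KS: "AE \<gamma> in \<nu>. T \<gamma> \<noteq> 0 \<longrightarrow> (\<forall>E\<in>sets borel. measure (K \<gamma>) E = S \<gamma> E)"
    using fib1 AE_branches[OF fib0] \<psi>T eqE
  proof eventually_elim
    case (elim \<gamma>)
    show ?case
    proof (intro impI ballI)
      fix E :: "('m \<times> 'k) set" assume T: "T \<gamma> \<noteq> 0" and E: "E \<in> sets borel"
      have sum_eq: "(\<Sum>i<d. h (branch i \<gamma>) * exp (\<phi> (branch i \<gamma>)) * sm (?r (branch i \<gamma>)) (Pair (branch i \<gamma>) -` (F -` E))) =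
        (\<Sum>i<d. u (branch i \<gamma>) * h (branch i \<gamma>) * exp (\<phi> (branch i \<gamma>)) * measure (distr (\<kappa> (branch i \<gamma>)) borel F) E)"
        using elim(2) E by (intro sum.cong refl) (simp add: \<kappa>_section)
      have "measure (K \<gamma>) E = sm (restriction_pos m R0 \<gamma>) (Pair \<gamma> -` E) / \<psi> \<gamma>"
        using elim(1,3) T E by (intro K_section) auto
      then show "measure (K \<gamma>) E = S \<gamma> E"
        using elim(3,4) E by (simp add: S_def sum_eq)
    qed
  qed
  have good: "good R0"
    unfolding good_def using R0 disR0 \<psi>T KS by (auto simp: AE_m_iff)
  have unique: "R = R0" if "good R" for R
  proof (rule measure_eqI)
    from that obtain \<kappa>1 \<psi>1 where R: "finite_measure R" "sets R = sets borel" "disintegration m R \<kappa>1 \<psi>1"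
      "AE \<gamma> in m. \<psi>1 \<gamma> = T \<gamma>" "AE \<gamma> in m. T \<gamma> \<noteq> 0 \<longrightarrow> (\<forall>E\<in>sets borel. measure (\<kappa>1 \<gamma>) E = S \<gamma> E)"
      unfolding good_def by blast
    show "sets R = sets R0" using R(2) R0(2) by simp
    have integral: "emeasure R' E = (\<integral>\<^sup>+\<gamma>. ennreal (\<psi>' \<gamma>) * emeasure (\<kappa>' \<gamma>) E \<partial>m)"
      if dis': "disintegration m R' \<kappa>' \<psi>'" and E: "E \<in> sets borel" for R' :: "('m \<times> 'k) measure" and \<kappa>' \<psi>' E
    proof -
      have a: "\<kappa>' \<in> measurable borel (prob_algebra borel)" "\<psi>' \<in> borel_measurable borel"
        "distr R' borel fst = density m (\<lambda>\<gamma>. ennreal (\<psi>' \<gamma>))"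
        "emeasure R' E = (\<integral>\<^sup>+\<gamma>. emeasure (\<kappa>' \<gamma>) E \<partial>distr R' borel fst)"
        using dis' E unfolding disintegration_def by blast+
      have "(\<lambda>\<gamma>. emeasure (\<kappa>' \<gamma>) E) \<in> borel_measurable m" "(\<lambda>\<gamma>. ennreal (\<psi>' \<gamma>)) \<in> borel_measurable m"
        unfolding measurable_cong_sets[OF sets_m refl]
        using measurable_emeasure_kernel[OF measurable_prob_algebraD[OF a(1)] E] a(2) by measurable
      then show ?thesis unfolding a(4) a(3) by (intro nn_integral_density)
    qed
    fix E assume "E \<in> sets R"
    then have E: "E \<in> sets borel" using R(2) by simp
    have \<kappa>1: "\<kappa>1 \<in> measurable borel (prob_algebra borel)"
      using R(3) unfolding disintegration_def by blast
    have "AE \<gamma> in m. ennreal (\<psi>1 \<gamma>) * emeasure (\<kappa>1 \<gamma>) E = ennreal (\<psi> \<gamma>) * emeasure (K \<gamma>) E"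
      using R(4,5) \<psi>T[folded AE_m_iff] KS[folded AE_m_iff]
    proof eventually_elim
      case (elim \<gamma>)
      show ?case
      proof (cases "T \<gamma> = 0")
        case False
        interpret k1: prob_space "\<kappa>1 \<gamma>" by (rule prob_kernel_distr_snd(2)[OF \<kappa>1])
        interpret k: prob_space "K \<gamma>" by (rule K')
        have "measure (\<kappa>1 \<gamma>) E = measure (K \<gamma>) E" using False elim(2,4) E by simp
        then show ?thesis using elim(1,3) by (simp add: k1.emeasure_eq_measure k.emeasure_eq_measure)
      qed (use elim in simp)
    qed
    then show "emeasure R E = emeasure R0 E"
      unfolding integral[OF R(3) E] integral[OF disR0 E] by (rule nn_integral_cong_AE)
  qed
  show ?thesis
    unfolding stp R0_def[symmetric] using good unique by (rule the_equality)
qed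

text \<open>The images of the Jordan parts of \<mu> need not be the Jordan parts of the image;
  linearity of push-forward reassembles them.\<close>

lemma skew_transfer_eq:
  fixes \<mu> :: "('m \<times> 'k) signed_measure"
  assumes \<mu>: "\<mu> \<in> AB m"
  shows "skew_transfer f G \<phi> h m d P \<mu> = l *\<^sub>R sm_push F \<mu>"
proof -
  have J: "jordan_decomposition \<mu> (pos_part \<mu>) (neg_part \<mu>)" by (rule jordan_decomposition_parts)
  then have fin: "finite_measure (pos_part \<mu>)" "finite_measure (neg_part \<mu>)"
    and s: "sets (pos_part \<mu>) = sets borel" "sets (neg_part \<mu>) = sets borel"
    and eq: "\<mu> = sm_of (pos_part \<mu>) - sm_of (neg_part \<mu>)"
    unfolding jordan_decomposition_def by blast+
  have *: "sm_of (skew_transfer_pos f G \<phi> h m d P Q) = l *\<^sub>R sm_push F (sm_of Q)"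
    if Q: "finite_measure Q" "sets Q = sets borel" "absolutely_continuous m (distr Q borel fst)"
    for Q :: "('m \<times> 'k) measure"
  proof -
    have "F \<in> measurable Q borel" unfolding measurable_cong_sets[OF Q(2) refl] by (rule F_meas)
    then have "finite_measure (distr Q borel F)" by (rule finite_measure.finite_measure_distr[OF Q(1)])
    then show ?thesis
      unfolding skew_transfer_pos_eq[OF Q]
      using l_pos by (subst sm_of_scale_measure) (auto simp: sm_of_distr[OF Q(1,2) F_meas])
  qed
  have "skew_transfer f G \<phi> h m d P \<mu> =
    l *\<^sub>R sm_push F (sm_of (pos_part \<mu>)) - l *\<^sub>R sm_push F (sm_of (neg_part \<mu>))"
    unfolding skew_transfer_def using \<mu> fin s by (simp add: * AB_def)
  also have "\<dots> = l *\<^sub>R sm_push F (1 *\<^sub>R sm_of (pos_part \<mu>) + (-1) *\<^sub>R sm_of (neg_part \<mu>))"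
    unfolding sm_push_lin[OF F_meas] by (simp add: scaleR_diff_right)
  also have "1 *\<^sub>R sm_of (pos_part \<mu>) + (-1) *\<^sub>R sm_of (neg_part \<mu>) = \<mu>"
    using eq by simp
  finally show ?thesis .
qed

end

section \<open>Spectral decomposition of the base operator\<close>

text \<open>An infimum of extended reals is reached along a sequence of admissible bounds, so
  countably many null sets suffice. The argument covers fibrewise norms that may fail to be
  measurable.\<close>

lemma ess_sup_AE: "AE x in M. ereal (u x) \<le> ess_sup M u"
proof -
  define X where "X = {c. AE x in M. ereal (u x) \<le> c}"
  have "\<infinity> \<in> X" by (simp add: X_def)
  then obtain c where c: "range c \<subseteq> X" "Inf X = (INF i::nat. c i)"
    using Inf_countable_INF[of X] by blast
  then have "AE x in M. \<forall>i. ereal (u x) \<le> c i"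
    unfolding AE_all_countable X_def by blast
  then show ?thesis
    unfolding ess_sup_def X_def[symmetric] c(2) by eventually_elim (auto intro: INF_greatest)
qed

lemma ess_sup_le: "(AE x in M. ereal (u x) \<le> c) \<Longrightarrow> ess_sup M u \<le> c"
  unfolding ess_sup_def by (rule Inf_lower) simp

text \<open>Since \<open>Bs\<close> contains every function vanishing almost everywhere, measurable or not, the operator
  may be applied to the indicator of a set that contains exactly one preimage in \<open>N\<close> of each point
  of \<open>f ` N\<close>.\<close>

lemma transfer_null_image:
  assumes nfs: "normed_function_space \<nu> B N" and fso: "function_space_operator \<nu> B (transfer f \<phi>)"
    and space: "space \<nu> = UNIV" and Z: "Z \<in> null_sets \<nu>"
  shows "\<exists>Z'\<in>null_sets \<nu>. f ` Z \<subseteq> Z'"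
proof -
  \<comment> \<open>Selecting a single preimage leaves one nonzero term in the sum. With infinitely
    many preimages in \<open>Z\<close> the sum could diverge, and \<open>infsum\<close> would then
    take the default value zero.\<close>
  define c where "c y = (SOME x. x \<in> Z \<and> f x = y)" for y
  have c: "c y \<in> Z \<and> f (c y) = y" if "y \<in> f ` Z" for y
    unfolding c_def by (rule someI_ex) (use that in auto)
  define X where "X = c ` f ` Z"
  have B0: "(\<lambda>_. 0) \<in> B" using nfs unfolding normed_function_space_def by (elim conjE)
  have ae: "AE x in \<nu>. 0 = (indicator X x :: real)"
    using AE_not_in[OF Z] by eventually_elim (use c in \<open>auto simp: X_def indicator_def\<close>)
  have Bcong: "\<forall>g\<in>B. \<forall>g'. (AE x in \<nu>. g x = g' x) \<longrightarrow> g' \<in> B"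
    using nfs unfolding normed_function_space_def by (elim conjE)
  have BX: "indicator X \<in> B" by (rule Bcong[rule_format, OF B0 ae])
  have "\<forall>g\<in>B. \<forall>g'\<in>B. (AE x in \<nu>. g x = g' x) \<longrightarrow> (AE x in \<nu>. transfer f \<phi> g x = transfer f \<phi> g' x)"
    using fso unfolding function_space_operator_def by (elim conjE)
  from this[rule_format, OF B0 BX ae]
  have "AE x in \<nu>. transfer f \<phi> (\<lambda>_. 0) x = transfer f \<phi> (indicator X) x" .
  then have "AE x in \<nu>. transfer f \<phi> (indicator X) x = 0"
    by (simp add: transfer_def)
  from AE_E[OF this] obtain Z' where Z': "{x\<in>space \<nu>. transfer f \<phi> (indicator X) x \<noteq> 0} \<subseteq> Z'"
    "emeasure \<nu> Z' = 0" "Z' \<in> sets \<nu>" .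
  have pos: "transfer f \<phi> (indicator X) y \<noteq> 0" if y: "y \<in> f ` Z" for y
  proof -
    have "transfer f \<phi> (indicator X) y = (\<Sum>\<^sub>\<infinity>x\<in>{c y}. indicator X x * exp (\<phi> x))"
      unfolding transfer_def
    proof (rule infsum_cong_neutral)
      fix x assume x: "x \<in> f -` {y} - {c y}"
      have "x \<notin> X"
      proof
        assume "x \<in> X"
        then obtain z where z: "z \<in> f ` Z" "x = c z" by (auto simp: X_def)
        then have "z = y" using c[OF z(1)] x by auto
        with z(2) x show False by auto
      qed
      then show "indicator X x * exp (\<phi> x) = 0" by simp
    next
      fix x assume "x \<in> {c y} - f -` {y}"
      then show "indicator X x * exp (\<phi> x) = 0" using c[OF y] by auto
    qed simp
    also have "\<dots> = exp (\<phi> (c y))" using y by (simp add: X_def)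
    finally show ?thesis by simp
  qed
  have "f ` Z \<subseteq> Z'" using pos Z'(1) space by auto
  moreover have "Z' \<in> null_sets \<nu>" using Z'(2,3) by (simp add: null_sets_def)
  ultimately show ?thesis by blast
qed

lemma nfs_norm_cong:
  assumes nfs: "normed_function_space \<nu> B N" and g: "g \<in> B" "AE x in \<nu>. g x = g' x"
  shows "g' \<in> B" "N g' = N g"
proof -
  have cong: "\<And>g g'. g \<in> B \<Longrightarrow> (AE x in \<nu>. g x = g' x) \<Longrightarrow> g' \<in> B"
    and add: "\<And>g g'. g \<in> B \<Longrightarrow> g' \<in> B \<Longrightarrow> (\<lambda>x. g x + g' x) \<in> B"
    and scale: "\<And>c g. g \<in> B \<Longrightarrow> (\<lambda>x. c * g x) \<in> B"
    and zero: "\<And>g. g \<in> B \<Longrightarrow> N g = 0 \<longleftrightarrow> (AE x in \<nu>. g x = 0)"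
    and tri: "\<And>g g'. g \<in> B \<Longrightarrow> g' \<in> B \<Longrightarrow> N (\<lambda>x. g x + g' x) \<le> N g + N g'"
    using nfs unfolding normed_function_space_def by simp_all
  have le: "N u \<le> N v" if u: "u \<in> B" and v: "v \<in> B" and ae: "AE x in \<nu>. u x = v x" for u v
  proof -
    let ?D = "\<lambda>x. u x + (-1) * v x"
    have D: "?D \<in> B" by (intro add u scale v)
    have "N ?D = 0" unfolding zero[OF D] using ae by eventually_elim simp
    moreover have "N (\<lambda>x. v x + ?D x) \<le> N v + N ?D" by (rule tri[OF v D])
    ultimately show ?thesis by simp
  qed
  show g': "g' \<in> B" by (rule cong[OF g])
  have "AE x in \<nu>. g' x = g x" using g(2) by eventually_elim simp
  then show "N g' = N g" using le[OF g' g(1)] le[OF g(1) g' g(2)] by simp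
qed

text \<open>Apply \<open>Nf\<close> to \<open>h = Pf h + Nf h\<close>: as \<open>Nf\<close> kills
  the image of \<open>Pf\<close>, the function \<open>Nf h\<close> is fixed by \<open>Nf\<close>, so
  geometric decay forces it to vanish. Hence \<open>h\<close> lies in the image of \<open>Pf\<close>
  and spans it.\<close>

lemma spectral_eigenfunction:
  assumes nfs: "normed_function_space \<nu> B N" and sd: "spectral_decomposition \<nu> B N T Pf Nf"
    and h: "h \<in> B" "AE x in \<nu>. T h x = h x" "\<not> (AE x in \<nu>. h x = 0)"
  shows "AE x in \<nu>. Pf h x = h x" "\<And>g. g \<in> B \<Longrightarrow> \<exists>c. AE x in \<nu>. Pf g x = c * h x"
proof -
  from sd have Pf: "function_space_operator \<nu> B Pf" and Nf: "function_space_operator \<nu> B Nf"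
    and dec: "\<And>g. g \<in> B \<Longrightarrow> AE x in \<nu>. T g x = Pf g x + Nf g x"
    and one: "\<exists>g\<^sub>0\<in>B. \<not> (AE x in \<nu>. Pf g\<^sub>0 x = 0) \<and> (\<forall>g\<in>B. \<exists>c. AE x in \<nu>. Pf g x = c * Pf g\<^sub>0 x)"
    and NP: "\<And>g. g \<in> B \<Longrightarrow> AE x in \<nu>. Nf (Pf g) x = 0"
    and decay: "\<exists>C\<^sub>0 r. 0 < C\<^sub>0 \<and> 0 \<le> r \<and> r < 1 \<and> (\<forall>g\<in>B. \<forall>n\<ge>1. N ((Nf ^^ n) g) \<le> C\<^sub>0 * r ^ n * N g)"
    unfolding spectral_decomposition_def by simp_all
  from Nf have NfB: "\<And>g. g \<in> B \<Longrightarrow> Nf g \<in> B"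
    and Nf_cong: "\<And>g g'. g \<in> B \<Longrightarrow> g' \<in> B \<Longrightarrow> AE x in \<nu>. g x = g' x \<Longrightarrow> AE x in \<nu>. Nf g x = Nf g' x"
    and Nf_lin: "\<And>a b g g'. g \<in> B \<Longrightarrow> g' \<in> B \<Longrightarrow> AE x in \<nu>. Nf (\<lambda>y. a * g y + b * g' y) x = a * Nf g x + b * Nf g' x"
    unfolding function_space_operator_def by simp_all
  from Pf have PfB: "\<And>g. g \<in> B \<Longrightarrow> Pf g \<in> B"
    unfolding function_space_operator_def by simp
  have pow: "(Nf ^^ n) g \<in> B" if "g \<in> B" for n g
    using that by (induction n) (simp_all add: NfB)
  have hdec: "AE x in \<nu>. h x = 1 * Pf h x + 1 * Nf h x"
    using dec[OF h(1)] h(2) by eventually_elim simp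
  have sumB: "(\<lambda>x. 1 * Pf h x + 1 * Nf h x) \<in> B"
    by (rule nfs_norm_cong(1)[OF nfs h(1) hdec])
  have NN: "AE x in \<nu>. Nf h x = Nf (Nf h) x"
    using Nf_cong[OF h(1) sumB hdec] Nf_lin[OF PfB[OF h(1)] NfB[OF h(1)], of 1 1] NP[OF h(1)]
    by eventually_elim simp
  have powN: "AE x in \<nu>. Nf h x = (Nf ^^ Suc n) h x" for n
  proof (induction n)
    case (Suc n)
    have "AE x in \<nu>. Nf (Nf h) x = Nf ((Nf ^^ Suc n) h) x"
      by (rule Nf_cong[OF NfB[OF h(1)] pow[OF h(1)] Suc.IH])
    with NN show ?case by eventually_elim simp
  qed simp
  obtain C\<^sub>0 r where C: "0 < C\<^sub>0" "0 \<le> r" "r < 1" "\<And>g n. g \<in> B \<Longrightarrow> 1 \<le> n \<Longrightarrow> N ((Nf ^^ n) g) \<le> C\<^sub>0 * r ^ n * N g"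
    using decay by blast
  have "N (Nf h) \<le> C\<^sub>0 * r ^ Suc n * N h" for n
    using nfs_norm_cong(2)[OF nfs NfB[OF h(1)] powN[of n]] C(4)[OF h(1), of "Suc n"] by simp
  moreover have "(\<lambda>n. C\<^sub>0 * r ^ Suc n * N h) \<longlonglongrightarrow> C\<^sub>0 * 0 * N h"
    using C by (intro tendsto_intros LIMSEQ_Suc LIMSEQ_power_zero) auto
  ultimately have "N (Nf h) \<le> C\<^sub>0 * 0 * N h" by (intro LIMSEQ_le_const) auto
  moreover have nn: "\<And>g. g \<in> B \<Longrightarrow> 0 \<le> N g" and zero: "\<And>g. g \<in> B \<Longrightarrow> N g = 0 \<longleftrightarrow> (AE x in \<nu>. g x = 0)"
    using nfs unfolding normed_function_space_def by simp_all
  ultimately have "N (Nf h) = 0" using nn[OF NfB[OF h(1)]] by simp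
  then have "AE x in \<nu>. Nf h x = 0" using zero[OF NfB[OF h(1)]] by simp
  with hdec show Ph: "AE x in \<nu>. Pf h x = h x" by eventually_elim simp
  obtain g\<^sub>0 where g0: "g\<^sub>0 \<in> B" "\<And>g. g \<in> B \<Longrightarrow> \<exists>c. AE x in \<nu>. Pf g x = c * Pf g\<^sub>0 x"
    using one by blast
  obtain a where a: "AE x in \<nu>. Pf h x = a * Pf g\<^sub>0 x" using g0(2)[OF h(1)] by blast
  have "a \<noteq> 0"
  proof
    assume a0: "a = 0"
    have "AE x in \<nu>. h x = 0" using a Ph by eventually_elim (simp add: a0)
    with h(3) show False by simp
  qed
  show "\<exists>c. AE x in \<nu>. Pf g x = c * h x" if g: "g \<in> B" for g
  proof -
    obtain c where "AE x in \<nu>. Pf g x = c * Pf g\<^sub>0 x" using g0(2)[OF g] by blast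
    with a Ph have "AE x in \<nu>. Pf g x = (c / a) * h x"
    proof eventually_elim
      case (elim x)
      then have "h x = a * Pf g\<^sub>0 x" by simp
      with elim(3) \<open>a \<noteq> 0\<close> show ?case by simp
    qed
    then show ?thesis by blast
  qed
qed

lemma is_norm_sum:
  assumes "is_norm no"
  shows "no (\<Sum>i\<in>I. c i *\<^sub>R v i) \<le> (\<Sum>i\<in>I. \<bar>c i\<bar> * no (v i))"
proof -
  have z: "no 0 = 0" and add: "\<And>u v. no (u + v) \<le> no u + no v" and sc: "\<And>c u. no (c *\<^sub>R u) = \<bar>c\<bar> * no u"
    using assms unfolding is_norm_def by blast+
  show ?thesis
  proof (induction I rule: infinite_finite_induct)
    case (insert i I)
    have "no (c i *\<^sub>R v i + (\<Sum>i\<in>I. c i *\<^sub>R v i)) \<le> no (c i *\<^sub>R v i) + no (\<Sum>i\<in>I. c i *\<^sub>R v i)"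
      by (rule add)
    with insert show ?case by (simp add: sc)
  qed (simp_all add: z)
qed

section \<open>Decomposition of the skew product operator\<close>

locale skew_gap = skew_system f G \<phi> h m \<nu> l d P
  for f :: "'m::polish_space \<Rightarrow> 'm" and G :: "'m \<times> 'k::polish_space \<Rightarrow> 'k"
    and \<phi> h :: "'m \<Rightarrow> real" and m \<nu> :: "'m measure" and l :: real and d :: nat and P :: "nat \<Rightarrow> 'm set" +
  fixes Bs Bw :: "('m \<Rightarrow> real) set" and ns nw :: "('m \<Rightarrow> real) \<Rightarrow> real" and \<alpha> :: real
    and no :: "'k signed_measure \<Rightarrow> real" and Pf Nf :: "('m \<Rightarrow> real) \<Rightarrow> 'm \<Rightarrow> real"
    and \<mu>\<^sub>0 :: "('m \<times> 'k) measure"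
  assumes gap: "spectral_gap_data f \<phi> h \<nu> l Bs ns Bw nw"
    and spectral: "spectral_decomposition \<nu> Bs ns (\<lambda>g x. transfer f \<phi> g x / l) Pf Nf"
    and \<mu>0: "invariant_prob (skew_product f G) \<mu>\<^sub>0" "distr \<mu>\<^sub>0 borel fst = m"
    and no: "is_norm no" and \<alpha>: "0 \<le> \<alpha>" "\<alpha> < 1"
    and no_contract: "AE \<gamma> in \<nu>. \<forall>\<mu>. no (sm_push (\<lambda>y. G (\<gamma>, y)) \<mu>) \<le> \<alpha> * no \<mu> + \<bar>sm \<mu> UNIV\<bar>"
    and no_push: "\<And>\<gamma> \<mu>. no (sm_push (\<lambda>y. G (\<gamma>, y)) \<mu>) \<le> no \<mu>"
    and marginal_bound: "\<And>\<mu>. \<mu> \<in> L_infty no m \<Longrightarrow>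
          ess_sup \<nu> (\<lambda>x. \<bar>marginal_density m \<mu> x\<bar>) \<le> ereal (nw (marginal_density m \<mu>)) \<and>
          ereal (nw (marginal_density m \<mu>)) \<le> norm_infty no m \<mu>"
    and no_prob: "\<And>\<eta>. prob_space \<eta> \<Longrightarrow> sets \<eta> = sets borel \<Longrightarrow> no (sm_of \<eta>) = 1"
begin

lemma no_nonneg: "0 \<le> no u" and no_add: "no (u + v) \<le> no u + no v" and no_scale: "no (c *\<^sub>R u) = \<bar>c\<bar> * no u"
  using no unfolding is_norm_def by blast+

lemma Bs_normed: "normed_function_space \<nu> Bs ns" and h_Bs: "h \<in> Bs"
  and inv_h_Bs: "(\<lambda>x. 1 / h x) \<in> Bs"
  and Bs_mult: "\<And>g g'. g \<in> Bs \<Longrightarrow> g' \<in> Bs \<Longrightarrow> (\<lambda>x. g x * g' x) \<in> Bs"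
  and nw_le: "\<And>g. g \<in> Bs \<Longrightarrow> nw g \<le> ns g"
  and transfer_Bs: "\<And>g. g \<in> Bs \<Longrightarrow> transfer f \<phi> g \<in> Bs"
  and mult_bound: "\<exists>C. \<forall>g\<in>Bs. ns (\<lambda>x. g x * h x) \<le> C * ns g \<and> ns (\<lambda>x. g x * (1 / h x)) \<le> C * ns g"
  using gap unfolding spectral_gap_data_def function_space_operator_def by simp_all

lemma Bs_cong: "g \<in> Bs \<Longrightarrow> AE x in \<nu>. g x = g' x \<Longrightarrow> g' \<in> Bs"
  by (rule nfs_norm_cong(1)[OF Bs_normed])

lemma Bs_add: "g \<in> Bs \<Longrightarrow> g' \<in> Bs \<Longrightarrow> (\<lambda>x. g x + g' x) \<in> Bs"
  and Bs_scale: "g \<in> Bs \<Longrightarrow> (\<lambda>x. c * g x) \<in> Bs"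
  and ns_nonneg: "g \<in> Bs \<Longrightarrow> 0 \<le> ns g"
  using Bs_normed unfolding normed_function_space_def by simp_all

lemma not_AE_False: "\<not> (AE x in \<nu>. False)"
  using prob_space.AE_False[OF prob_m] by (simp add: AE_m_iff)

text \<open>As \<nu> is not the zero measure, an inequality between numbers may be checked at a
  generic base point; the coefficient is compared and bounded this way.\<close>

lemma AE_const: "AE x in \<nu>. c \<Longrightarrow> c"
  using not_AE_False by (cases c) auto

section \<open>The normed space of measures\<close>

abbreviation Sinf :: "('m \<times> 'k) signed_measure set" where "Sinf \<equiv> S_infty no m Bs"
abbreviation marg :: "('m \<times> 'k) signed_measure \<Rightarrow> 'm \<Rightarrow> real" where "marg \<equiv> marginal_density m"

definition sup_norm :: "('m \<times> 'k) signed_measure \<Rightarrow> real" where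
  "sup_norm \<mu> = real_of_ereal (norm_infty no m \<mu>)"

lemma norm_infty_nonneg: "0 \<le> norm_infty no m \<mu>"
proof -
  have "AE \<gamma> in m. ereal (no (restriction m \<mu> \<gamma>)) \<le> norm_infty no m \<mu>"
    unfolding norm_infty_def by (rule ess_sup_AE)
  then have "AE \<gamma> in m. 0 \<le> norm_infty no m \<mu>"
  proof eventually_elim
    case (elim \<gamma>)
    have "0 \<le> ereal (no (restriction m \<mu> \<gamma>))" using no_nonneg by simp
    from order_trans[OF this elim] show ?case .
  qed
  then have "AE \<gamma> in \<nu>. 0 \<le> norm_infty no m \<mu>" unfolding AE_m_iff .
  then show ?thesis by (rule AE_const)
qed

lemma sup_norm:
  assumes "\<mu> \<in> L_infty no m"
  shows "norm_infty no m \<mu> = ereal (sup_norm \<mu>)" "0 \<le> sup_norm \<mu>"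
    "AE \<gamma> in \<nu>. no (restriction m \<mu> \<gamma>) \<le> sup_norm \<mu>"
proof -
  have "norm_infty no m \<mu> < \<infinity>" using assms by (simp add: L_infty_def)
  then show *: "norm_infty no m \<mu> = ereal (sup_norm \<mu>)"
    unfolding sup_norm_def using norm_infty_nonneg[of \<mu>] by (cases "norm_infty no m \<mu>") auto
  show "0 \<le> sup_norm \<mu>" using norm_infty_nonneg[of \<mu>] by (simp add: *)
  have "AE \<gamma> in m. ereal (no (restriction m \<mu> \<gamma>)) \<le> norm_infty no m \<mu>"
    unfolding norm_infty_def by (rule ess_sup_AE)
  then show "AE \<gamma> in \<nu>. no (restriction m \<mu> \<gamma>) \<le> sup_norm \<mu>" by (simp add: AE_m_iff *)
qed

lemma L_inftyI:
  assumes "\<mu> \<in> AB m" "AE \<gamma> in \<nu>. no (restriction m \<mu> \<gamma>) \<le> c"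
  shows "\<mu> \<in> L_infty no m" "sup_norm \<mu> \<le> c"
proof -
  have "norm_infty no m \<mu> \<le> ereal c"
    unfolding norm_infty_def using assms(2) by (intro ess_sup_le) (simp add: AE_m_iff)
  then have "norm_infty no m \<mu> < \<infinity>" using le_less_trans[of _ "ereal c" \<infinity>] by simp
  then show L: "\<mu> \<in> L_infty no m" using assms(1) by (simp add: L_infty_def)
  show "sup_norm \<mu> \<le> c" using \<open>norm_infty no m \<mu> \<le> ereal c\<close> by (simp add: sup_norm(1)[OF L])
qed

lemma L_AB: "\<mu> \<in> L_infty no m \<Longrightarrow> \<mu> \<in> AB m"
  by (simp add: L_infty_def)

lemma Sinf_L: "\<mu> \<in> Sinf \<Longrightarrow> \<mu> \<in> L_infty no m" and Sinf_marg: "\<mu> \<in> Sinf \<Longrightarrow> marg \<mu> \<in> Bs"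
  by (simp_all add: S_infty_def)

lemma Sinf_AB: "\<mu> \<in> Sinf \<Longrightarrow> \<mu> \<in> AB m"
  by (rule L_AB[OF Sinf_L])

text \<open>The two halves of (G2) in a.e. form: the weak norm lies between the essential bound of
  the marginal and the fibrewise norm.\<close>

lemma marg_bound:
  assumes "\<mu> \<in> L_infty no m"
  shows "AE x in \<nu>. \<bar>marg \<mu> x\<bar> \<le> nw (marg \<mu>)" "nw (marg \<mu>) \<le> sup_norm \<mu>"
proof -
  have b: "ess_sup \<nu> (\<lambda>x. \<bar>marg \<mu> x\<bar>) \<le> ereal (nw (marg \<mu>))" "ereal (nw (marg \<mu>)) \<le> norm_infty no m \<mu>"
    using marginal_bound[OF assms] by auto
  have "AE x in \<nu>. ereal \<bar>marg \<mu> x\<bar> \<le> ess_sup \<nu> (\<lambda>x. \<bar>marg \<mu> x\<bar>)" by (rule ess_sup_AE)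
  then show "AE x in \<nu>. \<bar>marg \<mu> x\<bar> \<le> nw (marg \<mu>)"
  proof eventually_elim
    case (elim x)
    from order_trans[OF elim b(1)] show ?case by simp
  qed
  show "nw (marg \<mu>) \<le> sup_norm \<mu>" using b(2) by (simp add: sup_norm(1)[OF assms])
qed

lemma marg_lin:
  assumes "\<mu> \<in> AB m" "\<eta> \<in> AB m"
  shows "AE x in \<nu>. marg (a *\<^sub>R \<mu> + b *\<^sub>R \<eta>) x = a * marg \<mu> x + b * marg \<eta> x"
proof -
  note L = AB_lin[OF finite_m sets_m assms, of a b]
  have "AE x in \<nu>. restriction m (a *\<^sub>R \<mu> + b *\<^sub>R \<eta>) x = a *\<^sub>R restriction m \<mu> x + b *\<^sub>R restriction m \<eta> x"
    using L(2) by (simp add: AE_m_iff)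
  then show ?thesis
    by eventually_elim
      (simp add: sm_restriction_UNIV[OF finite_m sets_m, symmetric] L(1) assms
        plus_signed_measure.rep_eq scaleR_signed_measure.rep_eq)
qed

lemma L_lin:
  assumes "\<mu> \<in> L_infty no m" "\<eta> \<in> L_infty no m"
  shows "a *\<^sub>R \<mu> + b *\<^sub>R \<eta> \<in> L_infty no m" "sup_norm (a *\<^sub>R \<mu> + b *\<^sub>R \<eta>) \<le> \<bar>a\<bar> * sup_norm \<mu> + \<bar>b\<bar> * sup_norm \<eta>"
proof -
  note L = AB_lin[OF finite_m sets_m L_AB[OF assms(1)] L_AB[OF assms(2)], of a b]
  have "AE x in \<nu>. restriction m (a *\<^sub>R \<mu> + b *\<^sub>R \<eta>) x = a *\<^sub>R restriction m \<mu> x + b *\<^sub>R restriction m \<eta> x"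
    using L(2) by (simp add: AE_m_iff)
  then have "AE x in \<nu>. no (restriction m (a *\<^sub>R \<mu> + b *\<^sub>R \<eta>) x) \<le> \<bar>a\<bar> * sup_norm \<mu> + \<bar>b\<bar> * sup_norm \<eta>"
    using sup_norm(3)[OF assms(1)] sup_norm(3)[OF assms(2)]
  proof eventually_elim
    case (elim x)
    have "no (restriction m (a *\<^sub>R \<mu> + b *\<^sub>R \<eta>) x) \<le> \<bar>a\<bar> * no (restriction m \<mu> x) + \<bar>b\<bar> * no (restriction m \<eta> x)"
      unfolding elim(1) using no_add[of "a *\<^sub>R restriction m \<mu> x" "b *\<^sub>R restriction m \<eta> x"] by (simp add: no_scale)
    also have "\<dots> \<le> \<bar>a\<bar> * sup_norm \<mu> + \<bar>b\<bar> * sup_norm \<eta>"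
      using elim by (intro add_mono mult_left_mono) auto
    finally show ?case .
  qed
  with L(1) show "a *\<^sub>R \<mu> + b *\<^sub>R \<eta> \<in> L_infty no m" "sup_norm (a *\<^sub>R \<mu> + b *\<^sub>R \<eta>) \<le> \<bar>a\<bar> * sup_norm \<mu> + \<bar>b\<bar> * sup_norm \<eta>"
    by (rule L_inftyI)+
qed

lemma Sinf_lin:
  assumes "\<mu> \<in> Sinf" "\<eta> \<in> Sinf"
  shows "a *\<^sub>R \<mu> + b *\<^sub>R \<eta> \<in> Sinf"
proof -
  have "(\<lambda>x. a * marg \<mu> x + b * marg \<eta> x) \<in> Bs"
    using assms by (intro Bs_add Bs_scale Sinf_marg)
  moreover have "AE x in \<nu>. a * marg \<mu> x + b * marg \<eta> x = marg (a *\<^sub>R \<mu> + b *\<^sub>R \<eta>) x"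
    using marg_lin[OF Sinf_AB[OF assms(1)] Sinf_AB[OF assms(2)], of a b] by eventually_elim simp
  ultimately have "marg (a *\<^sub>R \<mu> + b *\<^sub>R \<eta>) \<in> Bs" by (rule Bs_cong)
  then show ?thesis
    using L_lin(1)[OF Sinf_L[OF assms(1)] Sinf_L[OF assms(2)]] by (simp add: S_infty_def)
qed

section \<open>Fibrewise estimates for the push-forward\<close>

abbreviation push :: "('m \<times> 'k) signed_measure \<Rightarrow> ('m \<times> 'k) signed_measure" where "push \<equiv> sm_push F"

lemma no_push_rep: "no (push_rep R \<gamma>) \<le> (\<Sum>i<d. weight i \<gamma> * no (sm_push (\<lambda>y. G (branch i \<gamma>, y)) (R (branch i \<gamma>))))"
  unfolding push_rep_def using is_norm_sum[OF no, of "\<lambda>i. weight i \<gamma>" _ "{..<d}"] by (simp add: weight_nonneg)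

text \<open>The averaging step shared by both estimates from (G1): an a.e. bound \<open>c\<close> at
  the branch points survives because the weights are nonnegative and sum to one.\<close>

lemma push_bound:
  assumes \<mu>: "\<mu> \<in> L_infty no m"
    and c: "AE \<gamma> in \<nu>. no (sm_push (\<lambda>y. G (\<gamma>, y)) (restriction m \<mu> \<gamma>)) \<le> c"
  shows "push \<mu> \<in> L_infty no m" "sup_norm (push \<mu>) \<le> c"
proof -
  note R = restriction_push[OF L_AB[OF \<mu>]]
  have "AE \<gamma> in \<nu>. restriction m (push \<mu>) \<gamma> = push_rep (restriction m \<mu>) \<gamma>"
    using R(2) by (simp add: AE_m_iff)
  then have "AE \<gamma> in \<nu>. no (restriction m (push \<mu>) \<gamma>) \<le> c"
    using AE_branches[OF c] AE_sum_weight
  proof eventually_elim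
    case (elim \<gamma>)
    have "no (restriction m (push \<mu>) \<gamma>) \<le>
      (\<Sum>i<d. weight i \<gamma> * no (sm_push (\<lambda>y. G (branch i \<gamma>, y)) (restriction m \<mu> (branch i \<gamma>))))"
      unfolding elim(1) by (rule no_push_rep)
    also have "\<dots> \<le> (\<Sum>i<d. weight i \<gamma> * c)"
      using elim(2) by (intro sum_mono mult_left_mono weight_nonneg) auto
    also have "\<dots> = c" using elim(3) by (simp flip: sum_distrib_right)
    finally show ?case .
  qed
  with R(1) show "push \<mu> \<in> L_infty no m" "sup_norm (push \<mu>) \<le> c" by (rule L_inftyI)+
qed

lemma push_L:
  assumes \<mu>: "\<mu> \<in> L_infty no m"
  shows "push \<mu> \<in> L_infty no m" "sup_norm (push \<mu>) \<le> sup_norm \<mu>"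
proof -
  have "AE \<gamma> in \<nu>. no (sm_push (\<lambda>y. G (\<gamma>, y)) (restriction m \<mu> \<gamma>)) \<le> sup_norm \<mu>"
    using sup_norm(3)[OF \<mu>] by eventually_elim (rule order_trans[OF no_push])
  then show "push \<mu> \<in> L_infty no m" "sup_norm (push \<mu>) \<le> sup_norm \<mu>"
    by (rule push_bound[OF \<mu>])+
qed

text \<open>The mass term in the contraction is the marginal density at the branch point, which the
  weak norm bounds a.e.\<close>

lemma lasota_yorke:
  assumes \<mu>: "\<mu> \<in> L_infty no m"
  shows "sup_norm (push \<mu>) \<le> \<alpha> * sup_norm \<mu> + nw (marg \<mu>)"
proof (rule push_bound(2)[OF \<mu>])
  show "AE \<gamma> in \<nu>. no (sm_push (\<lambda>y. G (\<gamma>, y)) (restriction m \<mu> \<gamma>)) \<le> \<alpha> * sup_norm \<mu> + nw (marg \<mu>)"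
    using sup_norm(3)[OF \<mu>] marg_bound(1)[OF \<mu>] no_contract
  proof eventually_elim
    case (elim \<gamma>)
    have "no (sm_push (\<lambda>y. G (\<gamma>, y)) (restriction m \<mu> \<gamma>)) \<le> \<alpha> * no (restriction m \<mu> \<gamma>) + \<bar>marg \<mu> \<gamma>\<bar>"
      using elim(3) by (simp add: sm_restriction_UNIV[OF finite_m sets_m L_AB[OF \<mu>], symmetric])
    also have "\<dots> \<le> \<alpha> * sup_norm \<mu> + nw (marg \<mu>)"
      using elim(1,2) \<alpha> by (intro add_mono mult_left_mono) auto
    finally show ?case .
  qed
qed

lemma push_Sinf:
  assumes \<mu>: "\<mu> \<in> Sinf"
  shows "push \<mu> \<in> Sinf"
proof -
  have "(\<lambda>x. marg \<mu> x * h x) \<in> Bs" using \<mu> by (intro Bs_mult Sinf_marg h_Bs)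
  then have "(\<lambda>\<gamma>. (1 / l) * transfer f \<phi> (\<lambda>x. marg \<mu> x * h x) \<gamma> * (1 / h \<gamma>)) \<in> Bs"
    by (rule Bs_mult[OF Bs_scale[OF transfer_Bs] inv_h_Bs])
  moreover have "AE \<gamma> in \<nu>. (1 / l) * transfer f \<phi> (\<lambda>x. marg \<mu> x * h x) \<gamma> * (1 / h \<gamma>) = marg (push \<mu>) \<gamma>"
    using marginal_push[OF Sinf_AB[OF \<mu>]] by eventually_elim simp
  ultimately have "marg (push \<mu>) \<in> Bs" by (rule Bs_cong)
  then show ?thesis using push_L(1)[OF Sinf_L[OF \<mu>]] by (simp add: S_infty_def)
qed

section \<open>The spectral coefficient of a measure\<close>

text \<open>The density of the base projection with respect to \<nu> instead of \<open>m\<close>. In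
  this form push-forward acts as \<open>transfer\<close> divided by \<open>l\<close>, to which the
  spectral decomposition applies.\<close>

definition wmarg :: "('m \<times> 'k) signed_measure \<Rightarrow> 'm \<Rightarrow> real" where
  "wmarg \<mu> = (\<lambda>x. marg \<mu> x * h x)"

lemma wmarg_Bs: "\<mu> \<in> Sinf \<Longrightarrow> wmarg \<mu> \<in> Bs"
  unfolding wmarg_def by (intro Bs_mult Sinf_marg h_Bs)

lemma wmarg_push:
  assumes "\<mu> \<in> Sinf"
  shows "AE x in \<nu>. wmarg (push \<mu>) x = transfer f \<phi> (wmarg \<mu>) x / l"
  using marginal_push[OF Sinf_AB[OF assms]]
proof eventually_elim
  case (elim x)
  then show ?case using h_pos[of x] by (simp add: wmarg_def)
qed

lemma wmarg_lin:
  assumes "\<mu> \<in> Sinf" "\<eta> \<in> Sinf"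
  shows "AE x in \<nu>. wmarg (a *\<^sub>R \<mu> + b *\<^sub>R \<eta>) x = a * wmarg \<mu> x + b * wmarg \<eta> x"
  using marg_lin[OF Sinf_AB[OF assms(1)] Sinf_AB[OF assms(2)], of a b]
  by eventually_elim (simp add: wmarg_def algebra_simps)

lemma Pf_Bs: "g \<in> Bs \<Longrightarrow> Pf g \<in> Bs" and Nf_Bs: "g \<in> Bs \<Longrightarrow> Nf g \<in> Bs"
  and Pf_cong: "g \<in> Bs \<Longrightarrow> g' \<in> Bs \<Longrightarrow> AE x in \<nu>. g x = g' x \<Longrightarrow> AE x in \<nu>. Pf g x = Pf g' x"
  and Nf_cong: "g \<in> Bs \<Longrightarrow> g' \<in> Bs \<Longrightarrow> AE x in \<nu>. g x = g' x \<Longrightarrow> AE x in \<nu>. Nf g x = Nf g' x"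
  and Pf_lin: "g \<in> Bs \<Longrightarrow> g' \<in> Bs \<Longrightarrow> AE x in \<nu>. Pf (\<lambda>y. a * g y + b * g' y) x = a * Pf g x + b * Pf g' x"
  and decomp: "g \<in> Bs \<Longrightarrow> AE x in \<nu>. transfer f \<phi> g x / l = Pf g x + Nf g x"
  and Pf_Pf: "g \<in> Bs \<Longrightarrow> AE x in \<nu>. Pf (Pf g) x = Pf g x"
  and Pf_Nf: "g \<in> Bs \<Longrightarrow> AE x in \<nu>. Pf (Nf g) x = 0"
  using spectral unfolding spectral_decomposition_def function_space_operator_def by simp_all

lemma Nf_decay: "\<exists>C\<^sub>0 r. 0 < C\<^sub>0 \<and> 0 \<le> r \<and> r < 1 \<and> (\<forall>g\<in>Bs. \<forall>n\<ge>1. ns ((Nf ^^ n) g) \<le> C\<^sub>0 * r ^ n * ns g)"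
  using spectral unfolding spectral_decomposition_def by (elim conjE)

lemma h_fixed: "AE x in \<nu>. transfer f \<phi> h x / l = h x"
  using h_eigen by eventually_elim (use l_pos in simp)

lemma h_nonzero: "\<not> (AE x in \<nu>. h x = 0)"
proof
  assume "AE x in \<nu>. h x = 0"
  then have "AE x in \<nu>. False"
  proof eventually_elim
    case (elim x)
    then show False using h_pos[of x] by simp
  qed
  then show False using not_AE_False by simp
qed

lemma Pf_h: "AE x in \<nu>. Pf h x = h x"
  by (rule spectral_eigenfunction(1)[OF Bs_normed spectral h_Bs h_fixed h_nonzero])

text \<open>The coordinate of the spectral projection along \<open>h\<close>; it is unique because
  \<open>h\<close> is positive, as \<open>coeff_eqI\<close> exploits.\<close>

definition coeff :: "('m \<times> 'k) signed_measure \<Rightarrow> real" where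
  "coeff \<mu> = (SOME c. AE x in \<nu>. Pf (wmarg \<mu>) x = c * h x)"

lemma coeff: "\<mu> \<in> Sinf \<Longrightarrow> AE x in \<nu>. Pf (wmarg \<mu>) x = coeff \<mu> * h x"
  unfolding coeff_def
  by (rule someI_ex, rule spectral_eigenfunction(2)[OF Bs_normed spectral h_Bs h_fixed h_nonzero wmarg_Bs])

lemma coeff_eqI:
  assumes "\<mu> \<in> Sinf" "AE x in \<nu>. Pf (wmarg \<mu>) x = c * h x"
  shows "coeff \<mu> = c"
proof -
  have "AE x in \<nu>. coeff \<mu> = c"
    using coeff[OF assms(1)] assms(2)
  proof eventually_elim
    case (elim x)
    then show ?case using h_pos[of x] by simp
  qed
  then show ?thesis by (rule AE_const)
qed

lemma coeff_lin:
  assumes "\<mu> \<in> Sinf" "\<eta> \<in> Sinf"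
  shows "coeff (a *\<^sub>R \<mu> + b *\<^sub>R \<eta>) = a * coeff \<mu> + b * coeff \<eta>"
proof (rule coeff_eqI[OF Sinf_lin[OF assms]])
  have B: "(\<lambda>x. a * wmarg \<mu> x + b * wmarg \<eta> x) \<in> Bs"
    using assms by (intro Bs_add Bs_scale wmarg_Bs)
  show "AE x in \<nu>. Pf (wmarg (a *\<^sub>R \<mu> + b *\<^sub>R \<eta>)) x = (a * coeff \<mu> + b * coeff \<eta>) * h x"
    using Pf_cong[OF wmarg_Bs[OF Sinf_lin[OF assms]] B wmarg_lin[OF assms]] coeff[OF assms(1)] coeff[OF assms(2)]
      Pf_lin[OF wmarg_Bs[OF assms(1)] wmarg_Bs[OF assms(2)], of a b]
    by eventually_elim (simp add: algebra_simps)
qed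

lemma wmarg_push_decomp:
  assumes "\<mu> \<in> Sinf"
  shows "AE x in \<nu>. wmarg (push \<mu>) x = 1 * Pf (wmarg \<mu>) x + 1 * Nf (wmarg \<mu>) x"
  using wmarg_push[OF assms] decomp[OF wmarg_Bs[OF assms]] by eventually_elim simp

text \<open>The base operator acts on a density as \<open>Pf\<close> plus \<open>Nf\<close>;
  applying \<open>Pf\<close> again keeps the first part and kills the second.\<close>

lemma coeff_push:
  assumes \<mu>: "\<mu> \<in> Sinf"
  shows "coeff (push \<mu>) = coeff \<mu>"
proof (rule coeff_eqI[OF push_Sinf[OF \<mu>]])
  have g: "wmarg \<mu> \<in> Bs" by (rule wmarg_Bs[OF \<mu>])
  have B: "(\<lambda>x. 1 * Pf (wmarg \<mu>) x + 1 * Nf (wmarg \<mu>) x) \<in> Bs"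
    using g by (intro Bs_add Bs_scale Pf_Bs Nf_Bs)
  show "AE x in \<nu>. Pf (wmarg (push \<mu>)) x = coeff \<mu> * h x"
    using Pf_cong[OF wmarg_Bs[OF push_Sinf[OF \<mu>]] B wmarg_push_decomp[OF \<mu>]]
      Pf_lin[OF Pf_Bs[OF g] Nf_Bs[OF g], of 1 1] Pf_Pf[OF g] Pf_Nf[OF g] coeff[OF \<mu>]
    by eventually_elim simp
qed

section \<open>The invariant measure in the function space setting\<close>

definition inv_sm :: "('m \<times> 'k) signed_measure" where "inv_sm = sm_of \<mu>\<^sub>0"

lemma prob_\<mu>0: "prob_space \<mu>\<^sub>0" and sets_\<mu>0: "sets \<mu>\<^sub>0 = sets borel" and inv_\<mu>0: "distr \<mu>\<^sub>0 borel F = \<mu>\<^sub>0"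
  using \<mu>0 unfolding invariant_prob_def by auto

lemma push_inv_sm: "push inv_sm = inv_sm"
  unfolding inv_sm_def
  using sm_of_distr[OF prob_space.finite_measure[OF prob_\<mu>0] sets_\<mu>0 F_meas] by (simp add: inv_\<mu>0)

text \<open>The projection is \<open>m\<close> itself, so the density is 1 a.e. and the restrictions
  are probabilities up to a null set; (G3) then gives their norm.\<close>

lemma inv_sm_restriction:
  shows "inv_sm \<in> AB m" "AE \<gamma> in \<nu>. no (restriction m inv_sm \<gamma>) = 1" "AE \<gamma> in \<nu>. marg inv_sm \<gamma> = 1"
proof -
  have f0: "finite_measure \<mu>\<^sub>0" by (rule prob_space.finite_measure[OF prob_\<mu>0])
  have ac: "absolutely_continuous m (distr \<mu>\<^sub>0 borel fst)"
    unfolding \<mu>0(2) absolutely_continuous_def ..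
  have rep: "fibre_rep m (restriction_pos m \<mu>\<^sub>0) inv_sm"
    unfolding inv_sm_def by (rule fibre_rep_restriction_pos[OF f0 sets_\<mu>0 finite_m sets_m ac])
  show AB: "inv_sm \<in> AB m" by (rule fibre_rep_imp_AB[OF sets_m rep])
  have eq: "AE \<gamma> in \<nu>. restriction m inv_sm \<gamma> = restriction_pos m \<mu>\<^sub>0 \<gamma>"
    using restriction_AE_eq[OF finite_m sets_m rep] by (simp add: AE_m_iff)
  have dis: "disintegration m \<mu>\<^sub>0 (cond_measure m \<mu>\<^sub>0) (base_density m \<mu>\<^sub>0)"
    by (rule the_disintegration[OF f0 sets_\<mu>0 finite_m sets_m ac])
  then have \<kappa>: "cond_measure m \<mu>\<^sub>0 \<in> measurable borel (prob_algebra borel)"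
    and u: "base_density m \<mu>\<^sub>0 \<in> borel_measurable borel" "\<And>\<gamma>. 0 \<le> base_density m \<mu>\<^sub>0 \<gamma>"
    and dens: "distr \<mu>\<^sub>0 borel fst = density m (\<lambda>\<gamma>. ennreal (base_density m \<mu>\<^sub>0 \<gamma>))"
    unfolding disintegration_def by blast+
  interpret m: finite_measure m by (rule finite_m)
  have um: "(\<lambda>\<gamma>. ennreal (base_density m \<mu>\<^sub>0 \<gamma>)) \<in> borel_measurable m"
    unfolding measurable_cong_sets[OF sets_m refl] using u(1) by measurable
  have "density m (\<lambda>\<gamma>. ennreal (base_density m \<mu>\<^sub>0 \<gamma>)) = density m (\<lambda>_. 1)"
    using dens \<mu>0(2) by (simp add: density_1)
  then have "AE \<gamma> in m. ennreal (base_density m \<mu>\<^sub>0 \<gamma>) = 1"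
    using m.density_unique_iff[OF um, of "\<lambda>_. 1"] by simp
  then have one: "AE \<gamma> in \<nu>. base_density m \<mu>\<^sub>0 \<gamma> = 1"
    by (simp add: AE_m_iff)
  have no1: "no (restriction_pos m \<mu>\<^sub>0 \<gamma>) = base_density m \<mu>\<^sub>0 \<gamma>" for \<gamma>
    unfolding restriction_pos_def no_scale
    using no_prob[OF prob_kernel_distr_snd(4)[OF \<kappa>]] u(2) by simp
  show "AE \<gamma> in \<nu>. no (restriction m inv_sm \<gamma>) = 1"
    using eq one by eventually_elim (simp add: no1)
  show "AE \<gamma> in \<nu>. marg inv_sm \<gamma> = 1"
    using eq one
  proof eventually_elim
    case (elim \<gamma>)
    have "marg inv_sm \<gamma> = sm (restriction_pos m \<mu>\<^sub>0 \<gamma>) UNIV"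
      by (simp add: sm_restriction_UNIV[OF finite_m sets_m AB, symmetric] elim(1))
    then show ?case
      by (simp add: sm_restriction_pos_UNIV[OF f0 sets_\<mu>0 finite_m sets_m ac] elim(2))
  qed
qed

lemma inv_sm_L: "inv_sm \<in> L_infty no m" "sup_norm inv_sm \<le> 1"
proof -
  have "AE \<gamma> in \<nu>. no (restriction m inv_sm \<gamma>) \<le> 1"
    using inv_sm_restriction(2) by eventually_elim simp
  with inv_sm_restriction(1) show "inv_sm \<in> L_infty no m" "sup_norm inv_sm \<le> 1" by (rule L_inftyI)+
qed

lemma inv_sm_Sinf: "inv_sm \<in> Sinf"
proof -
  \<comment> \<open>The constant 1 belongs to \<open>Bs\<close> as the product of \<open>h\<close>
    and its reciprocal.\<close>
  have "(\<lambda>x. h x * (1 / h x)) \<in> Bs" by (intro Bs_mult h_Bs inv_h_Bs)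
  moreover have "AE x in \<nu>. h x * (1 / h x) = marg inv_sm x"
    using inv_sm_restriction(3)
  proof eventually_elim
    case (elim x)
    then show ?case using h_pos[of x] by simp
  qed
  ultimately have "marg inv_sm \<in> Bs" by (rule Bs_cong)
  then show ?thesis using inv_sm_L(1) by (simp add: S_infty_def)
qed

lemma wmarg_inv_sm: "AE x in \<nu>. wmarg inv_sm x = h x"
  using inv_sm_restriction(3) by eventually_elim (simp add: wmarg_def)

lemma coeff_inv_sm: "coeff inv_sm = 1"
proof (rule coeff_eqI[OF inv_sm_Sinf])
  show "AE x in \<nu>. Pf (wmarg inv_sm) x = 1 * h x"
    using Pf_cong[OF wmarg_Bs[OF inv_sm_Sinf] h_Bs wmarg_inv_sm] Pf_h by eventually_elim simp
qed

lemma inv_sm_nonzero: "inv_sm \<noteq> 0"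
proof
  assume "inv_sm = 0"
  moreover have "sm inv_sm UNIV = 1"
    using prob_space.prob_space[OF prob_\<mu>0] sets_eq_imp_space_eq[OF sets_\<mu>0]
    by (simp add: inv_sm_def sm_sm_of[OF prob_space.finite_measure[OF prob_\<mu>0] sets_\<mu>0])
  ultimately show False by (simp add: zero_signed_measure.rep_eq)
qed

section \<open>The remainder operator and its decay\<close>

text \<open>Push-forward minus projection, with the scalars spelled out so that the linearity lemmas
  match.\<close>

definition remainder :: "('m \<times> 'k) signed_measure \<Rightarrow> ('m \<times> 'k) signed_measure" where
  "remainder \<mu> = 1 *\<^sub>R push \<mu> + (- coeff \<mu>) *\<^sub>R inv_sm"

lemma remainder_Sinf: "\<mu> \<in> Sinf \<Longrightarrow> remainder \<mu> \<in> Sinf"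
  unfolding remainder_def by (intro Sinf_lin push_Sinf inv_sm_Sinf)

text \<open>Push-forward keeps the coefficient and the invariant measure has coefficient 1. This
  gives \<open>Pr (N \<mu>) = 0\<close>, and it makes later applications of the remainder plain
  push-forwards.\<close>

lemma coeff_remainder: "\<mu> \<in> Sinf \<Longrightarrow> coeff (remainder \<mu>) = 0"
  unfolding remainder_def by (subst coeff_lin) (simp_all add: push_Sinf inv_sm_Sinf coeff_push coeff_inv_sm)

lemma remainder_lin:
  assumes "\<mu> \<in> Sinf" "\<eta> \<in> Sinf"
  shows "remainder (a *\<^sub>R \<mu> + b *\<^sub>R \<eta>) = a *\<^sub>R remainder \<mu> + b *\<^sub>R remainder \<eta>"
  unfolding remainder_def coeff_lin[OF assms] sm_push_lin[OF F_meas]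
  by (simp add: scaleR_add_right scaleR_add_left algebra_simps)

lemma remainder_inv_sm: "remainder (c *\<^sub>R inv_sm) = 0"
proof -
  have "remainder (c *\<^sub>R inv_sm + 0 *\<^sub>R inv_sm) = c *\<^sub>R remainder inv_sm + 0 *\<^sub>R remainder inv_sm" by (rule remainder_lin[OF inv_sm_Sinf inv_sm_Sinf])
  moreover have "remainder inv_sm = 0" by (simp add: remainder_def coeff_inv_sm push_inv_sm)
  ultimately show ?thesis by simp
qed

text \<open>Subtracting the multiple of the invariant measure removes exactly the \<open>Pf\<close>
  part of the density, so iterates of the remainder have the iterates of \<open>Nf\<close> as
  densities.\<close>

lemma wmarg_remainder:
  assumes \<mu>: "\<mu> \<in> Sinf"
  shows "AE x in \<nu>. wmarg (remainder \<mu>) x = Nf (wmarg \<mu>) x"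
  using wmarg_lin[OF push_Sinf[OF \<mu>] inv_sm_Sinf, of 1 "- coeff \<mu>"] wmarg_push_decomp[OF \<mu>] coeff[OF \<mu>] wmarg_inv_sm
  unfolding remainder_def[symmetric] by eventually_elim simp

lemma remainder_pow:
  assumes \<mu>: "\<mu> \<in> Sinf"
  shows "(remainder ^^ n) \<mu> \<in> Sinf" "AE x in \<nu>. (Nf ^^ n) (wmarg \<mu>) x = wmarg ((remainder ^^ n) \<mu>) x"
proof -
  show S: "(remainder ^^ n) \<mu> \<in> Sinf" for n
    by (induction n) (simp_all add: \<mu> remainder_Sinf)
  have B: "(Nf ^^ n) (wmarg \<mu>) \<in> Bs" for n
    by (induction n) (simp_all add: wmarg_Bs[OF \<mu>] Nf_Bs)
  show "AE x in \<nu>. (Nf ^^ n) (wmarg \<mu>) x = wmarg ((remainder ^^ n) \<mu>) x"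
  proof (induction n)
    case (Suc n)
    show ?case
      using Nf_cong[OF B wmarg_Bs[OF S] Suc.IH] wmarg_remainder[OF S[of n]] by eventually_elim simp
  qed simp
qed

text \<open>For \<open>n \<ge> 1\<close> the fibrewise norms \<open>a n\<close> satisfy
  \<open>a (n + 1) \<le> \<alpha> * a n + D * r ^ n * Z\<close>, where \<open>Z\<close> is the
  initial norm. Any rate strictly above both \<alpha> and \<open>r\<close> dominates the solution of
  this recursion.\<close>

lemma remainder_decay:
  "\<exists>\<xi> R. 0 < \<xi> \<and> \<xi> < 1 \<and> 0 < R \<and>
    (\<forall>\<mu>\<in>Sinf. \<forall>n\<ge>1. norm_S_infty no m ns ((remainder ^^ n) \<mu>) \<le> R * \<xi> ^ n * norm_S_infty no m ns \<mu>)"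
proof -
  obtain C where C: "\<And>g. g \<in> Bs \<Longrightarrow> ns (\<lambda>x. g x * h x) \<le> C * ns g" "\<And>g. g \<in> Bs \<Longrightarrow> ns (\<lambda>x. g x * (1 / h x)) \<le> C * ns g"
    using mult_bound by blast
  define C' where "C' = \<bar>C\<bar>"
  have C': "ns (\<lambda>x. g x * h x) \<le> C' * ns g" "ns (\<lambda>x. g x * (1 / h x)) \<le> C' * ns g" if "g \<in> Bs" for g
    using C[OF that] mult_right_mono[OF abs_ge_self[of C] ns_nonneg[OF that]] unfolding C'_def by auto
  have C'0: "0 \<le> C'" by (simp add: C'_def)
  obtain C\<^sub>0 r where r: "0 < C\<^sub>0" "0 \<le> r" "r < 1" "\<And>g n. g \<in> Bs \<Longrightarrow> 1 \<le> n \<Longrightarrow> ns ((Nf ^^ n) g) \<le> C\<^sub>0 * r ^ n * ns g"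
    using Nf_decay by blast
  \<comment> \<open>One factor \<open>C'\<close> for multiplying the marginal by \<open>h\<close>,
    \<open>C\<^sub>0\<close> for the decay of \<open>Nf\<close>, and one factor \<open>C'\<close>
    for dividing by \<open>h\<close> again.\<close>
  define D where "D = C' * C\<^sub>0 * C'"
  have D0: "0 \<le> D" using C'0 r(1) by (simp add: D_def)
  \<comment> \<open>The midpoint between the larger rate and 1; the strict gap to \<alpha> absorbs
    the forcing term even when \<alpha> equals \<open>r\<close>.\<close>
  define \<xi> where "\<xi> = (1 + max \<alpha> r) / 2"
  have \<xi>: "\<alpha> < \<xi>" "r < \<xi>" "0 < \<xi>" "\<xi> < 1"
    using \<alpha> r by (auto simp: \<xi>_def)
  \<comment> \<open>The first summand covers the start at \<open>n = 1\<close>, the second the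
    induction step; these are \<open>K1\<close> and \<open>K2\<close>.\<close>
  define K where "K = (2 + D) / \<xi> + D / (\<xi> - \<alpha>)"
  have K1: "2 + D \<le> K * \<xi>" and K2: "\<alpha> * K + D \<le> K * \<xi>" and K0: "0 \<le> K"
  proof -
    have q: "0 \<le> (2 + D) / \<xi>" "0 \<le> D / (\<xi> - \<alpha>)" using D0 \<xi> by simp_all
    then show "0 \<le> K" by (simp add: K_def)
    have "(2 + D) / \<xi> * \<xi> \<le> K * \<xi>" using q \<xi> by (intro mult_right_mono) (auto simp: K_def)
    then show "2 + D \<le> K * \<xi>" using \<xi> by simp
    have "D / (\<xi> - \<alpha>) * (\<xi> - \<alpha>) \<le> K * (\<xi> - \<alpha>)" using q \<xi> by (intro mult_right_mono) (auto simp: K_def)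
    then have "D \<le> K * (\<xi> - \<alpha>)" using \<xi> by simp
    then show "\<alpha> * K + D \<le> K * \<xi>" by (simp add: algebra_simps)
  qed
  \<comment> \<open>\<open>D\<close> accounts for the marginal and \<open>K\<close> for the
    fibrewise norm; the extra 1 makes the constant visibly positive.\<close>
  have main: "ns (marg ((remainder ^^ n) \<mu>)) + sup_norm ((remainder ^^ n) \<mu>) \<le> (D + K + 1) * \<xi> ^ n * (ns (marg \<mu>) + sup_norm \<mu>)"
    if \<mu>: "\<mu> \<in> Sinf" and n: "1 \<le> n" for \<mu> n
  proof -
    note S = remainder_pow(1)[OF \<mu>]
    define Z where "Z = ns (marg \<mu>) + sup_norm \<mu>"
    have z: "0 \<le> ns (marg \<mu>)" "0 \<le> sup_norm \<mu>" by (rule ns_nonneg[OF Sinf_marg[OF \<mu>]], rule sup_norm(2)[OF Sinf_L[OF \<mu>]])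
    then have Z0: "0 \<le> Z" by (simp add: Z_def)
    have b: "ns (marg ((remainder ^^ n) \<mu>)) \<le> D * r ^ n * Z" if n: "1 \<le> n" for n
    proof -
      have eq: "(\<lambda>x. wmarg ((remainder ^^ n) \<mu>) x * (1 / h x)) = marg ((remainder ^^ n) \<mu>)"
        using h_pos by (auto simp: wmarg_def less_le)
      have "ns (marg ((remainder ^^ n) \<mu>)) \<le> C' * ns (wmarg ((remainder ^^ n) \<mu>))"
        using C'(2)[OF wmarg_Bs[OF S[of n]]] unfolding eq .
      also have "\<dots> \<le> C' * (C\<^sub>0 * r ^ n * (C' * Z))"
      proof (rule mult_left_mono[OF _ C'0])
        have "(Nf ^^ n) (wmarg \<mu>) \<in> Bs"
          by (induction n) (simp_all add: wmarg_Bs[OF \<mu>] Nf_Bs)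
        then have "ns (wmarg ((remainder ^^ n) \<mu>)) = ns ((Nf ^^ n) (wmarg \<mu>))"
          by (rule nfs_norm_cong(2)[OF Bs_normed _ remainder_pow(2)[OF \<mu>]])
        also have "\<dots> \<le> C\<^sub>0 * r ^ n * ns (wmarg \<mu>)" by (rule r(4)[OF wmarg_Bs[OF \<mu>] n])
        also have "\<dots> \<le> C\<^sub>0 * r ^ n * (C' * Z)"
        proof (rule mult_left_mono)
          have "ns (wmarg \<mu>) \<le> C' * ns (marg \<mu>)" unfolding wmarg_def by (rule C'(1)[OF Sinf_marg[OF \<mu>]])
          also have "\<dots> \<le> C' * Z" using z C'0 by (intro mult_left_mono) (auto simp: Z_def)
          finally show "ns (wmarg \<mu>) \<le> C' * Z" .
        qed (use r in simp)
        finally show "ns (wmarg ((remainder ^^ n) \<mu>)) \<le> C\<^sub>0 * r ^ n * (C' * Z)" .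
      qed
      finally show ?thesis by (simp add: D_def mult_ac)
    qed
    have bw: "nw (marg ((remainder ^^ n) \<mu>)) \<le> D * r ^ n * Z" if "1 \<le> n" for n
      using b[OF that] nw_le[OF Sinf_marg[OF S[of n]]] by simp
    have rn: "D * r ^ n * Z \<le> D * \<xi> ^ n * Z" for n
      using r(2) \<xi>(2) D0 Z0 by (intro mult_right_mono mult_left_mono power_mono) auto
    \<comment> \<open>The invariant measure has density 1, so the coefficient is a.e. the difference
      of the marginals of \<open>push \<mu>\<close> and \<open>remainder \<mu>\<close>. Both are
      bounded a.e. by their weak norms, without a bound on \<open>Pf\<close>.\<close>
    have "\<bar>coeff \<mu>\<bar> \<le> sup_norm \<mu> + D * r * Z"
    proof -
      have "AE x in \<nu>. \<bar>coeff \<mu>\<bar> \<le> sup_norm \<mu> + D * r * Z"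
        using marg_lin[OF Sinf_AB[OF push_Sinf[OF \<mu>]] Sinf_AB[OF inv_sm_Sinf], of 1 "- coeff \<mu>"] inv_sm_restriction(3)
          marg_bound(1)[OF Sinf_L[OF push_Sinf[OF \<mu>]]] marg_bound(1)[OF Sinf_L[OF remainder_Sinf[OF \<mu>]]]
        unfolding remainder_def[symmetric]
      proof eventually_elim
        case (elim x)
        have "nw (marg (push \<mu>)) \<le> sup_norm \<mu>"
          using marg_bound(2)[OF Sinf_L[OF push_Sinf[OF \<mu>]]] push_L(2)[OF Sinf_L[OF \<mu>]] by simp
        moreover have "nw (marg (remainder \<mu>)) \<le> D * r * Z" using bw[of 1] by simp
        moreover have "coeff \<mu> = marg (push \<mu>) x - marg (remainder \<mu>) x" using elim(1,2) by simp
        ultimately show ?case using elim(3,4) by linarith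
      qed
      then show ?thesis by (rule AE_const)
    qed
    moreover have "sup_norm (remainder \<mu>) \<le> 1 * sup_norm (push \<mu>) + \<bar>coeff \<mu>\<bar> * sup_norm inv_sm"
      using L_lin(2)[OF Sinf_L[OF push_Sinf[OF \<mu>]] Sinf_L[OF inv_sm_Sinf], of 1 "- coeff \<mu>"] by (simp add: remainder_def)
    moreover have "\<bar>coeff \<mu>\<bar> * sup_norm inv_sm \<le> \<bar>coeff \<mu>\<bar> * 1" using inv_sm_L(2) by (intro mult_left_mono) auto
    moreover have "sup_norm (push \<mu>) \<le> sup_norm \<mu>" by (rule push_L(2)[OF Sinf_L[OF \<mu>]])
    \<comment> \<open>The norm of \<mu> enters twice: through \<open>push \<mu>\<close> and through
      the bound on the coefficient.\<close>
    ultimately have first: "sup_norm (remainder \<mu>) \<le> 2 * sup_norm \<mu> + D * r * Z" by linarith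
    \<comment> \<open>The induction starts at 1 because \<open>remainder \<mu>\<close> itself is in
      general not \<open>push \<mu>\<close>.\<close>
    have a: "sup_norm ((remainder ^^ n) \<mu>) \<le> K * \<xi> ^ n * Z" using n
    proof (induction n rule: dec_induct)
      case base
      have "D * r * Z \<le> D * 1 * Z" using D0 Z0 r by (intro mult_right_mono mult_left_mono) auto
      then have "sup_norm (remainder \<mu>) \<le> (2 + D) * Z" using first z by (simp add: Z_def algebra_simps)
      also have "\<dots> \<le> K * \<xi> * Z" using K1 Z0 by (intro mult_right_mono)
      finally show ?case by simp
    next
      case (step n)
      \<comment> \<open>As \<open>n \<ge> 1\<close>, the iterate is itself a remainder and has
        coefficient zero, so \<open>lasota_yorke\<close> applies to the next step.\<close>
      have "remainder ((remainder ^^ n) \<mu>) = push ((remainder ^^ n) \<mu>)"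
      proof -
        obtain k where "n = Suc k" using step(1) by (cases n) auto
        then have "coeff ((remainder ^^ n) \<mu>) = 0" using coeff_remainder[OF S[of k]] by simp
        then show ?thesis by (simp add: remainder_def[of "(remainder ^^ n) \<mu>"])
      qed
      then have "sup_norm ((remainder ^^ Suc n) \<mu>) \<le> \<alpha> * sup_norm ((remainder ^^ n) \<mu>) + nw (marg ((remainder ^^ n) \<mu>))"
        using lasota_yorke[OF Sinf_L[OF S[of n]]] by simp
      also have "\<dots> \<le> \<alpha> * (K * \<xi> ^ n * Z) + D * \<xi> ^ n * Z"
        using step bw[of n] rn[of n] \<alpha> by (intro add_mono mult_left_mono) auto
      also have "\<dots> = (\<alpha> * K + D) * (\<xi> ^ n * Z)" by (simp add: algebra_simps)
      also have "\<dots> \<le> (K * \<xi>) * (\<xi> ^ n * Z)" using K2 Z0 \<xi> by (intro mult_right_mono) auto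
      also have "\<dots> = K * \<xi> ^ Suc n * Z" by simp
      finally show ?case .
    qed
    have "0 \<le> \<xi> ^ n * Z" using Z0 \<xi> by simp
    with a b[OF n] rn[of n] show ?thesis
      unfolding Z_def[symmetric] by (simp add: algebra_simps)
  qed
  show ?thesis
    using \<xi> D0 K0 main by (intro exI[of _ \<xi>] exI[of _ "D + K + 1"]) (auto simp: norm_S_infty_def sup_norm_def)
qed

lemma spectral_gap_decomposition:
  defines "Fbar \<equiv> \<lambda>\<mu>. (1 / l) *\<^sub>R skew_transfer f G \<phi> h m d P \<mu>"
  shows "(\<forall>\<mu>\<in>Sinf. Fbar \<mu> \<in> Sinf) \<and>
    (\<exists>Pr N. linear_operator_on Sinf Pr \<and> linear_operator_on Sinf N \<and>
       (\<forall>\<mu>\<in>Sinf. Fbar \<mu> = Pr \<mu> + N \<mu>) \<and>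
       (\<forall>\<mu>\<in>Sinf. Pr (Pr \<mu>) = Pr \<mu>) \<and> dim (Pr ` Sinf) = 1 \<and>
       (\<exists>\<xi>\<^sub>2 R\<^sub>2. 0 < \<xi>\<^sub>2 \<and> \<xi>\<^sub>2 < 1 \<and> 0 < R\<^sub>2 \<and>
          (\<forall>\<mu>\<in>Sinf. \<forall>n\<ge>1. norm_S_infty no m ns ((N ^^ n) \<mu>) \<le> R\<^sub>2 * \<xi>\<^sub>2 ^ n * norm_S_infty no m ns \<mu>)) \<and>
       (\<forall>\<mu>\<in>Sinf. Pr (N \<mu>) = 0 \<and> N (Pr \<mu>) = 0))"
proof -
  have Fbar: "Fbar \<mu> = push \<mu>" if "\<mu> \<in> Sinf" for \<mu>
    using skew_transfer_eq[OF Sinf_AB[OF that]] l_pos by (simp add: Fbar_def)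
  define Pr where "Pr \<mu> = coeff \<mu> *\<^sub>R inv_sm" for \<mu>
  have inv_sm_scale: "c *\<^sub>R inv_sm \<in> Sinf" for c using Sinf_lin[OF inv_sm_Sinf inv_sm_Sinf, of c 0] by simp
  have coeff_scale: "coeff (c *\<^sub>R inv_sm) = c" for c using coeff_lin[OF inv_sm_Sinf inv_sm_Sinf, of c 0] by (simp add: coeff_inv_sm)
  have "linear_operator_on Sinf Pr"
    unfolding linear_operator_on_def Pr_def by (simp add: inv_sm_scale coeff_lin scaleR_add_left)
  moreover have "linear_operator_on Sinf remainder"
    unfolding linear_operator_on_def by (simp add: remainder_Sinf remainder_lin)
  moreover have "\<forall>\<mu>\<in>Sinf. Fbar \<mu> = Pr \<mu> + remainder \<mu>"
    by (simp add: Fbar Pr_def remainder_def)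
  moreover have "\<forall>\<mu>\<in>Sinf. Pr (Pr \<mu>) = Pr \<mu>"
    by (simp add: Pr_def coeff_scale)
  moreover have "dim (Pr ` Sinf) = 1"
  proof -
    \<comment> \<open>Each multiple of the invariant measure is fixed by \<open>Pr\<close>, so the
      image is the whole line.\<close>
    have "Pr ` Sinf = span {inv_sm}"
      unfolding span_singleton
    proof (intro equalityI subsetI)
      fix x assume "x \<in> range (\<lambda>c. c *\<^sub>R inv_sm)"
      then obtain c where "x = c *\<^sub>R inv_sm" by auto
      then show "x \<in> Pr ` Sinf" by (intro image_eqI[of _ _ x]) (simp_all add: Pr_def inv_sm_scale coeff_scale)
    qed (auto simp: Pr_def)
    then have "dim (Pr ` Sinf) = card {inv_sm}"
      using inv_sm_nonzero by (simp add: dim_span dim_eq_card_independent)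
    then show ?thesis by simp
  qed
  moreover have "\<forall>\<mu>\<in>Sinf. Pr (remainder \<mu>) = 0 \<and> remainder (Pr \<mu>) = 0"
    by (simp add: Pr_def coeff_remainder remainder_inv_sm)
  moreover have "\<forall>\<mu>\<in>Sinf. Fbar \<mu> \<in> Sinf" by (simp add: Fbar push_Sinf)
  ultimately show ?thesis using remainder_decay by blast
qed

end

section \<open>The decomposition from the stated hypotheses\<close>

theorem theoremE:
  fixes f :: "'m::polish_space \<Rightarrow> 'm"
    and G :: "'m \<times> 'k::polish_space \<Rightarrow> 'k"
    and PM :: "('m \<Rightarrow> real) set"
    and \<phi> h :: "'m \<Rightarrow> real"
    and m \<nu> :: "'m measure"
    and l \<alpha> :: real
    and Bs Bw :: "('m \<Rightarrow> real) set"
    and ns nw :: "('m \<Rightarrow> real) \<Rightarrow> real"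
    and d :: nat
    and P :: "nat \<Rightarrow> 'm set"
    and no :: "'k signed_measure \<Rightarrow> real"
  defines "Fbar \<equiv> \<lambda>\<mu>. (1 / l) *\<^sub>R skew_transfer f G \<phi> h m d P \<mu>"
    and "S \<equiv> S_infty no m Bs"
  assumes compact_K: "compact (UNIV :: 'k set)"
    and f_measurable: "f \<in> borel_measurable borel"
    and G_measurable: "G \<in> borel_measurable borel"
    and P1: "\<And>\<psi>. \<psi> \<in> PM \<Longrightarrow> \<exists>m' h' \<nu>' l' Bs' ns' Bw' nw'.
               equilibrium_data f \<psi> m' h' \<nu>' l' \<and> spectral_gap_data f \<psi> h' \<nu>' l' Bs' ns' Bw' nw'"
    and potential: "\<phi> \<in> PM"
    and potential_data: "equilibrium_data f \<phi> m h \<nu> l" "spectral_gap_data f \<phi> h \<nu> l Bs ns Bw nw"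
    and P2: "branch_partition f \<nu> d P"
    and P3: "\<exists>\<mu>\<^sub>0. invariant_prob (skew_product f G) \<mu>\<^sub>0 \<and> distr \<mu>\<^sub>0 borel fst = m"
    and G1: "is_norm no" "0 \<le> \<alpha>" "\<alpha> < 1"
      "AE \<gamma> in \<nu>. \<forall>\<mu>. no (sm_push (\<lambda>y. G (\<gamma>, y)) \<mu>) \<le> \<alpha> * no \<mu> + \<bar>sm \<mu> UNIV\<bar>"
      "\<And>\<gamma> \<mu>. no (sm_push (\<lambda>y. G (\<gamma>, y)) \<mu>) \<le> no \<mu>"
    and G2: "\<And>g. g \<in> Bw \<Longrightarrow> g \<in> borel_measurable (completion \<nu>) \<and> ess_sup \<nu> (\<lambda>x. \<bar>g x\<bar>) < \<infinity>"
      "\<And>\<mu>. \<mu> \<in> L_infty no m \<Longrightarrow> marginal_density m \<mu> \<in> Bw \<and>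
          ess_sup \<nu> (\<lambda>x. \<bar>marginal_density m \<mu> x\<bar>) \<le> ereal (nw (marginal_density m \<mu>)) \<and>
          ereal (nw (marginal_density m \<mu>)) \<le> norm_infty no m \<mu>"
    and G3: "\<And>\<eta>. prob_space \<eta> \<Longrightarrow> sets \<eta> = sets borel \<Longrightarrow> no (sm_of \<eta>) = 1"
  shows "(\<forall>\<mu>\<in>S. Fbar \<mu> \<in> S) \<and>
    (\<exists>Pr N. linear_operator_on S Pr \<and> linear_operator_on S N \<and>
       (\<forall>\<mu>\<in>S. Fbar \<mu> = Pr \<mu> + N \<mu>) \<and>
       (\<forall>\<mu>\<in>S. Pr (Pr \<mu>) = Pr \<mu>) \<and> dim (Pr ` S) = 1 \<and>
       (\<exists>\<xi>\<^sub>2 R\<^sub>2. 0 < \<xi>\<^sub>2 \<and> \<xi>\<^sub>2 < 1 \<and> 0 < R\<^sub>2 \<and>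
          (\<forall>\<mu>\<in>S. \<forall>n\<ge>1. norm_S_infty no m ns ((N ^^ n) \<mu>) \<le> R\<^sub>2 * \<xi>\<^sub>2 ^ n * norm_S_infty no m ns \<mu>)) \<and>
       (\<forall>\<mu>\<in>S. Pr (N \<mu>) = 0 \<and> N (Pr \<mu>) = 0))"
proof -
  obtain \<mu>\<^sub>0 where \<mu>0: "invariant_prob (skew_product f G) \<mu>\<^sub>0" "distr \<mu>\<^sub>0 borel fst = m"
    using P3 by blast
  have Bs_normed: "normed_function_space \<nu> Bs ns" and fso: "function_space_operator \<nu> Bs (transfer f \<phi>)"
    and sd: "\<exists>Pf Nf. spectral_decomposition \<nu> Bs ns (\<lambda>g x. transfer f \<phi> g x / l) Pf Nf"
    using potential_data(2) unfolding spectral_gap_data_def by simp_all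
  obtain Pf Nf where spectral: "spectral_decomposition \<nu> Bs ns (\<lambda>g x. transfer f \<phi> g x / l) Pf Nf"
    using sd by blast
  have "sets \<nu> = sets borel"
    using potential_data(1) unfolding equilibrium_data_def conformal_measure_def by blast
  then have space: "space \<nu> = UNIV" using sets_eq_imp_space_eq by fastforce
  \<comment> \<open>The remaining locale condition, that \<open>f\<close> maps null sets into null
    sets, comes from the transfer operator being well defined on classes modulo null sets.\<close>
  interpret skew_gap f G \<phi> h m \<nu> l d P Bs Bw ns nw \<alpha> no Pf Nf \<mu>\<^sub>0
  proof
    show "\<exists>N'\<in>null_sets \<nu>. f ` N \<subseteq> N'" if "N \<in> null_sets \<nu>" for N
      by (rule transfer_null_image[OF Bs_normed fso space that])
  qed (use assms \<mu>0 spectral in auto)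
  show ?thesis
    unfolding Fbar_def S_def by (rule spectral_gap_decomposition)
qed

end
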